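(* Let $0<\alpha,\beta<\infty$, let $\varphi:D\to D$ be an analytic self-map of $D$, let $g\in H(D)$, and suppose that the operator $C_\varphi U_g:\mathcal{Z}^\alpha\to\mathcal{Z}^\beta$, $(C_\varphi U_g f)(z)=\int_0^{\varphi(z)} f(\xi)g'(\xi)\,d\xi$, is bounded. (i) If $0<\alpha<1$, then $\|C_\varphi U_g\|_{e,\mathcal{Z}^\alpha\to\mathcal{Z}^\beta}=0$. (ii) If $\alpha=1$, then $$\|C_\varphi U_g\|_{e,\mathcal{Z}^1\to\mathcal{Z}^\beta}\asymp\limsup_{n\to\infty}(\log n)\|(g'\circ\varphi)(\varphi')^2\varphi^n\|_{v_\beta}.$$ (iii) If $1<\alpha<2$, then $$\|C_\varphi U_g\|_{e,\mathcal{Z}^\alpha\to\mathcal{Z}^\beta}\asymp\limsup_{n\to\infty}(n+1)^{\alpha-1}\|(g'\circ\varphi)(\varphi')^2\varphi^n\|_{v_\beta}.$$ (iv) If $\alpha=2$, then $$\|C_\varphi U_g\|_{e,\mathcal{Z}^2\to\mathcal{Z}^\beta}\asymp\max\Big\{\limsup_{n\to\infty}(n+1)\|(g'\circ\varphi)(\varphi')^2\varphi^n\|_{v_\beta},\ \limsup_{n\to\infty}(\log n)\|((g''\circ\varphi)(\varphi')^2+(g'\circ\varphi)\varphi'')\varphi^n\|_{v_\beta}\Big\}.$$ (v) If $\alpha>2$, then $$\|C_\varphi U_g\|_{e,\mathcal{Z}^\alpha\to\mathcal{Z}^\beta}\asymp\max\Big\{\limsup_{n\to\infty}(n+1)^{\alpha-1}\|(g'\circ\varphi)(\varphi')^2\varphi^n\|_{v_\beta},\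 \limsup_{n\to\infty}(n+1)^{\alpha-2}\|((g''\circ\varphi)(\varphi')^2+(g'\circ\varphi)\varphi'')\varphi^n\|_{v_\beta}\Big\}.$$
   Context: $D=\{z\in\mathbb{C}:|z|<1\}$ and $H(D)$ is the set of analytic functions on $D$. For $0<\alpha<\infty$, the Zygmund type space $\mathcal{Z}^\alpha$ is the Banach space of $f\in H(D)$ with $\sup_{z\in D}(1-|z|^2)^\alpha|f''(z)|<\infty$, normed by $\|f\|_{\mathcal{Z}^\alpha}=|f(0)|+|f'(0)|+\sup_{z\in D}(1-|z|^2)^\alpha|f''(z)|$. For $0<\beta<\infty$, $v_\beta(z)=(1-|z|^2)^\beta$ and $\|h\|_{v_\beta}=\sup_{z\in D}v_\beta(z)|h(z)|$ for $h\in H(D)$. $\varphi^n$ denotes the $n$-th power (pointwise product) of $\varphi$. The essential norm of a bounded linear operator $T:X\to Y$ is $\|T\|_{e,X\to Y}=\inf\{\|T+K\|_{X\to Y}: K:X\to Y\text{ compact}\}$. $A\asymp B$ means that there are positive constants $C_1,C_2$ with $C_1A\le B\le C_2A$ (constants not depending on $g$ or $\varphi$). *)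

theory Defs
  imports "HOL-Complex_Analysis.Complex_Analysis"
begin

abbreviation unit_disc :: "complex set" where
  "unit_disc \<equiv> ball 0 1"

definition weight :: "real \<Rightarrow> complex \<Rightarrow> real" where
  "weight \<beta> z = (1 - (cmod z)\<^sup>2) powr \<beta>"

text \<open>The weighted supremum norm is extended-real valued: it may be infinite for an arbitrary
  holomorphic function.\<close>

definition weighted_norm :: "real \<Rightarrow> (complex \<Rightarrow> complex) \<Rightarrow> ereal" where
  "weighted_norm \<beta> h = (SUP z\<in>unit_disc. ereal (weight \<beta> z * cmod (h z)))"


subsection \<open>Zygmund type spaces\<close>

text \<open>Functions on the disc are represented by total functions vanishing off the disc, so that
  equality of elements of the space is equality of functions and the norm is definite.\<close>

definition zygmund_space :: "real \<Rightarrow> (complex \<Rightarrow> complex) set" where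
  "zygmund_space \<alpha> = {f. f holomorphic_on unit_disc \<and> (\<forall>z. z \<notin> unit_disc \<longrightarrow> f z = 0) \<and>
     weighted_norm \<alpha> (deriv (deriv f)) < \<infinity>}"

definition zygmund_norm :: "real \<Rightarrow> (complex \<Rightarrow> complex) \<Rightarrow> real" where
  "zygmund_norm \<alpha> f =
     cmod (f 0) + cmod (deriv f 0) + real_of_ereal (weighted_norm \<alpha> (deriv (deriv f)))"

text \<open>The value 0 off the space only serves to satisfy the axioms of \<^locale>\<open>Metric_space\<close>, which
  require symmetry and nonnegativity on the whole type.\<close>

definition zygmund_dist :: "real \<Rightarrow> (complex \<Rightarrow> complex) \<Rightarrow> (complex \<Rightarrow> complex) \<Rightarrow> real" where
  "zygmund_dist \<alpha> f h =
     (if f \<in> zygmund_space \<alpha> \<and> h \<in> zygmund_space \<alpha> then zygmund_norm \<alpha> (\<lambda>z. f z - h z) else 0)"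

definition zygmund_topology :: "real \<Rightarrow> (complex \<Rightarrow> complex) topology" where
  "zygmund_topology \<alpha> = Metric_space.mtopology (zygmund_space \<alpha>) (zygmund_dist \<alpha>)"

definition zygmund_unit_ball :: "real \<Rightarrow> (complex \<Rightarrow> complex) set" where
  "zygmund_unit_ball \<alpha> = {f \<in> zygmund_space \<alpha>. zygmund_norm \<alpha> f \<le> 1}"


subsection \<open>Operators and essential norm\<close>

type_synonym fun_operator = "(complex \<Rightarrow> complex) \<Rightarrow> complex \<Rightarrow> complex"

definition linear_operator :: "real \<Rightarrow> real \<Rightarrow> fun_operator \<Rightarrow> bool" where
  "linear_operator \<alpha> \<beta> T \<longleftrightarrow>
     (\<forall>f\<in>zygmund_space \<alpha>. T f \<in> zygmund_space \<beta>) \<and>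
     (\<forall>f\<in>zygmund_space \<alpha>. \<forall>h\<in>zygmund_space \<alpha>. T (\<lambda>z. f z + h z) = (\<lambda>z. T f z + T h z)) \<and>
     (\<forall>c. \<forall>f\<in>zygmund_space \<alpha>. T (\<lambda>z. c * f z) = (\<lambda>z. c * T f z))"

definition bounded_operator :: "real \<Rightarrow> real \<Rightarrow> fun_operator \<Rightarrow> bool" where
  "bounded_operator \<alpha> \<beta> T \<longleftrightarrow> linear_operator \<alpha> \<beta> T \<and>
     (\<exists>C. \<forall>f\<in>zygmund_space \<alpha>. zygmund_norm \<beta> (T f) \<le> C * zygmund_norm \<alpha> f)"

definition compact_operator :: "real \<Rightarrow> real \<Rightarrow> fun_operator \<Rightarrow> bool" where
  "compact_operator \<alpha> \<beta> K \<longleftrightarrow> linear_operator \<alpha> \<beta> K \<and>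
     compactin (zygmund_topology \<beta>) (zygmund_topology \<beta> closure_of (K ` zygmund_unit_ball \<alpha>))"

definition operator_norm :: "real \<Rightarrow> real \<Rightarrow> fun_operator \<Rightarrow> ereal" where
  "operator_norm \<alpha> \<beta> T = (SUP f\<in>zygmund_unit_ball \<alpha>. ereal (zygmund_norm \<beta> (T f)))"

definition essential_norm :: "real \<Rightarrow> real \<Rightarrow> fun_operator \<Rightarrow> ereal" where
  "essential_norm \<alpha> \<beta> T =
     (INF K\<in>{K. compact_operator \<alpha> \<beta> K}. operator_norm \<alpha> \<beta> (\<lambda>f z. T f z + K f z))"

definition comp_volterra :: "(complex \<Rightarrow> complex) \<Rightarrow> (complex \<Rightarrow> complex) \<Rightarrow> fun_operator" where
  "comp_volterra \<phi> g f z =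
     (if z \<in> unit_disc then contour_integral (linepath 0 (\<phi> z)) (\<lambda>\<xi>. f \<xi> * deriv g \<xi>) else 0)"

definition admissible :: "real \<Rightarrow> real \<Rightarrow> (complex \<Rightarrow> complex) \<Rightarrow> (complex \<Rightarrow> complex) \<Rightarrow> bool" where
  "admissible \<alpha> \<beta> \<phi> g \<longleftrightarrow>
     \<phi> holomorphic_on unit_disc \<and> \<phi> ` unit_disc \<subseteq> unit_disc \<and> g holomorphic_on unit_disc \<and>
     bounded_operator \<alpha> \<beta> (comp_volterra \<phi> g)"

text \<open>The constants are chosen before the pair of functions, hence independent of it.\<close>

definition comparable :: "('a \<Rightarrow> 'b \<Rightarrow> bool) \<Rightarrow> ('a \<Rightarrow> 'b \<Rightarrow> ereal) \<Rightarrow> ('a \<Rightarrow> 'b \<Rightarrow> ereal) \<Rightarrow> bool" where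
  "comparable P A B \<longleftrightarrow> (\<exists>C\<^sub>1 C\<^sub>2 :: real. C\<^sub>1 > 0 \<and> C\<^sub>2 > 0 \<and>
     (\<forall>x y. P x y \<longrightarrow> ereal C\<^sub>1 * A x y \<le> B x y \<and> B x y \<le> ereal C\<^sub>2 * A x y))"

definition first_symbol :: "(complex \<Rightarrow> complex) \<Rightarrow> (complex \<Rightarrow> complex) \<Rightarrow> complex \<Rightarrow> complex" where
  "first_symbol \<phi> g z = deriv g (\<phi> z) * (deriv \<phi> z)\<^sup>2"

definition second_symbol :: "(complex \<Rightarrow> complex) \<Rightarrow> (complex \<Rightarrow> complex) \<Rightarrow> complex \<Rightarrow> complex" where
  "second_symbol \<phi> g z =
     deriv (deriv g) (\<phi> z) * (deriv \<phi> z)\<^sup>2 + deriv g (\<phi> z) * deriv (deriv \<phi>) z"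


subsection \<open>The Zygmund metric\<close>

lemma weight_pos: "z \<in> unit_disc \<Longrightarrow> weight \<beta> z > 0"
proof -
  assume "z \<in> unit_disc"
  then have "(cmod z)\<^sup>2 < 1" by (simp add: abs_square_less_1)
  then show ?thesis by (simp add: weight_def)
qed

lemma weighted_norm_nonneg: "0 \<le> weighted_norm \<beta> h"
  unfolding weighted_norm_def
  by (rule SUP_upper2[of 0]) (auto simp: weight_def)

lemma weighted_norm_upper:
  assumes "weighted_norm \<beta> h < \<infinity>" "z \<in> unit_disc"
  shows "weight \<beta> z * cmod (h z) \<le> real_of_ereal (weighted_norm \<beta> h)"
proof -
  have "ereal (weight \<beta> z * cmod (h z)) \<le> weighted_norm \<beta> h"
    unfolding weighted_norm_def using assms(2) by (intro SUP_upper)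
  moreover have "weighted_norm \<beta> h = ereal (real_of_ereal (weighted_norm \<beta> h))"
    using assms(1) weighted_norm_nonneg[of \<beta> h] by (cases "weighted_norm \<beta> h") auto
  ultimately show ?thesis by (metis ereal_less_eq(3))
qed

lemma weighted_norm_least:
  assumes "\<And>z. z \<in> unit_disc \<Longrightarrow> weight \<beta> z * cmod (h z) \<le> c"
  shows "weighted_norm \<beta> h \<le> ereal c" "real_of_ereal (weighted_norm \<beta> h) \<le> c"
proof -
  show *: "weighted_norm \<beta> h \<le> ereal c"
    unfolding weighted_norm_def using assms by (intro SUP_least) auto
  show "real_of_ereal (weighted_norm \<beta> h) \<le> c"
    using * weighted_norm_nonneg[of \<beta> h] by (cases "weighted_norm \<beta> h") auto
qed

lemma weighted_norm_diff:
  assumes "weighted_norm \<beta> h < \<infinity>" "weighted_norm \<beta> k < \<infinity>"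
    "\<And>z. z \<in> unit_disc \<Longrightarrow> l z = h z - k z"
  shows "weighted_norm \<beta> l < \<infinity>"
    "real_of_ereal (weighted_norm \<beta> l) \<le>
       real_of_ereal (weighted_norm \<beta> h) + real_of_ereal (weighted_norm \<beta> k)"
proof -
  have *: "weight \<beta> z * cmod (l z) \<le>
      real_of_ereal (weighted_norm \<beta> h) + real_of_ereal (weighted_norm \<beta> k)"
    if "z \<in> unit_disc" for z
  proof -
    have "weight \<beta> z * cmod (l z) \<le> weight \<beta> z * (cmod (h z) + cmod (k z))"
      using assms(3)[OF that] weight_pos[OF that, of \<beta>]
      by (intro mult_left_mono) (auto simp: norm_triangle_ineq4)
    then show ?thesis
      using weighted_norm_upper[OF assms(1) that] weighted_norm_upper[OF assms(2) that]
      by (simp add: distrib_left)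
  qed
  show "real_of_ereal (weighted_norm \<beta> l) \<le>
       real_of_ereal (weighted_norm \<beta> h) + real_of_ereal (weighted_norm \<beta> k)"
    by (rule weighted_norm_least(2)) (rule *)
  show "weighted_norm \<beta> l < \<infinity>"
    using weighted_norm_least(1)[OF *] by (rule order.strict_trans1) auto
qed

lemma deriv_diff_disc:
  assumes "f holomorphic_on unit_disc" "h holomorphic_on unit_disc" "z \<in> unit_disc"
  shows "deriv (\<lambda>z. f z - h z) z = deriv f z - deriv h z"
    "deriv (deriv (\<lambda>z. f z - h z)) z = deriv (deriv f) z - deriv (deriv h) z"
proof -
  have 1: "deriv (\<lambda>z. f z - h z) w = deriv f w - deriv h w" if "w \<in> unit_disc" for w
    using assms that by (intro deriv_diff holomorphic_on_imp_differentiable_at) auto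
  then show "deriv (\<lambda>z. f z - h z) z = deriv f z - deriv h z" using assms by blast
  have "deriv (deriv (\<lambda>z. f z - h z)) z = deriv (\<lambda>w. deriv f w - deriv h w) z"
    using 1 assms(3)
    by (intro deriv_cong_ev eventually_mono[OF eventually_nhds_in_open[of unit_disc z]]) auto
  also have "\<dots> = deriv (deriv f) z - deriv (deriv h) z"
    using assms
    by (intro deriv_diff holomorphic_on_imp_differentiable_at[of _ unit_disc] holomorphic_deriv) auto
  finally show "deriv (deriv (\<lambda>z. f z - h z)) z = deriv (deriv f) z - deriv (deriv h) z" .
qed

lemma zygmund_norm_nonneg: "0 \<le> zygmund_norm \<alpha> f"
  unfolding zygmund_norm_def by (simp add: real_of_ereal_pos weighted_norm_nonneg)

lemma zygmund_space_diff:
  assumes "f \<in> zygmund_space \<alpha>" "h \<in> zygmund_space \<alpha>"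
  shows "(\<lambda>z. f z - h z) \<in> zygmund_space \<alpha>"
    "zygmund_norm \<alpha> (\<lambda>z. f z - h z) \<le> zygmund_norm \<alpha> f + zygmund_norm \<alpha> h"
proof -
  have *: "f holomorphic_on unit_disc" "h holomorphic_on unit_disc"
    "weighted_norm \<alpha> (deriv (deriv f)) < \<infinity>" "weighted_norm \<alpha> (deriv (deriv h)) < \<infinity>"
    using assms by (auto simp: zygmund_space_def)
  note wd = weighted_norm_diff[OF *(3,4) deriv_diff_disc(2)[OF *(1,2)]]
  show "(\<lambda>z. f z - h z) \<in> zygmund_space \<alpha>"
    using assms wd(1) by (auto simp: zygmund_space_def intro!: holomorphic_intros)
  show "zygmund_norm \<alpha> (\<lambda>z. f z - h z) \<le> zygmund_norm \<alpha> f + zygmund_norm \<alpha> h"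
    using wd(2) norm_triangle_ineq4[of "f 0" "h 0"] norm_triangle_ineq4[of "deriv f 0" "deriv h 0"]
      deriv_diff_disc(1)[OF *(1,2), of 0]
    by (simp add: zygmund_norm_def)
qed

lemma zygmund_norm_eq_0:
  assumes "f \<in> zygmund_space \<alpha>" "zygmund_norm \<alpha> f = 0"
  shows "f z = 0"
proof (cases "z \<in> unit_disc")
  case True
  have hol: "f holomorphic_on unit_disc" and fin: "weighted_norm \<alpha> (deriv (deriv f)) < \<infinity>"
    using assms(1) by (auto simp: zygmund_space_def)
  have "0 \<le> real_of_ereal (weighted_norm \<alpha> (deriv (deriv f)))"
    by (simp add: real_of_ereal_pos weighted_norm_nonneg)
  then have 0: "f 0 = 0" "deriv f 0 = 0" "real_of_ereal (weighted_norm \<alpha> (deriv (deriv f))) = 0"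
    using assms(2) norm_ge_zero[of "f 0"] norm_ge_zero[of "deriv f 0"]
    unfolding zygmund_norm_def by (smt (verit) norm_le_zero_iff)+
  have d2: "deriv (deriv f) w = 0" if "w \<in> unit_disc" for w
    using weighted_norm_upper[OF fin that] weight_pos[OF that, of \<alpha>] 0(3)
    by (simp add: mult_le_0_iff)
  have const: "k w = 0" if "k holomorphic_on unit_disc" "k 0 = 0"
    "\<And>w. w \<in> unit_disc \<Longrightarrow> deriv k w = 0" "w \<in> unit_disc" for k w
  proof -
    note k = that(1,3)
    have "(k has_field_derivative 0) (at v within unit_disc)" if "v \<in> unit_disc" for v
      using holomorphic_derivI[OF k(1) open_ball that, of UNIV]
      unfolding k(2)[OF that] by (rule has_field_derivative_at_within)
    then have "\<exists>c. \<forall>v\<in>unit_disc. k v = c"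
      by (intro has_field_derivative_zero_constant convex_ball)
    then obtain c where c: "\<forall>v\<in>unit_disc. k v = c" ..
    then have "k 0 = c" "k w = c" using that(4) by simp_all
    then show ?thesis using that(2) by simp
  qed
  have "deriv f w = 0" if "w \<in> unit_disc" for w
    using const[of "deriv f" w] hol 0 d2 that by (simp add: holomorphic_deriv)
  then show ?thesis using const[of f z] hol 0 True by simp
qed (use assms in \<open>auto simp: zygmund_space_def\<close>)

lemma zygmund_space_zero:
  "(\<lambda>_. 0) \<in> zygmund_space \<alpha>" "zygmund_norm \<alpha> (\<lambda>_. 0) = 0"
proof -
  have "deriv (\<lambda>_. 0 :: complex) = (\<lambda>_ :: complex. 0)" by auto
  then have *: "weighted_norm \<alpha> (deriv (deriv (\<lambda>_. 0))) = 0"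
    using weighted_norm_least(1)[of \<alpha> "\<lambda>_. 0" 0] weighted_norm_nonneg[of \<alpha> "\<lambda>_. 0"]
    by (simp add: zero_ereal_def[symmetric])
  then show "(\<lambda>_. 0) \<in> zygmund_space \<alpha>" "zygmund_norm \<alpha> (\<lambda>_. 0) = 0"
    by (auto simp: zygmund_space_def zygmund_norm_def)
qed

lemma Metric_space_zygmund: "Metric_space (zygmund_space \<alpha>) (zygmund_dist \<alpha>)"
proof
  show "0 \<le> zygmund_dist \<alpha> f h" for f h
    by (simp add: zygmund_dist_def zygmund_norm_nonneg)
  have le: "zygmund_norm \<alpha> (\<lambda>z. f z - h z) \<le> zygmund_norm \<alpha> (\<lambda>z. h z - f z)"
    if "f \<in> zygmund_space \<alpha>" "h \<in> zygmund_space \<alpha>" for f h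
    using zygmund_space_diff(2)[OF zygmund_space_zero(1) zygmund_space_diff(1)[OF that(2,1)]]
    by (simp add: zygmund_space_zero(2))
  then show "zygmund_dist \<alpha> f h = zygmund_dist \<alpha> h f" for f h
    by (auto simp: zygmund_dist_def intro!: antisym)
  show "zygmund_dist \<alpha> f h = 0 \<longleftrightarrow> f = h"
    if "f \<in> zygmund_space \<alpha>" "h \<in> zygmund_space \<alpha>" for f h
    using zygmund_norm_eq_0[OF zygmund_space_diff(1)[OF that]] that zygmund_space_zero(2)
    by (auto simp: zygmund_dist_def fun_eq_iff)
  show "zygmund_dist \<alpha> f k \<le> zygmund_dist \<alpha> f h + zygmund_dist \<alpha> h k"
    if "f \<in> zygmund_space \<alpha>" "h \<in> zygmund_space \<alpha>" "k \<in> zygmund_space \<alpha>" for f h k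
  proof -
    have "zygmund_norm \<alpha> (\<lambda>z. f z - k z) \<le>
        zygmund_norm \<alpha> (\<lambda>z. f z - h z) + zygmund_norm \<alpha> (\<lambda>z. k z - h z)"
      using zygmund_space_diff(2)[OF zygmund_space_diff(1)[OF that(1,2)]
          zygmund_space_diff(1)[OF that(3,2)]] by simp
    then show ?thesis using le[of k h] that by (auto simp: zygmund_dist_def)
  qed
qed

end

theory Submission
  imports Defs
begin

text \<open>Write \<open>T\<close> for the operator and \<open>u\<close>, \<open>v\<close> for the first and second symbol. Differentiating twice gives
  \<open>(T f)'' = u (f' \<circ> \<phi>) + v (f \<circ> \<phi>)\<close>, so up to two integrations \<open>T\<close> is a sum of two weighted composition
  operators applied to \<open>f'\<close> and \<open>f\<close>. For \<open>f\<close> in the unit ball, \<open>f'\<close> grows at most like a constant, a logarithm or \<open>(1 - |z|) powr (1 - \<alpha>)\<close>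
  according to whether \<open>\<alpha>\<close> is below, at or above 1, and \<open>f\<close> behaves in the same way with 2 in place of 1.
  The essential norm should measure how large the symbols times these growth functions of \<open>|\<phi> z|\<close> are as
  \<open>|\<phi> z| \<longlonglongrightarrow> 1\<close>.

  Upper bounds. The operator \<open>f \<mapsto> f\<^sub>\<rho>\<close> with \<open>f\<^sub>\<rho>(z) = f(\<rho> z)\<close> is compact by Montel's theorem, hence so is
  \<open>f \<mapsto> - T f\<^sub>\<rho>\<close>. As \<open>\<rho> \<longlonglongrightarrow> 1\<close> the difference \<open>f - f\<^sub>\<rho>\<close> tends to 0 uniformly over the unit ball on compact sets,
  and on the whole disc in the ranges where the growth function is bounded; such terms contribute
  nothing. In the other ranges only points with \<open>|\<phi> z|\<close> near 1 count (lemma \<open>essential_norm_upper\<close>). There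
  the bound for \<open>u \<phi> ^ m\<close> with \<open>m = \<lfloor>1 / (1 - |\<phi> z|)\<rfloor>\<close> bounds \<open>u\<close> itself, since \<open>|\<phi> z| ^ m \<ge> 1/6\<close> (lemma
  \<open>eventual_bound_critical_exponent\<close>).

  Lower bounds. Let \<open>f\<^sub>n\<close> be polynomials in the unit ball whose lowest degree tends to infinity. A gliding
  hump selection produces arbitrarily long sums of them with norm at most 2, and this alone forces
  \<open>K f\<^sub>n \<longlonglongrightarrow> 0\<close> for every compact \<open>K\<close> (lemma \<open>compact_operator_gliding_hump\<close>). So \<open>(T f\<^sub>n)''\<close> is asymptotically bounded by a multiple of the essential norm, uniformly under rotations of
  \<open>f\<^sub>n\<close> (lemma \<open>essential_norm_lower\<close>). With normalized monomials this bounds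
  \<open>n powr (\<alpha> - 2) (n u \<phi> ^ (n - 1) + v \<phi> ^ n)\<close>. For \<open>\<alpha> < 2\<close> the \<open>v\<close> term tends to 0; for \<open>\<alpha> \<ge> 2\<close> comparing the exponents
  \<open>n\<close> and \<open>2 n\<close> isolates \<open>u\<close>, and then \<open>v\<close>. Monomials cannot see logarithmic growth. For \<open>v\<close> at \<open>\<alpha> = 2\<close>
  they are replaced by the blocks \<open>\<Sum> z ^ k / k\<close> over \<open>n \<le> k \<le> n\<^sup>2\<close>, and for \<open>u\<close> at \<open>\<alpha> = 1\<close> by polynomials with
  essentially these blocks as derivatives: they stay in a fixed multiple of the unit ball, while the
  blocks are of order \<open>ln n\<close> where \<open>|z| ^ (n\<^sup>2)\<close> is bounded below.\<close>

section \<open>Functions of Zygmund type\<close>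

lemma zygmund_spaceD:
  assumes "f \<in> zygmund_space \<alpha>"
  shows "f holomorphic_on unit_disc" "\<And>z. z \<notin> unit_disc \<Longrightarrow> f z = 0"
    "cmod (f 0) \<le> zygmund_norm \<alpha> f" "cmod (deriv f 0) \<le> zygmund_norm \<alpha> f"
    "\<And>z. z \<in> unit_disc \<Longrightarrow> weight \<alpha> z * cmod (deriv (deriv f) z) \<le> zygmund_norm \<alpha> f"
proof -
  show "f holomorphic_on unit_disc" "\<And>z. z \<notin> unit_disc \<Longrightarrow> f z = 0"
    using assms by (auto simp: zygmund_space_def)
  have *: "real_of_ereal (weighted_norm \<alpha> (deriv (deriv f))) \<ge> 0"
    by (simp add: real_of_ereal_pos weighted_norm_nonneg)
  then show "cmod (f 0) \<le> zygmund_norm \<alpha> f" "cmod (deriv f 0) \<le> zygmund_norm \<alpha> f"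
    by (auto simp: zygmund_norm_def)
  have "weighted_norm \<alpha> (deriv (deriv f)) < \<infinity>"
    using assms by (auto simp: zygmund_space_def)
  then show "weight \<alpha> z * cmod (deriv (deriv f) z) \<le> zygmund_norm \<alpha> f" if "z \<in> unit_disc" for z
    using weighted_norm_upper[OF _ that, of \<alpha> "deriv (deriv f)"] *
    unfolding zygmund_norm_def by (smt (verit) norm_ge_zero)
qed

lemma zygmund_spaceI:
  assumes "f holomorphic_on unit_disc" "\<And>z. z \<notin> unit_disc \<Longrightarrow> f z = 0"
    "\<And>z. z \<in> unit_disc \<Longrightarrow> weight \<alpha> z * cmod (deriv (deriv f) z) \<le> c"
  shows "f \<in> zygmund_space \<alpha>" "zygmund_norm \<alpha> f \<le> cmod (f 0) + cmod (deriv f 0) + c"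
  using weighted_norm_least[of \<alpha> "deriv (deriv f)" c, OF assms(3)] assms(1,2)
  by (auto simp: zygmund_space_def zygmund_norm_def intro: order.strict_trans1)

lemma eq_on_disc_deriv:
  assumes "\<And>z. z \<in> unit_disc \<Longrightarrow> f z = h z" "z \<in> unit_disc"
  shows "deriv f z = deriv h z" "deriv (deriv f) z = deriv (deriv h) z"
proof -
  have ev: "eventually (\<lambda>w. w \<in> unit_disc) (nhds z)" if "z \<in> unit_disc" for z :: complex
    using that by (intro eventually_nhds_in_open) auto
  have 1: "deriv f z = deriv h z" if "z \<in> unit_disc" for z
    by (rule deriv_cong_ev[OF eventually_mono[OF ev[OF that]] refl]) (rule assms(1))
  then show "deriv f z = deriv h z" using assms by blast
  show "deriv (deriv f) z = deriv (deriv h) z"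
    by (rule deriv_cong_ev[OF eventually_mono[OF ev[OF assms(2)]] refl]) (rule 1)
qed

lemma deriv2_eqI:
  assumes "\<And>z. z \<in> unit_disc \<Longrightarrow> (f has_field_derivative f1 z) (at z)"
    "\<And>z. z \<in> unit_disc \<Longrightarrow> (f1 has_field_derivative f2 z) (at z)" "z \<in> unit_disc"
  shows "deriv f z = f1 z" "deriv (deriv f) z = f2 z"
proof -
  have 1: "deriv f w = f1 w" if "w \<in> unit_disc" for w
    using assms(1)[OF that] by (rule DERIV_imp_deriv)
  then show "deriv f z = f1 z" using assms by blast
  have "deriv (deriv f) z = deriv f1 z"
    by (rule eq_on_disc_deriv(1)[OF 1 assms(3)])
  then show "deriv (deriv f) z = f2 z" using DERIV_imp_deriv[OF assms(2)[OF assms(3)]] by simp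
qed

definition disc_part :: "(complex \<Rightarrow> complex) \<Rightarrow> complex \<Rightarrow> complex" where
  "disc_part f z = (if z \<in> unit_disc then f z else 0)"

lemma disc_part_simps:
  "z \<in> unit_disc \<Longrightarrow> disc_part f z = f z"
  "z \<in> unit_disc \<Longrightarrow> deriv (disc_part f) z = deriv f z"
  "z \<in> unit_disc \<Longrightarrow> deriv (deriv (disc_part f)) z = deriv (deriv f) z"
  by (auto simp: disc_part_def intro!: eq_on_disc_deriv)

lemma disc_part_zygmund:
  assumes "f holomorphic_on unit_disc"
    "\<And>z. z \<in> unit_disc \<Longrightarrow> weight \<alpha> z * cmod (deriv (deriv f) z) \<le> c"
  shows "disc_part f \<in> zygmund_space \<alpha>"
    "zygmund_norm \<alpha> (disc_part f) \<le> cmod (f 0) + cmod (deriv f 0) + c"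
proof -
  have "disc_part f holomorphic_on unit_disc"
    using holomorphic_cong[THEN iffD1, OF refl _ assms(1), of "disc_part f"]
    by (simp add: disc_part_def)
  from zygmund_spaceI[OF this, of \<alpha> c] assms(2)
  show "disc_part f \<in> zygmund_space \<alpha>"
    "zygmund_norm \<alpha> (disc_part f) \<le> cmod (f 0) + cmod (deriv f 0) + c"
    by (auto simp: disc_part_simps) (auto simp: disc_part_def)
qed

lemma deriv_cmult_disc:
  assumes "f holomorphic_on unit_disc" "z \<in> unit_disc"
  shows "deriv (\<lambda>z. c * f z) z = c * deriv f z"
    "deriv (deriv (\<lambda>z. c * f z)) z = c * deriv (deriv f) z"
proof -
  have 1: "(f has_field_derivative deriv f w) (at w)"
    "(deriv f has_field_derivative deriv (deriv f) w) (at w)" if "w \<in> unit_disc" for w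
    using assms that by (auto intro!: holomorphic_derivI holomorphic_deriv)
  show "deriv (\<lambda>z. c * f z) z = c * deriv f z"
    "deriv (deriv (\<lambda>z. c * f z)) z = c * deriv (deriv f) z"
    by (rule deriv2_eqI[where ?f1.0 = "\<lambda>z. c * deriv f z" and ?f2.0 = "\<lambda>z. c * deriv (deriv f) z"];
        use assms in \<open>auto intro!: 1 DERIV_cmult\<close>)+
qed

lemma zygmund_space_cmult:
  assumes "f \<in> zygmund_space \<alpha>"
  shows "(\<lambda>z. c * f z) \<in> zygmund_space \<alpha>"
    "zygmund_norm \<alpha> (\<lambda>z. c * f z) \<le> cmod c * zygmund_norm \<alpha> f"
proof -
  have hol: "f holomorphic_on unit_disc" and fin: "weighted_norm \<alpha> (deriv (deriv f)) < \<infinity>"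
    using assms by (auto simp: zygmund_space_def)
  have "weight \<alpha> z * cmod (deriv (deriv (\<lambda>z. c * f z)) z)
      \<le> cmod c * real_of_ereal (weighted_norm \<alpha> (deriv (deriv f)))" if "z \<in> unit_disc" for z
    using mult_left_mono[OF weighted_norm_upper[OF fin that], of "cmod c"] deriv_cmult_disc(2)[OF hol that]
    by (simp add: norm_mult mult.left_commute)
  note * = zygmund_spaceI[OF _ _ this]
  show "(\<lambda>z. c * f z) \<in> zygmund_space \<alpha>"
    using hol assms by (intro *(1)) (auto intro!: holomorphic_intros simp: zygmund_space_def)
  have "zygmund_norm \<alpha> (\<lambda>z. c * f z) \<le> cmod (c * f 0) + cmod (deriv (\<lambda>z. c * f z) 0) +
      cmod c * real_of_ereal (weighted_norm \<alpha> (deriv (deriv f)))"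
    using hol assms by (intro *(2)) (auto intro!: holomorphic_intros simp: zygmund_space_def)
  also have "\<dots> = cmod c * zygmund_norm \<alpha> f"
    using deriv_cmult_disc(1)[OF hol, of 0] by (simp add: zygmund_norm_def norm_mult algebra_simps)
  finally show "zygmund_norm \<alpha> (\<lambda>z. c * f z) \<le> cmod c * zygmund_norm \<alpha> f" .
qed

lemma zygmund_space_add:
  assumes "f \<in> zygmund_space \<alpha>" "h \<in> zygmund_space \<alpha>"
  shows "(\<lambda>z. f z + h z) \<in> zygmund_space \<alpha>"
    "zygmund_norm \<alpha> (\<lambda>z. f z + h z) \<le> zygmund_norm \<alpha> f + zygmund_norm \<alpha> h"
  using zygmund_space_diff[OF assms(1) zygmund_space_cmult(1)[OF assms(2), of "-1"]]
    zygmund_space_cmult(2)[OF assms(2), of "-1"] by auto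

lemma zygmund_space_sum:
  assumes "finite A" "\<And>k. k \<in> A \<Longrightarrow> f k \<in> zygmund_space \<alpha>"
  shows "(\<lambda>z. \<Sum>k\<in>A. f k z) \<in> zygmund_space \<alpha>"
    "zygmund_norm \<alpha> (\<lambda>z. \<Sum>k\<in>A. f k z) \<le> (\<Sum>k\<in>A. zygmund_norm \<alpha> (f k))"
  using assms
proof (induction A)
  case (insert k A)
  have *: "(\<lambda>z. \<Sum>k\<in>insert k A. f k z) = (\<lambda>z. f k z + (\<Sum>k\<in>A. f k z))"
    using insert by auto
  case 1
  then show ?case unfolding * using insert by (intro zygmund_space_add) auto
  case 2
  then show ?case unfolding * using insert zygmund_space_add(2)[of "f k" \<alpha> "\<lambda>z. \<Sum>k\<in>A. f k z"] by force
qed (auto simp: zygmund_space_zero)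

section \<open>The operator and its symbols\<close>

lemma comp_volterra_primitive:
  assumes "f holomorphic_on unit_disc" "g holomorphic_on unit_disc" "\<phi> ` unit_disc \<subseteq> unit_disc"
  obtains G where "\<And>z. z \<in> unit_disc \<Longrightarrow> (G has_field_derivative f z * deriv g z) (at z)"
    "\<And>z. z \<in> unit_disc \<Longrightarrow> comp_volterra \<phi> g f z = G (\<phi> z) - G 0"
proof -
  have hol: "(\<lambda>z. f z * deriv g z) holomorphic_on unit_disc"
    using assms by (intro holomorphic_intros) auto
  obtain G where G: "\<And>z. z \<in> unit_disc \<Longrightarrow> (G has_field_derivative f z * deriv g z) (at z within unit_disc)"
    using holomorphic_convex_primitive'[OF _ _ hol] by auto
  show ?thesis
  proof
    show "(G has_field_derivative f z * deriv g z) (at z)" if "z \<in> unit_disc" for z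
      using G[OF that] at_within_open[OF that] by simp
    show "comp_volterra \<phi> g f z = G (\<phi> z) - G 0" if "z \<in> unit_disc" for z
    proof -
      have "path_image (linepath 0 (\<phi> z)) \<subseteq> unit_disc"
        unfolding path_image_linepath
      using that assms(3) by (intro closed_segment_subset convex_ball) (simp, blast)
      from contour_integral_primitive[OF G valid_path_linepath this] have
        "((\<lambda>z. f z * deriv g z) has_contour_integral (G (\<phi> z) - G 0)) (linepath 0 (\<phi> z))" by simp
      then show ?thesis using that by (simp add: comp_volterra_def contour_integral_unique)
    qed
  qed
qed

text \<open>Differentiating twice removes the integral: the second derivative of the image of \<open>f\<close> is a
  combination of \<open>f' \<circ> \<phi>\<close> and \<open>f \<circ> \<phi>\<close> with the two symbols as coefficients.\<close>

lemma comp_volterra_derivs: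
  assumes "f holomorphic_on unit_disc" "g holomorphic_on unit_disc" "\<phi> holomorphic_on unit_disc"
    "\<phi> ` unit_disc \<subseteq> unit_disc" "z \<in> unit_disc"
  shows "deriv (comp_volterra \<phi> g f) z = f (\<phi> z) * deriv g (\<phi> z) * deriv \<phi> z"
    "deriv (deriv (comp_volterra \<phi> g f)) z =
       first_symbol \<phi> g z * deriv f (\<phi> z) + second_symbol \<phi> g z * f (\<phi> z)"
proof -
  obtain G where G: "\<And>z. z \<in> unit_disc \<Longrightarrow> (G has_field_derivative f z * deriv g z) (at z)"
    "\<And>z. z \<in> unit_disc \<Longrightarrow> comp_volterra \<phi> g f z = G (\<phi> z) - G 0"
    using comp_volterra_primitive[OF assms(1,2,4)] by metis
  have der: "(h has_field_derivative deriv h w) (at w)"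
    if "h holomorphic_on unit_disc" "w \<in> unit_disc" for h w
    using holomorphic_derivI[OF that(1) _ that(2)] by auto
  have \<phi>: "\<phi> w \<in> unit_disc" if "w \<in> unit_disc" for w using assms(4) that by blast
  have 1: "((\<lambda>z. G (\<phi> z) - G 0) has_field_derivative f (\<phi> w) * deriv g (\<phi> w) * deriv \<phi> w) (at w)"
    if w: "w \<in> unit_disc" for w
    using DERIV_chain2[OF G(1)[OF \<phi>[OF w]] der[OF assms(3) w]]
    by (auto intro!: derivative_eq_intros)
  have 2: "((\<lambda>w. f (\<phi> w) * deriv g (\<phi> w) * deriv \<phi> w) has_field_derivative
      first_symbol \<phi> g w * deriv f (\<phi> w) + second_symbol \<phi> g w * f (\<phi> w)) (at w)"
    if w: "w \<in> unit_disc" for w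
  proof -
    note d\<phi> = der[OF assms(3) w]
    note df = DERIV_chain2[OF der[OF assms(1) \<phi>[OF w]] d\<phi>]
    note dg = DERIV_chain2[OF der[OF holomorphic_deriv[OF assms(2) open_ball] \<phi>[OF w]] d\<phi>]
    note dd\<phi> = der[OF holomorphic_deriv[OF assms(3) open_ball] w]
    have "first_symbol \<phi> g w * deriv f (\<phi> w) + second_symbol \<phi> g w * f (\<phi> w) =
       (deriv f (\<phi> w) * deriv \<phi> w * deriv g (\<phi> w) + deriv (deriv g) (\<phi> w) * deriv \<phi> w * f (\<phi> w)) * deriv \<phi> w
        + deriv (deriv \<phi>) w * (f (\<phi> w) * deriv g (\<phi> w))"
      by (simp add: first_symbol_def second_symbol_def algebra_simps power2_eq_square)
    then show ?thesis using DERIV_mult[OF DERIV_mult[OF df dg] dd\<phi>] by simp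
  qed
  note eq = eq_on_disc_deriv[where f = "comp_volterra \<phi> g f", OF G(2) assms(5)]
  show "deriv (comp_volterra \<phi> g f) z = f (\<phi> z) * deriv g (\<phi> z) * deriv \<phi> z"
    using eq(1) deriv2_eqI(1)[OF 1 2 assms(5)] by simp
  show "deriv (deriv (comp_volterra \<phi> g f)) z =
       first_symbol \<phi> g z * deriv f (\<phi> z) + second_symbol \<phi> g z * f (\<phi> z)"
    using eq(2) deriv2_eqI(2)[OF 1 2 assms(5)] by simp
qed

lemma polynomial_test_derivs:
  fixes a :: "nat \<Rightarrow> complex"
  shows "deriv (\<lambda>z. \<Sum>k\<in>A. a k * z ^ k) z = (\<Sum>k\<in>A. a k * of_nat k * z ^ (k - 1))"
    "deriv (deriv (\<lambda>z. \<Sum>k\<in>A. a k * z ^ k)) z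
      = (\<Sum>k\<in>A. a k * of_nat k * of_nat (k - 1) * z ^ (k - 2))"
proof -
  have 1: "deriv (\<lambda>z. \<Sum>k\<in>A. a k * z ^ k) = (\<lambda>z. \<Sum>k\<in>A. a k * of_nat k * z ^ (k - 1))"
    by (rule ext, rule DERIV_imp_deriv) (auto intro!: derivative_eq_intros simp: ac_simps)
  then show "deriv (\<lambda>z. \<Sum>k\<in>A. a k * z ^ k) z = (\<Sum>k\<in>A. a k * of_nat k * z ^ (k - 1))" by simp
  show "deriv (deriv (\<lambda>z. \<Sum>k\<in>A. a k * z ^ k)) z
      = (\<Sum>k\<in>A. a k * of_nat k * of_nat (k - 1) * z ^ (k - 2))"
    unfolding 1
    by (rule DERIV_imp_deriv) (auto intro!: derivative_eq_intros sum.cong simp: ac_simps numeral_2_eq_2)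
qed

text \<open>The constant function 1 and the identity are mapped to functions with second derivatives \<open>v\<close> and
  \<open>u + v \<phi>\<close>, where \<open>u\<close>, \<open>v\<close> are the two symbols. Membership of both images in the target space bounds
  first \<open>v\<close>, then \<open>u\<close>.\<close>

lemma symbols_bounded:
  assumes "admissible \<alpha> \<beta> \<phi> g"
  obtains B where "B > 0"
    "\<And>z. z \<in> unit_disc \<Longrightarrow> weight \<beta> z * cmod (first_symbol \<phi> g z) \<le> B"
    "\<And>z. z \<in> unit_disc \<Longrightarrow> weight \<beta> z * cmod (second_symbol \<phi> g z) \<le> B"
proof -
  let ?T = "comp_volterra \<phi> g"
  have adm: "\<phi> holomorphic_on unit_disc" "\<phi> ` unit_disc \<subseteq> unit_disc" "g holomorphic_on unit_disc"
    "\<And>f. f \<in> zygmund_space \<alpha> \<Longrightarrow> ?T f \<in> zygmund_space \<beta>"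
    using assms by (auto simp: admissible_def bounded_operator_def linear_operator_def)
  define e where "e j = disc_part (\<lambda>z. z ^ j)" for j :: nat
  have e: "e j \<in> zygmund_space \<alpha>" if "j \<le> 1" for j
    unfolding e_def
  proof (rule disc_part_zygmund(1)[where c = 0])
    have "deriv (\<lambda>z::complex. z ^ j) = (\<lambda>z. of_nat j)"
      using that by (intro ext DERIV_imp_deriv) (cases j; auto intro!: derivative_eq_intros)
    then show "weight \<alpha> z * cmod (deriv (deriv (\<lambda>z. z ^ j)) z) \<le> 0" for z
      by (cases j) auto
  qed (intro holomorphic_intros)
  have T: "weight \<beta> z * cmod (first_symbol \<phi> g z * of_nat j + second_symbol \<phi> g z * \<phi> z ^ j)
      \<le> zygmund_norm \<beta> (?T (e j))" if z: "z \<in> unit_disc" and j: "j \<le> 1" for z j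
  proof -
    have \<phi>z: "\<phi> z \<in> unit_disc" using adm(2) z by blast
    have "deriv (e j) (\<phi> z) = of_nat j"
      unfolding e_def disc_part_simps(2)[OF \<phi>z]
      using j by (intro DERIV_imp_deriv) (cases j; auto intro!: derivative_eq_intros)
    then have "deriv (deriv (?T (e j))) z =
        first_symbol \<phi> g z * of_nat j + second_symbol \<phi> g z * \<phi> z ^ j"
      using comp_volterra_derivs(2)[OF zygmund_spaceD(1)[OF e[OF j]] adm(3,1,2) z] \<phi>z
      by (simp add: e_def disc_part_def)
    then show ?thesis using zygmund_spaceD(5)[OF adm(4)[OF e[OF j]] z] by simp
  qed
  define B where "B = zygmund_norm \<beta> (?T (e 0)) + zygmund_norm \<beta> (?T (e 1)) + 1"
  show ?thesis
  proof
    show "B > 0" unfolding B_def using zygmund_norm_nonneg by (smt (verit))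
    fix z assume z: "z \<in> unit_disc"
    have w: "weight \<beta> z \<ge> 0" using weight_pos[OF z] by (simp add: less_imp_le)
    have 0: "weight \<beta> z * cmod (second_symbol \<phi> g z) \<le> zygmund_norm \<beta> (?T (e 0))"
      using T[OF z, of 0] by simp
    then show "weight \<beta> z * cmod (second_symbol \<phi> g z) \<le> B"
      using zygmund_norm_nonneg[of \<beta> "?T (e 1)"] by (simp add: B_def)
    have "cmod (\<phi> z) \<le> 1" using adm(2) z by (force simp: less_imp_le)
    then have "cmod (second_symbol \<phi> g z * \<phi> z) \<le> cmod (second_symbol \<phi> g z)"
      by (simp add: norm_mult mult_left_le)
    then have "cmod (first_symbol \<phi> g z) \<le>
        cmod (first_symbol \<phi> g z + second_symbol \<phi> g z * \<phi> z) + cmod (second_symbol \<phi> g z)"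
      using norm_triangle_ineq4[of "first_symbol \<phi> g z + second_symbol \<phi> g z * \<phi> z" "second_symbol \<phi> g z * \<phi> z"]
      by simp
    from mult_left_mono[OF this w] T[OF z, of 1] 0
    show "weight \<beta> z * cmod (first_symbol \<phi> g z) \<le> B"
      by (simp add: B_def distrib_left)
  qed
qed

section \<open>Growth of functions with a bound on the derivative\<close>

lemma weight_ge:
  assumes "\<alpha> > 0" "z \<in> unit_disc"
  shows "(1 - cmod z) powr \<alpha> \<le> weight \<alpha> z"
proof -
  have "(cmod z)\<^sup>2 \<le> cmod z" using assms(2) by (simp add: power2_eq_square mult_left_le)
  then show ?thesis unfolding weight_def using assms by (intro powr_mono2) auto
qed

lemma weight_le_1:
  assumes "\<alpha> > 0" "z \<in> unit_disc"
  shows "weight \<alpha> z \<le> 1"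
  unfolding weight_def using assms by (intro powr_le1) (auto simp: abs_square_le_1 less_imp_le)

lemma DERIV_one_minus_powr:
  fixes s p :: real
  assumes "s < 1"
  shows "((\<lambda>s. (1 - s) powr p) has_real_derivative - (p * (1 - s) powr (p - 1))) (at s)"
proof -
  have "((\<lambda>s. 1 - s) has_real_derivative - 1) (at s)" by (auto intro!: derivative_eq_intros)
  from DERIV_chain2[OF has_real_derivative_powr[of "1 - s" p] this] show ?thesis
    using assms by simp
qed

lemma powr_subadditive:
  fixes x y p :: real
  assumes "0 \<le> x" "0 \<le> y" "0 \<le> p" "p \<le> 1"
  shows "(x + y) powr p \<le> x powr p + y powr p"
proof (cases "x + y = 0")
  case False
  then have pos: "x + y > 0" using assms by simp
  have *: "t / (x + y) * (x + y) powr p \<le> t powr p" if "0 \<le> t" "t \<le> x + y" for t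
  proof (cases "t = 0")
    case False
    then have "(t / (x + y)) powr 1 \<le> (t / (x + y)) powr p"
      using that pos assms by (intro powr_mono') auto
    also have "\<dots> = t powr p / (x + y) powr p" by (rule powr_divide)
    finally show ?thesis using pos that by (simp add: pos_le_divide_eq)
  qed simp
  have "(x + y) powr p = x / (x + y) * (x + y) powr p + y / (x + y) * (x + y) powr p"
    using False by (simp flip: distrib_right add_divide_distrib)
  then show ?thesis using *[of x] *[of y] assms by simp
qed (use assms in auto)

text \<open>Integration along the radius, phrased with a primitive \<open>\<Psi>\<close> of the bound \<open>\<psi>\<close> instead of an integral.\<close>

lemma radial_increment_bound:
  fixes F F' :: "complex \<Rightarrow> complex" and \<psi> \<Psi> :: "real \<Rightarrow> real"
  assumes der: "\<And>z. z \<in> unit_disc \<Longrightarrow> (F has_field_derivative F' z) (at z)"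
    and bnd: "\<And>z. z \<in> unit_disc \<Longrightarrow> cmod (F' z) \<le> \<psi> (cmod z)"
    and \<Psi>: "\<And>s. 0 \<le> s \<Longrightarrow> s < 1 \<Longrightarrow> (\<Psi> has_real_derivative \<psi> s) (at s)"
    and z: "z \<in> unit_disc" and t: "0 \<le> t" "t \<le> 1"
  shows "cmod (F z - F (of_real t * z)) \<le> \<Psi> (cmod z) - \<Psi> (t * cmod z)"
proof (cases "t = 1 \<or> z = 0")
  case False
  define r where "r = cmod z"
  define c where "c = z / of_real r"
  have r: "0 < r" "r < 1" and t1: "t < 1" using False z t by (auto simp: r_def)
  have c: "cmod c = 1" "z = of_real r * c" using r by (auto simp: c_def r_def norm_divide)
  have mem: "of_real s * c \<in> unit_disc" "cmod (of_real s * c) = s" if "0 \<le> s" "s \<le> r" for s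
    using that r c by (auto simp: norm_mult)
  have F: "((\<lambda>s. F (of_real s * c)) has_vector_derivative F' (of_real s * c) * c) (at s)"
    if "0 \<le> s" "s \<le> r" for s
  proof -
    have "((\<lambda>s. of_real s * c) has_vector_derivative c) (at s)"
      by (auto intro!: derivative_eq_intros)
    from field_vector_diff_chain_at[OF this der[OF mem(1)[OF that]]] show ?thesis
      by (simp add: o_def mult.commute)
  qed
  have \<Psi>': "(\<Psi> has_vector_derivative \<psi> s) (at s)" if "0 \<le> s" "s \<le> r" for s
    using \<Psi>[of s] that r by (simp add: has_real_derivative_iff_has_vector_derivative)
  have tr: "0 \<le> t * r" "t * r < r" using t r t1 by auto
  have "cmod (F (of_real r * c) - F (of_real (t * r) * c)) \<le> \<Psi> r - \<Psi> (t * r)"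
  proof (rule differentiable_bound_general[where f = "\<lambda>s. F (of_real s * c)"])
    show "continuous_on {t * r..r} (\<lambda>s. F (of_real s * c))"
      using tr by (intro continuous_at_imp_continuous_on ballI has_vector_derivative_continuous[OF F]) auto
    show "continuous_on {t * r..r} \<Psi>"
      using tr by (intro continuous_at_imp_continuous_on ballI has_vector_derivative_continuous[OF \<Psi>']) auto
    show "cmod (F' (of_real s * c) * c) \<le> \<psi> s" if "t * r < s" "s < r" for s
      using bnd[OF mem(1), of s] mem(2)[of s] that tr c by (simp add: norm_mult)
  qed (use tr F \<Psi>' in auto)
  then show ?thesis by (simp add: c(2)[symmetric] r_def[symmetric] mult.assoc)
qed auto

text \<open>For \<open>\<gamma> < 1\<close> the bound on \<open>F'\<close> is integrable up to the circle, so the increment between \<open>\<rho> z\<close> and \<open>z\<close>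
  is small uniformly in the whole disc as \<open>\<rho> \<longlonglongrightarrow> 1\<close>: subadditivity of the concave power turns the difference
  of the primitives into a power of \<open>1 - \<rho>\<close>.\<close>

lemma increment_bound_subcritical:
  fixes F F' :: "complex \<Rightarrow> complex"
  assumes der: "\<And>z. z \<in> unit_disc \<Longrightarrow> (F has_field_derivative F' z) (at z)"
    and bnd: "\<And>z. z \<in> unit_disc \<Longrightarrow> cmod (F' z) \<le> B * (1 - cmod z) powr - \<gamma>"
    and "0 \<le> \<gamma>" "\<gamma> < 1" "0 \<le> B" and z: "z \<in> unit_disc" and \<rho>: "0 \<le> \<rho>" "\<rho> \<le> 1"
  shows "cmod (F z - F (of_real \<rho> * z)) \<le> B / (1 - \<gamma>) * (1 - \<rho>) powr (1 - \<gamma>)"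
proof -
  define r where "r = cmod z"
  have r: "0 \<le> r" "r < 1" using z by (auto simp: r_def)
  have "cmod (F z - F (of_real \<rho> * z))
      \<le> - (B / (1 - \<gamma>)) * (1 - r) powr (1 - \<gamma>) - - (B / (1 - \<gamma>)) * (1 - \<rho> * r) powr (1 - \<gamma>)"
    unfolding r_def
    by (rule radial_increment_bound[OF der bnd _ z \<rho>])
      (use assms(4) in \<open>auto intro!: derivative_eq_intros DERIV_one_minus_powr\<close>)
  also have "\<dots> = B / (1 - \<gamma>) * ((1 - \<rho> * r) powr (1 - \<gamma>) - (1 - r) powr (1 - \<gamma>))"
    by (simp add: algebra_simps)
  also have "\<dots> \<le> B / (1 - \<gamma>) * (1 - \<rho>) powr (1 - \<gamma>)"
  proof (rule mult_left_mono)
    have "1 - \<rho> * r \<le> (1 - r) + (1 - \<rho>)" using \<rho> r mult_left_le[of r "1 - \<rho>"] by (simp add: algebra_simps)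
    moreover have "0 \<le> 1 - \<rho> * r" using \<rho> r mult_le_one[of \<rho> r] by simp
    ultimately have "(1 - \<rho> * r) powr (1 - \<gamma>) \<le> ((1 - r) + (1 - \<rho>)) powr (1 - \<gamma>)"
      using assms(4) by (intro powr_mono2) auto
    also have "\<dots> \<le> (1 - r) powr (1 - \<gamma>) + (1 - \<rho>) powr (1 - \<gamma>)"
      using assms(3,4) r \<rho> by (intro powr_subadditive) auto
    finally show "(1 - \<rho> * r) powr (1 - \<gamma>) - (1 - r) powr (1 - \<gamma>) \<le> (1 - \<rho>) powr (1 - \<gamma>)" by simp
  qed (use assms in auto)
  finally show ?thesis .
qed

text \<open>For arbitrary \<open>\<gamma>\<close> the same increment is small only on compact subdiscs, by the mean value
  inequality.\<close>

lemma increment_bound_local: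
  fixes F F' :: "complex \<Rightarrow> complex"
  assumes der: "\<And>z. z \<in> unit_disc \<Longrightarrow> (F has_field_derivative F' z) (at z)"
    and bnd: "\<And>z. z \<in> unit_disc \<Longrightarrow> cmod (F' z) \<le> B * (1 - cmod z) powr - \<gamma>"
    and "0 \<le> \<gamma>" "0 \<le> B" and s: "s < 1" and z: "cmod z \<le> s" and \<rho>: "0 \<le> \<rho>" "\<rho> \<le> 1"
  shows "cmod (F z - F (of_real \<rho> * z)) \<le> B * (1 - s) powr - \<gamma> * (1 - \<rho>)"
proof -
  have sub: "cball 0 s \<subseteq> unit_disc" using s by auto
  have "cmod (F z - F (of_real \<rho> * z)) \<le> B * (1 - s) powr - \<gamma> * cmod (z - of_real \<rho> * z)" (is "_ \<le> ?c * _")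
  proof (rule field_differentiable_bound[OF convex_cball[of 0 s]])
    fix w assume w: "w \<in> cball (0::complex) s"
    show "(F has_field_derivative F' w) (at w within cball 0 s)"
      using der w sub has_field_derivative_at_within by blast
    have "(1 - cmod w) powr - \<gamma> \<le> (1 - s) powr - \<gamma>"
      using w s assms(3) by (intro powr_mono2') auto
    then show "cmod (F' w) \<le> B * (1 - s) powr - \<gamma>"
      using bnd[of w] w sub assms(4) by (meson mult_left_mono order_trans subsetD)
  next
    have "\<rho> * cmod z \<le> 1 * cmod z" using \<rho> by (intro mult_right_mono) auto
    then show "of_real \<rho> * z \<in> cball 0 s" using z \<rho> by (simp add: norm_mult)
  qed (use z in auto)
  also have "\<dots> \<le> ?c * (1 - \<rho>)"
  proof -
    have "z - of_real \<rho> * z = of_real (1 - \<rho>) * z" by (simp add: algebra_simps)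
    then have "cmod (z - of_real \<rho> * z) = (1 - \<rho>) * cmod z" using \<rho> by (simp only: norm_mult norm_of_real)
    then have "cmod (z - of_real \<rho> * z) \<le> 1 - \<rho>"
      using \<rho> z s mult_left_le[of "cmod z" "1 - \<rho>"] by simp
    then show ?thesis using assms(4) by (intro mult_left_mono) auto
  qed
  finally show ?thesis .
qed

lemma growth_subcritical:
  fixes F F' :: "complex \<Rightarrow> complex"
  assumes der: "\<And>z. z \<in> unit_disc \<Longrightarrow> (F has_field_derivative F' z) (at z)"
    and bnd: "\<And>z. z \<in> unit_disc \<Longrightarrow> cmod (F' z) \<le> B * (1 - cmod z) powr - \<gamma>"
    and "cmod (F 0) \<le> 1" "0 \<le> \<gamma>" "\<gamma> < 1" "0 \<le> B" and z: "z \<in> unit_disc"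
  shows "cmod (F z) \<le> 1 + B / (1 - \<gamma>)"
  using increment_bound_subcritical[OF der bnd assms(4-6) z, of 0] assms(3)
    norm_triangle_sub[of "F z" "F 0"] by simp

lemma growth_critical:
  fixes F F' :: "complex \<Rightarrow> complex"
  assumes der: "\<And>z. z \<in> unit_disc \<Longrightarrow> (F has_field_derivative F' z) (at z)"
    and bnd: "\<And>z. z \<in> unit_disc \<Longrightarrow> cmod (F' z) \<le> B * (1 - cmod z) powr - 1"
    and "cmod (F 0) \<le> 1" "0 \<le> B" and z: "z \<in> unit_disc"
  shows "cmod (F z) \<le> 1 + B * ln (1 / (1 - cmod z))"
proof -
  have "cmod (F z - F (of_real 0 * z)) \<le> - B * ln (1 - cmod z) - - B * ln (1 - 0 * cmod z)"
    by (rule radial_increment_bound[OF der bnd _ z])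
      (auto intro!: derivative_eq_intros simp: powr_minus field_simps)
  then show ?thesis using assms(3) norm_triangle_sub[of "F z" "F 0"] z by (simp add: ln_div)
qed

text \<open>As \<open>(1 - |z|) powr (1 - \<gamma>) \<ge> 1\<close>, the value at the origin goes into the constant.\<close>

lemma growth_supercritical:
  fixes F F' :: "complex \<Rightarrow> complex"
  assumes der: "\<And>z. z \<in> unit_disc \<Longrightarrow> (F has_field_derivative F' z) (at z)"
    and bnd: "\<And>z. z \<in> unit_disc \<Longrightarrow> cmod (F' z) \<le> B * (1 - cmod z) powr - \<gamma>"
    and "cmod (F 0) \<le> 1" "1 < \<gamma>" "0 \<le> B" and z: "z \<in> unit_disc"
  shows "cmod (F z) \<le> (1 + B / (\<gamma> - 1)) * (1 - cmod z) powr (1 - \<gamma>)"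
proof -
  have "((\<lambda>s. B / (\<gamma> - 1) * (1 - s) powr (1 - \<gamma>)) has_real_derivative B * (1 - s) powr - \<gamma>) (at s)"
    if "s < 1" for s
  proof -
    have "B / (\<gamma> - 1) * - ((1 - \<gamma>) * (1 - s) powr (1 - \<gamma> - 1)) = B * (1 - s) powr - \<gamma>"
      using assms(4) by (simp add: divide_simps) (simp add: algebra_simps)
    then show ?thesis
      using DERIV_cmult[OF DERIV_one_minus_powr[OF that], of "B / (\<gamma> - 1)" "1 - \<gamma>"] by simp
  qed
  then have "cmod (F z - F (of_real 0 * z))
      \<le> B / (\<gamma> - 1) * (1 - cmod z) powr (1 - \<gamma>) - B / (\<gamma> - 1) * (1 - 0 * cmod z) powr (1 - \<gamma>)"
    by (intro radial_increment_bound[OF der bnd _ z]) auto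
  moreover have "B / (\<gamma> - 1) \<ge> 0" using assms by simp
  ultimately have "cmod (F z) \<le> 1 + B / (\<gamma> - 1) * (1 - cmod z) powr (1 - \<gamma>)"
    using assms(3) norm_triangle_sub[of "F z" "F 0"] by simp
  moreover have "1 \<le> (1 - cmod z) powr (1 - \<gamma>)"
    using powr_mono'[of "1 - \<gamma>" 0 "1 - cmod z"] assms(4) z by simp
  ultimately show ?thesis by (simp add: distrib_right)
qed

lemma unit_ballD:
  assumes "f \<in> zygmund_unit_ball \<alpha>" "\<alpha> > 0"
  shows "f \<in> zygmund_space \<alpha>" "f holomorphic_on unit_disc" "cmod (f 0) \<le> 1" "cmod (deriv f 0) \<le> 1"
    "\<And>z. z \<in> unit_disc \<Longrightarrow> cmod (deriv (deriv f) z) \<le> 1 * (1 - cmod z) powr - \<alpha>"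
    "\<And>z. z \<in> unit_disc \<Longrightarrow> (f has_field_derivative deriv f z) (at z)"
    "\<And>z. z \<in> unit_disc \<Longrightarrow> (deriv f has_field_derivative deriv (deriv f) z) (at z)"
proof -
  show f: "f \<in> zygmund_space \<alpha>" using assms by (simp add: zygmund_unit_ball_def)
  note f' = zygmund_spaceD[OF f]
  have n: "zygmund_norm \<alpha> f \<le> 1" using assms by (simp add: zygmund_unit_ball_def)
  show "f holomorphic_on unit_disc" "cmod (f 0) \<le> 1" "cmod (deriv f 0) \<le> 1" using f' n by auto
  show "(f has_field_derivative deriv f z) (at z)"
    "(deriv f has_field_derivative deriv (deriv f) z) (at z)" if "z \<in> unit_disc" for z
    using f'(1) that by (auto intro!: holomorphic_derivI holomorphic_deriv)
  show "cmod (deriv (deriv f) z) \<le> 1 * (1 - cmod z) powr - \<alpha>" if z: "z \<in> unit_disc" for z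
  proof -
    have "(1 - cmod z) powr \<alpha> * cmod (deriv (deriv f) z) \<le> 1"
      using mult_right_mono[OF weight_ge[OF assms(2) z], of "cmod (deriv (deriv f) z)"] f'(5)[OF z] n
      by simp
    then show ?thesis using z by (simp add: powr_minus field_simps)
  qed
qed

text \<open>Admitting every exponent \<open>\<gamma> \<ge> \<alpha>\<close> with \<open>\<gamma> > 1\<close> avoids a case distinction at \<open>\<alpha> = 1\<close>. For \<open>\<alpha> > 1\<close> the choice
  \<open>\<gamma> = \<alpha>\<close> is the sharp growth; a larger \<open>\<gamma>\<close> serves where only smallness on compact sets, or integrability
  of \<open>f'\<close> up to the circle, is at stake.\<close>

lemma unit_ball_crude:
  assumes "f \<in> zygmund_unit_ball \<alpha>" "\<alpha> > 0" "\<alpha> \<le> \<gamma>" "1 < \<gamma>" "z \<in> unit_disc"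
  shows "cmod (deriv (deriv f) z) \<le> 1 * (1 - cmod z) powr - \<gamma>"
    "cmod (deriv f z) \<le> (1 + 1 / (\<gamma> - 1)) * (1 - cmod z) powr - (\<gamma> - 1)"
proof -
  note f = unit_ballD[OF assms(1,2)]
  have 1: "cmod (deriv (deriv f) z) \<le> 1 * (1 - cmod z) powr - \<gamma>" if "z \<in> unit_disc" for z
  proof -
    have "(1 - cmod z) powr - \<alpha> \<le> (1 - cmod z) powr - \<gamma>"
      using that assms(3) by (intro powr_mono') auto
    then show ?thesis using f(5)[OF that] by simp
  qed
  show "cmod (deriv (deriv f) z) \<le> 1 * (1 - cmod z) powr - \<gamma>" using 1 assms by blast
  show "cmod (deriv f z) \<le> (1 + 1 / (\<gamma> - 1)) * (1 - cmod z) powr - (\<gamma> - 1)"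
    using growth_supercritical[OF f(7) 1 f(4) assms(4) _ assms(5)] by simp
qed

section \<open>Dilations are compact\<close>

definition dilate :: "real \<Rightarrow> (complex \<Rightarrow> complex) \<Rightarrow> complex \<Rightarrow> complex" where
  "dilate \<rho> f = disc_part (\<lambda>z. f (of_real \<rho> * z))"

lemma scaled_in_disc:
  assumes "z \<in> unit_disc" "0 \<le> \<rho>" "\<rho> \<le> 1"
  shows "of_real \<rho> * z \<in> unit_disc" "cmod (of_real \<rho> * z) \<le> cmod z" "cmod (of_real \<rho> * z) \<le> \<rho>"
proof -
  show *: "cmod (of_real \<rho> * z) \<le> cmod z" "cmod (of_real \<rho> * z) \<le> \<rho>"
    using assms by (auto simp: norm_mult intro: mult_left_le_one_le mult_left_le)
  then show "of_real \<rho> * z \<in> unit_disc" using assms(1) by auto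
qed

lemma dilate_derivs:
  assumes "f holomorphic_on unit_disc" "0 \<le> \<rho>" "\<rho> \<le> 1" "z \<in> unit_disc"
  shows "dilate \<rho> f z = f (of_real \<rho> * z)"
    "deriv (dilate \<rho> f) z = of_real \<rho> * deriv f (of_real \<rho> * z)"
    "deriv (deriv (dilate \<rho> f)) z = (of_real \<rho>)\<^sup>2 * deriv (deriv f) (of_real \<rho> * z)"
    "dilate \<rho> f holomorphic_on unit_disc"
proof -
  have der: "(h has_field_derivative deriv h (of_real \<rho> * w)) (at (of_real \<rho> * w))"
    if "h holomorphic_on unit_disc" "w \<in> unit_disc" for h w
    using holomorphic_derivI[OF that(1) _ scaled_in_disc(1)[OF that(2) assms(2,3)]] by auto
  have lin: "((\<lambda>w. of_real \<rho> * w) has_field_derivative of_real \<rho>) (at w)" for w :: complex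
    by (auto intro!: derivative_eq_intros)
  have 1: "((\<lambda>w. f (of_real \<rho> * w)) has_field_derivative of_real \<rho> * deriv f (of_real \<rho> * w)) (at w)"
    if "w \<in> unit_disc" for w
    using DERIV_chain2[OF der[OF assms(1) that] lin] by (simp add: mult.commute)
  have 2: "((\<lambda>w. of_real \<rho> * deriv f (of_real \<rho> * w)) has_field_derivative
      (of_real \<rho>)\<^sup>2 * deriv (deriv f) (of_real \<rho> * w)) (at w)" if "w \<in> unit_disc" for w
    using DERIV_cmult[OF DERIV_chain2[OF der[OF holomorphic_deriv[OF assms(1) open_ball] that] lin], of "of_real \<rho>"]
    by (simp add: power2_eq_square mult_ac)
  show "dilate \<rho> f z = f (of_real \<rho> * z)"
    "deriv (dilate \<rho> f) z = of_real \<rho> * deriv f (of_real \<rho> * z)"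
    "deriv (deriv (dilate \<rho> f)) z = (of_real \<rho>)\<^sup>2 * deriv (deriv f) (of_real \<rho> * z)"
    unfolding dilate_def disc_part_simps[OF assms(4)] using deriv2_eqI[OF 1 2 assms(4)] by simp_all
  have "(\<lambda>w. f (of_real \<rho> * w)) holomorphic_on unit_disc"
    using 1 by (intro holomorphic_onI) (meson field_differentiable_at_within field_differentiable_def)
  then show "dilate \<rho> f holomorphic_on unit_disc"
    by (rule holomorphic_cong[THEN iffD1, rotated 2]) (auto simp: dilate_def disc_part_def)
qed

lemma dilate_zygmund:
  assumes "f \<in> zygmund_space \<alpha>" "\<alpha> > 0" "0 \<le> \<rho>" "\<rho> \<le> 1"
  shows "dilate \<rho> f \<in> zygmund_space \<alpha>"
proof (rule zygmund_spaceI(1))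
  note f = zygmund_spaceD[OF assms(1)]
  note d = dilate_derivs[OF f(1) assms(3,4)]
  show "dilate \<rho> f holomorphic_on unit_disc" using d(4)[of 0] by simp
  show "dilate \<rho> f z = 0" if "z \<notin> unit_disc" for z using that by (simp add: dilate_def disc_part_def)
  show "weight \<alpha> z * cmod (deriv (deriv (dilate \<rho> f)) z) \<le> zygmund_norm \<alpha> f"
    if z: "z \<in> unit_disc" for z
  proof -
    note \<rho>z = scaled_in_disc[OF z assms(3,4)]
    have "(cmod (of_real \<rho> * z))\<^sup>2 \<le> (cmod z)\<^sup>2" using \<rho>z(2) by (intro power_mono) auto
    moreover have "(cmod z)\<^sup>2 < 1" using z by (simp add: abs_square_less_1)
    ultimately have "weight \<alpha> z \<le> weight \<alpha> (of_real \<rho> * z)"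
      unfolding weight_def using assms(2) by (intro powr_mono2) auto
    moreover have "\<rho>\<^sup>2 * cmod (deriv (deriv f) (of_real \<rho> * z)) \<le> cmod (deriv (deriv f) (of_real \<rho> * z))"
      using assms(3,4) by (intro mult_left_le_one_le) (auto simp: power_le_one)
    ultimately have "weight \<alpha> z * (\<rho>\<^sup>2 * cmod (deriv (deriv f) (of_real \<rho> * z)))
        \<le> weight \<alpha> (of_real \<rho> * z) * cmod (deriv (deriv f) (of_real \<rho> * z))"
      using weight_pos[OF \<rho>z(1), of \<alpha>] by (intro mult_mono) auto
    then show ?thesis using f(5)[OF \<rho>z(1)] assms(3) by (simp add: d(3)[OF z] norm_mult norm_power)
  qed
qed

text \<open>Montel's theorem for the unit ball, which is moreover closed under locally uniform limits
  because its defining inequality is a pointwise one in the derivatives.\<close>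

lemma unit_ball_normal_family:
  fixes f :: "nat \<Rightarrow> complex \<Rightarrow> complex"
  assumes "\<alpha> > 0" "\<And>n. f n \<in> zygmund_unit_ball \<alpha>"
  obtains l r where "l \<in> zygmund_unit_ball \<alpha>" "strict_mono (r :: nat \<Rightarrow> nat)"
    "\<And>s. s < 1 \<Longrightarrow> uniform_limit (cball 0 s) (f \<circ> r) l sequentially"
proof -
  define \<gamma> where "\<gamma> = \<alpha> + 1"
  have \<gamma>: "\<alpha> \<le> \<gamma>" "1 < \<gamma>" using assms(1) by (auto simp: \<gamma>_def)
  obtain h r where h: "h holomorphic_on unit_disc" "strict_mono (r :: nat \<Rightarrow> nat)"
    "\<And>K. \<lbrakk>compact K; K \<subseteq> unit_disc\<rbrakk> \<Longrightarrow> uniform_limit K (f \<circ> r) h sequentially"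
  proof (rule Montel[of unit_disc "zygmund_unit_ball \<alpha>" f])
    show "h holomorphic_on unit_disc" if "h \<in> zygmund_unit_ball \<alpha>" for h
      using unit_ballD(2)[OF that assms(1)] .
    fix K :: "complex set" assume K: "compact K" "K \<subseteq> unit_disc"
    have "\<exists>s<1. K \<subseteq> cball 0 s"
    proof (cases "K = {}")
      case False
      obtain x where x: "x \<in> K" "\<And>y. y \<in> K \<Longrightarrow> cmod y \<le> cmod x"
        using continuous_attains_sup[OF K(1) False, of cmod] by (auto intro: continuous_intros)
      then show ?thesis using K(2) by (intro exI[of _ "cmod x"]) auto
    qed (auto intro: exI[of _ 0])
    then obtain s where s: "s < 1" "K \<subseteq> cball 0 s" by blast
    have "cmod (h z) \<le> 1 + (1 + 1 / (\<gamma> - 1)) * (1 - s) powr - (\<gamma> - 1) * (1 - 0)"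
      if "h \<in> zygmund_unit_ball \<alpha>" "z \<in> K" for h z
    proof -
      note hb = unit_ballD[OF that(1) assms(1)]
      have "cmod (h z - h (of_real 0 * z)) \<le> (1 + 1 / (\<gamma> - 1)) * (1 - s) powr - (\<gamma> - 1) * (1 - 0)"
        by (rule increment_bound_local[OF hb(6) unit_ball_crude(2)[OF that(1) assms(1) \<gamma>]])
          (use \<gamma> s that in auto)
      then show ?thesis using hb(3) norm_triangle_sub[of "h z" "h 0"] by simp
    qed
    then show "\<exists>B. \<forall>h\<in>zygmund_unit_ball \<alpha>. \<forall>z\<in>K. cmod (h z) \<le> B" by blast
  qed (use assms(2) in auto)
  have ul: "uniform_limit (ball 0 s) (f \<circ> r) h sequentially" if "s < 1" for s
    by (rule uniform_limit_on_subset[OF h(3)[of "cball 0 s"]]) (use that in auto)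
  have lim: "(\<lambda>n. (deriv ^^ m) (f (r n)) z) \<longlonglongrightarrow> (deriv ^^ m) h z" if z: "z \<in> unit_disc" for m z
  proof -
    obtain s where s: "cmod z < s" "s < 1" using z dense by auto
    have "f (r n) holomorphic_on ball 0 s" for n
      using unit_ballD(2)[OF assms(2,1), of "r n"] s by (rule_tac holomorphic_on_subset) auto
    then show ?thesis
      using higher_deriv_complex_uniform_limit[OF ul[OF s(2)], of z m] s by (simp add: o_def)
  qed
  show ?thesis
  proof
    define c where "c = 1 - cmod (h 0) - cmod (deriv h 0)"
    have hz: "weight \<alpha> z * cmod (deriv (deriv h) z) \<le> c" if z: "z \<in> unit_disc" for z
    proof -
      have "(\<lambda>n. cmod (f (r n) 0) + cmod (deriv (f (r n)) 0) + weight \<alpha> z * cmod (deriv (deriv (f (r n))) z))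
          \<longlonglongrightarrow> cmod (h 0) + cmod (deriv h 0) + weight \<alpha> z * cmod (deriv (deriv h) z)"
        using lim[of 0 0] lim[of 0 1] lim[OF z, of 2]
        by (intro tendsto_intros) (auto simp: numeral_2_eq_2)
      moreover have "cmod (f n 0) + cmod (deriv (f n) 0) + weight \<alpha> z * cmod (deriv (deriv (f n)) z) \<le> 1" for n
      proof -
        have "weighted_norm \<alpha> (deriv (deriv (f n))) < \<infinity>" "zygmund_norm \<alpha> (f n) \<le> 1"
          using assms(2)[of n] by (auto simp: zygmund_unit_ball_def zygmund_space_def)
        then show ?thesis using weighted_norm_upper[OF _ z] unfolding zygmund_norm_def by force
      qed
      ultimately have "cmod (h 0) + cmod (deriv h 0) + weight \<alpha> z * cmod (deriv (deriv h) z) \<le> 1"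
        by (intro LIMSEQ_le_const2) auto
      then show ?thesis by (simp add: c_def)
    qed
    show "disc_part h \<in> zygmund_unit_ball \<alpha>"
      using disc_part_zygmund[of h \<alpha> c, OF h(1) hz] by (auto simp: zygmund_unit_ball_def c_def)
    show "uniform_limit (cball 0 s) (f \<circ> r) (disc_part h) sequentially" if "s < 1" for s
    proof -
      have "uniform_limit (cball 0 s) (f \<circ> r) h sequentially" using that by (intro h(3)) auto
      then show ?thesis
        by (rule uniform_limit_cong'[THEN iffD1, rotated -1]) (use that in \<open>auto simp: disc_part_def\<close>)
    qed
  qed (rule h(2))
qed

text \<open>By Cauchy's estimates the norm of a dilation is controlled by the supremum on a compact disc,
  so dilations turn locally uniform convergence into norm convergence.\<close>

lemma dilate_norm_le:
  assumes "d holomorphic_on unit_disc" "\<alpha> > 0" "0 \<le> \<rho>" "\<rho> < 1" "0 \<le> e"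
    "\<And>z. cmod z \<le> (1 + \<rho>) / 2 \<Longrightarrow> cmod (d z) \<le> e"
  shows "zygmund_norm \<alpha> (dilate \<rho> d) \<le> e * (1 + 2 / (1 - \<rho>) + 8 / (1 - \<rho>)\<^sup>2)"
proof -
  \<comment> \<open>radius of the Cauchy estimates: discs of this radius about points of modulus at most \<open>\<rho>\<close> stay
    within modulus \<open>(1 + \<rho>) / 2\<close>\<close>
  define \<eta> where "\<eta> = (1 - \<rho>) / 2"
  have \<eta>: "\<eta> > 0" using assms by (simp add: \<eta>_def)
  have C: "cmod ((deriv ^^ n) d z) \<le> fact n * e / \<eta> ^ n" if "cmod z \<le> \<rho>" for n z
  proof (rule Cauchy_inequality)
    have le: "cmod w \<le> (1 + \<rho>) / 2" if "w \<in> cball z \<eta>" for w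
      using norm_triangle_sub[of w z] that \<open>cmod z \<le> \<rho>\<close> by (simp add: dist_norm norm_minus_commute \<eta>_def field_simps)
    have sub: "cball z \<eta> \<subseteq> unit_disc"
      using le assms(4) by fastforce
    have "d holomorphic_on cball z \<eta>" using holomorphic_on_subset[OF assms(1) sub] .
    then show "d holomorphic_on ball z \<eta>" "continuous_on (cball z \<eta>) d"
      by (auto intro: holomorphic_on_subset holomorphic_on_imp_continuous_on)
    show "cmod (d x) \<le> e" if "cmod (z - x) = \<eta>" for x
      using that by (intro assms(6) le) (auto simp: dist_norm)
  qed (rule \<eta>)
  note dd = dilate_derivs[OF assms(1,3) less_imp_le[OF assms(4)]]
  have "zygmund_norm \<alpha> (dilate \<rho> d) \<le> cmod (dilate \<rho> d 0) + cmod (deriv (dilate \<rho> d) 0) + 2 * e / \<eta>\<^sup>2"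
  proof (rule zygmund_spaceI(2))
    show "dilate \<rho> d holomorphic_on unit_disc" using dd(4)[of 0] by simp
    show "dilate \<rho> d z = 0" if "z \<notin> unit_disc" for z using that by (simp add: dilate_def disc_part_def)
    fix z :: complex assume z: "z \<in> unit_disc"
    have "cmod (deriv (deriv d) (of_real \<rho> * z)) \<le> 2 * e / \<eta>\<^sup>2"
      using C[of "of_real \<rho> * z" 2] scaled_in_disc(3)[OF z assms(3)] assms(4)
      by (simp add: numeral_2_eq_2)
    moreover have "\<rho>\<^sup>2 \<le> 1" using assms(3,4) by (simp add: power_le_one)
    ultimately have "weight \<alpha> z * (\<rho>\<^sup>2 * cmod (deriv (deriv d) (of_real \<rho> * z))) \<le> 1 * (1 * (2 * e / \<eta>\<^sup>2))"
      using weight_le_1[OF assms(2) z] weight_pos[OF z, of \<alpha>] by (intro mult_mono) auto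
    then show "weight \<alpha> z * cmod (deriv (deriv (dilate \<rho> d)) z) \<le> 2 * e / \<eta>\<^sup>2"
      using assms(3) by (simp add: dd(3)[OF z] norm_mult norm_power)
  qed
  also have "\<dots> \<le> e + e / \<eta> + 2 * e / \<eta>\<^sup>2"
  proof -
    have "\<rho> * cmod (deriv d 0) \<le> 1 * (e / \<eta>)"
      using C[of 0 1] assms(3,4) by (intro mult_mono) auto
    then show ?thesis using C[of 0 0] assms(3) dd(1,2)[of 0] by (simp add: norm_mult)
  qed
  also have "\<dots> = e * (1 + 2 / (1 - \<rho>) + 8 / (1 - \<rho>)\<^sup>2)"
    using \<eta> by (simp add: \<eta>_def field_simps power2_eq_square)
  finally show ?thesis .
qed

lemma linear_operator_diff:
  assumes "linear_operator \<alpha> \<beta> T" "f \<in> zygmund_space \<alpha>" "h \<in> zygmund_space \<alpha>"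
  shows "T (\<lambda>z. f z - h z) = (\<lambda>z. T f z - T h z)"
proof -
  have "T (\<lambda>z. f z + (- 1) * h z) = (\<lambda>z. T f z + T (\<lambda>z. (- 1) * h z) z)"
    using assms(1)[unfolded linear_operator_def, THEN conjunct2, THEN conjunct1, rule_format,
        OF assms(2) zygmund_space_cmult(1)[OF assms(3)]] .
  moreover have "T (\<lambda>z. (- 1) * h z) = (\<lambda>z. (- 1) * T h z)"
    using assms unfolding linear_operator_def by blast
  ultimately show ?thesis by simp
qed

lemma neg_dilate_zygmund:
  assumes "f \<in> zygmund_space \<alpha>" "\<alpha> > 0" "0 \<le> \<rho>" "\<rho> \<le> 1"
  shows "(\<lambda>z. - dilate \<rho> f z) \<in> zygmund_space \<alpha>"
  using zygmund_space_cmult(1)[OF dilate_zygmund[OF assms], of "-1"] by simp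

text \<open>A sequence in the unit ball has a subsequence converging locally uniformly to an element of the
  ball; its dilations converge in norm, and so do their images. Hence the image of the ball is itself
  sequentially compact. The sign makes the operator directly usable as a summand that subtracts.\<close>

lemma compact_operator_dilate:
  assumes T: "bounded_operator \<alpha> \<beta> T" and \<alpha>: "\<alpha> > 0" and \<rho>: "0 \<le> \<rho>" "\<rho> < 1"
  shows "compact_operator \<alpha> \<beta> (\<lambda>f. T (\<lambda>z. - dilate \<rho> f z))" (is "compact_operator \<alpha> \<beta> ?K")
proof -
  interpret M: Metric_space "zygmund_space \<beta>" "zygmund_dist \<beta>" by (rule Metric_space_zygmund)
  have lin: "linear_operator \<alpha> \<beta> T" using T by (simp add: bounded_operator_def)
  obtain C where C: "\<And>f. f \<in> zygmund_space \<alpha> \<Longrightarrow> zygmund_norm \<beta> (T f) \<le> C * zygmund_norm \<alpha> f"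
    using T by (auto simp: bounded_operator_def)
  note nd = neg_dilate_zygmund[OF _ \<alpha> \<rho>(1) less_imp_le[OF \<rho>(2)]]
  have linK: "linear_operator \<alpha> \<beta> ?K"
    unfolding linear_operator_def
  proof (intro conjI ballI allI)
    fix f h assume fh: "f \<in> zygmund_space \<alpha>" "h \<in> zygmund_space \<alpha>"
    show "?K f \<in> zygmund_space \<beta>" using lin nd[OF fh(1)] by (auto simp: linear_operator_def)
    have "(\<lambda>z. - dilate \<rho> (\<lambda>z. f z + h z) z) = (\<lambda>z. - dilate \<rho> f z + - dilate \<rho> h z)"
      by (auto simp: dilate_def disc_part_def)
    then show "?K (\<lambda>z. f z + h z) = (\<lambda>z. ?K f z + ?K h z)"
      using lin nd[OF fh(1)] nd[OF fh(2)] unfolding linear_operator_def by metis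
  next
    fix c f assume f: "f \<in> zygmund_space \<alpha>"
    have "(\<lambda>z. - dilate \<rho> (\<lambda>z. c * f z) z) = (\<lambda>z. c * - dilate \<rho> f z)"
      by (auto simp: dilate_def disc_part_def)
    then show "?K (\<lambda>z. c * f z) = (\<lambda>z. c * ?K f z)"
      using lin nd[OF f] unfolding linear_operator_def by metis
  qed
  let ?S = "?K ` zygmund_unit_ball \<alpha>"
  have "compactin M.mtopology ?S"
    unfolding M.compactin_sequentially
  proof (intro conjI allI impI)
    show "?S \<subseteq> zygmund_space \<beta>"
      using linK by (auto simp: linear_operator_def zygmund_unit_ball_def)
    fix \<sigma> :: "nat \<Rightarrow> _" assume "range \<sigma> \<subseteq> ?S"
    then have "\<forall>n. \<exists>f\<in>zygmund_unit_ball \<alpha>. \<sigma> n = ?K f" by blast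
    then obtain f where f: "\<And>n. f n \<in> zygmund_unit_ball \<alpha>" "\<And>n. \<sigma> n = ?K (f n)" by metis
    obtain l r where l: "l \<in> zygmund_unit_ball \<alpha>" and r: "strict_mono (r :: nat \<Rightarrow> nat)"
      and ul: "\<And>s. s < 1 \<Longrightarrow> uniform_limit (cball 0 s) (f \<circ> r) l sequentially"
      by (rule unit_ball_normal_family[where f = f, OF \<alpha> f(1)]) (rule that)
    have mem: "l \<in> zygmund_space \<alpha>" "f n \<in> zygmund_space \<alpha>" for n
      using l f(1)[of n] by (auto simp: zygmund_unit_ball_def)
    have K: "?K h \<in> zygmund_space \<beta>" if "h \<in> zygmund_space \<alpha>" for h
      using linK that by (auto simp: linear_operator_def)
    define k where "k = 1 + 2 / (1 - \<rho>) + 8 / (1 - \<rho>)\<^sup>2"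
    have k: "k > 0" using \<rho> by (auto simp: k_def intro!: add_pos_nonneg)
    have dist: "zygmund_dist \<beta> (?K (f n)) (?K l) \<le> max C 0 * (e * k)"
      if e: "e \<ge> 0" and n: "\<And>z. cmod z \<le> (1 + \<rho>) / 2 \<Longrightarrow> cmod (f n z - l z) \<le> e" for n e
    proof -
      define d where "d = (\<lambda>z. f n z - l z)"
      have d: "d \<in> zygmund_space \<alpha>" unfolding d_def by (intro zygmund_space_diff mem)
      have "(\<lambda>z. - dilate \<rho> (f n) z - - dilate \<rho> l z) = (\<lambda>z. - dilate \<rho> d z)"
        by (auto simp: dilate_def disc_part_def d_def)
      then have "(\<lambda>z. ?K (f n) z - ?K l z) = T (\<lambda>z. - dilate \<rho> d z)"
        using linear_operator_diff[OF lin nd[OF mem(2)[of n]] nd[OF mem(1)]] by simp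
      then have "zygmund_dist \<beta> (?K (f n)) (?K l) = zygmund_norm \<beta> (T (\<lambda>z. - dilate \<rho> d z))"
        using K[OF mem(1)] K[OF mem(2)] by (simp add: zygmund_dist_def)
      also have "\<dots> \<le> C * zygmund_norm \<alpha> (\<lambda>z. - dilate \<rho> d z)" using C[OF nd[OF d]] .
      also have "\<dots> \<le> max C 0 * zygmund_norm \<alpha> (\<lambda>z. - dilate \<rho> d z)"
        by (intro mult_right_mono) (auto simp: zygmund_norm_nonneg)
      also have "\<dots> \<le> max C 0 * (e * k)"
      proof (rule mult_left_mono)
        have "zygmund_norm \<alpha> (\<lambda>z. - dilate \<rho> d z) \<le> zygmund_norm \<alpha> (dilate \<rho> d)"
          using zygmund_space_cmult(2)[OF dilate_zygmund[OF d \<alpha> \<rho>(1) less_imp_le[OF \<rho>(2)]], of "-1"] by simp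
        also have "\<dots> \<le> e * k"
          unfolding k_def using n
          by (intro dilate_norm_le[OF zygmund_spaceD(1)[OF d] \<alpha> \<rho> e]) (auto simp: d_def)
        finally show "zygmund_norm \<alpha> (\<lambda>z. - dilate \<rho> d z) \<le> e * k" .
      qed auto
      finally show ?thesis .
    qed
    have "(\<lambda>n. zygmund_dist \<beta> ((\<sigma> \<circ> r) n) (?K l)) \<longlonglongrightarrow> 0"
    proof (rule LIMSEQ_I)
      fix \<epsilon> :: real assume \<epsilon>: "\<epsilon> > 0"
      define c where "c = max C 0 + 1"
      have c: "c > 0" "max C 0 \<le> c" by (auto simp: c_def)
      define e where "e = \<epsilon> / (2 * c * k)"
      have e: "e > 0" using \<epsilon> k c by (simp add: e_def)
      have "(1 + \<rho>) / 2 < 1" using \<rho> by simp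
      from uniform_limitD[OF ul[OF this] e] obtain N where
        N: "\<And>n z. n \<ge> N \<Longrightarrow> z \<in> cball 0 ((1 + \<rho>) / 2) \<Longrightarrow> dist ((f \<circ> r) n z) (l z) < e"
        unfolding eventually_sequentially by blast
      have "zygmund_dist \<beta> ((\<sigma> \<circ> r) n) (?K l) < \<epsilon>" if "n \<ge> N" for n
      proof -
        have "zygmund_dist \<beta> (?K (f (r n))) (?K l) \<le> max C 0 * (e * k)"
          using N[OF that] e by (intro dist) (auto simp: dist_norm less_imp_le)
        also have "\<dots> \<le> c * (e * k)" using e k c by (intro mult_right_mono) auto
        also have "\<dots> = \<epsilon> / 2" using k c by (simp add: e_def)
        also have "\<dots> < \<epsilon>" using \<epsilon> by simp
        finally show ?thesis by (simp add: f(2))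
      qed
      then show "\<exists>no. \<forall>n\<ge>no. norm (zygmund_dist \<beta> ((\<sigma> \<circ> r) n) (?K l) - 0) < \<epsilon>"
        by auto
    qed
    then have "limitin M.mtopology (\<sigma> \<circ> r) (?K l) sequentially"
      unfolding M.limitin_metric_dist_null using K mem by (auto simp: f(2))
    then show "\<exists>l r. l \<in> ?S \<and> strict_mono r \<and> limitin M.mtopology (\<sigma> \<circ> r) l sequentially"
      using l r by blast
  qed
  moreover from this have "M.mtopology closure_of ?S = ?S"
    by (simp add: closure_of_eq compactin_imp_closedin M.Hausdorff_space_mtopology)
  ultimately show ?thesis using linK by (simp add: compact_operator_def zygmund_topology_def)
qed

section \<open>Upper estimates of the essential norm\<close>

lemma essential_norm_leI:
  assumes "compact_operator \<alpha> \<beta> K"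
    "\<And>f. f \<in> zygmund_unit_ball \<alpha> \<Longrightarrow> zygmund_norm \<beta> (\<lambda>z. T f z + K f z) \<le> c"
  shows "essential_norm \<alpha> \<beta> T \<le> ereal c"
proof -
  have "essential_norm \<alpha> \<beta> T \<le> operator_norm \<alpha> \<beta> (\<lambda>f z. T f z + K f z)"
    unfolding essential_norm_def using assms(1) by (intro INF_lower) auto
  also have "\<dots> \<le> ereal c"
    unfolding operator_norm_def using assms(2) by (intro SUP_least) auto
  finally show ?thesis .
qed

lemma essential_norm_nonneg: "0 \<le> essential_norm \<alpha> \<beta> T"
  unfolding essential_norm_def operator_norm_def
proof (intro INF_greatest)
  fix K
  have "(\<lambda>_. 0) \<in> zygmund_unit_ball \<alpha>"
    using zygmund_space_zero[of \<alpha>] by (simp add: zygmund_unit_ball_def)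
  then show "0 \<le> (SUP f\<in>zygmund_unit_ball \<alpha>. ereal (zygmund_norm \<beta> (\<lambda>z. T f z + K f z)))"
    by (rule SUP_upper2) (simp add: zygmund_norm_nonneg)
qed

text \<open>The derivative of the dilation is \<open>\<rho> f'(\<rho> z)\<close>; the factor \<open>\<rho>\<close> costs an additional \<open>(1 - \<rho>) |f'|\<close>.\<close>

lemma dilation_error_local:
  assumes "\<alpha> > 0" "s < 1"
  obtains L where "L > 0"
    "\<And>f \<rho> z. f \<in> zygmund_unit_ball \<alpha> \<Longrightarrow> 0 \<le> \<rho> \<Longrightarrow> \<rho> \<le> 1 \<Longrightarrow> cmod z \<le> s \<Longrightarrow>
       cmod (f z - f (of_real \<rho> * z)) \<le> L * (1 - \<rho>)"
    "\<And>f \<rho> z. f \<in> zygmund_unit_ball \<alpha> \<Longrightarrow> 0 \<le> \<rho> \<Longrightarrow> \<rho> \<le> 1 \<Longrightarrow> cmod z \<le> s \<Longrightarrow>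
       cmod (deriv f z - of_real \<rho> * deriv f (of_real \<rho> * z)) \<le> L * (1 - \<rho>)"
proof -
  define \<gamma> where "\<gamma> = \<alpha> + 1"
  have \<gamma>: "\<alpha> \<le> \<gamma>" "1 < \<gamma>" using assms(1) by (auto simp: \<gamma>_def)
  define L1 where "L1 = (1 + 1 / (\<gamma> - 1)) * (1 - s) powr - (\<gamma> - 1)"
  define L2 where "L2 = 1 * (1 - s) powr - \<gamma>"
  have pos: "L1 > 0" "L2 > 0" using \<gamma> assms by (auto simp: L1_def L2_def intro!: mult_pos_pos add_pos_pos)
  show ?thesis
  proof
    show "L1 + L2 > 0" using pos by simp
    fix f :: "complex \<Rightarrow> complex" and \<rho> :: real and z :: complex assume f: "f \<in> zygmund_unit_ball \<alpha>" and \<rho>: "0 \<le> \<rho>" "\<rho> \<le> 1" and z: "cmod z \<le> s"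
    note ub = unit_ballD[OF f assms(1)]
    have zD: "z \<in> unit_disc" using z assms by auto
    note \<rho>z = scaled_in_disc[OF zD \<rho>]
    have "cmod (f z - f (of_real \<rho> * z)) \<le> L1 * (1 - \<rho>)"
      unfolding L1_def
      by (rule increment_bound_local[OF ub(6) unit_ball_crude(2)[OF f assms(1) \<gamma>]])
        (use \<gamma> assms z \<rho> in auto)
    also have "\<dots> \<le> (L1 + L2) * (1 - \<rho>)" using pos \<rho> by (intro mult_right_mono) auto
    finally show "cmod (f z - f (of_real \<rho> * z)) \<le> (L1 + L2) * (1 - \<rho>)" .
    have 1: "cmod (deriv f z - deriv f (of_real \<rho> * z)) \<le> L2 * (1 - \<rho>)"
      unfolding L2_def
      by (rule increment_bound_local[OF ub(7) unit_ball_crude(1)[OF f assms(1) \<gamma>]])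
        (use \<gamma> assms z \<rho> in auto)
    have "(1 - cmod (of_real \<rho> * z)) powr - (\<gamma> - 1) \<le> (1 - s) powr - (\<gamma> - 1)"
      using \<gamma> assms z \<rho>z by (intro powr_mono2') auto
    then have "(1 + 1 / (\<gamma> - 1)) * (1 - cmod (of_real \<rho> * z)) powr - (\<gamma> - 1) \<le> L1"
      unfolding L1_def using \<gamma> by (intro mult_left_mono) auto
    then have "cmod (deriv f (of_real \<rho> * z)) \<le> L1"
      using unit_ball_crude(2)[OF f assms(1) \<gamma> \<rho>z(1)] by linarith
    then have 2: "cmod (of_real (1 - \<rho>) * deriv f (of_real \<rho> * z)) \<le> (1 - \<rho>) * L1"
      using \<rho> unfolding norm_mult norm_of_real by (intro mult_mono) auto
    have "deriv f z - of_real \<rho> * deriv f (of_real \<rho> * z)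
        = (deriv f z - deriv f (of_real \<rho> * z)) + of_real (1 - \<rho>) * deriv f (of_real \<rho> * z)"
      by (simp add: algebra_simps)
    then show "cmod (deriv f z - of_real \<rho> * deriv f (of_real \<rho> * z)) \<le> (L1 + L2) * (1 - \<rho>)"
      using 1 2 norm_triangle_ineq[of "deriv f z - deriv f (of_real \<rho> * z)" "of_real (1 - \<rho>) * deriv f (of_real \<rho> * z)"]
      by (simp add: algebra_simps)
  qed
qed

text \<open>\<open>M\<close> bounds, up to arbitrarily small errors, the contribution of the symbol \<open>\<sigma>\<close> from points with
  \<open>\<phi> z\<close> near the circle, uniformly over the unit ball; \<open>F\<close> is the identity or the derivative, and the
  factor \<open>t \<rho>\<close> is what the chain rule puts in front of the dilated function.\<close>

definition dilation_defect_le :: "real \<Rightarrow> real \<Rightarrow> (complex \<Rightarrow> complex) \<Rightarrow> (complex \<Rightarrow> complex) \<Rightarrow>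
    fun_operator \<Rightarrow> (real \<Rightarrow> complex) \<Rightarrow> real \<Rightarrow> bool" where
  "dilation_defect_le \<alpha> \<beta> \<phi> \<sigma> F t M \<longleftrightarrow>
     (\<forall>\<epsilon>>0. \<exists>s<1. \<exists>\<rho>\<^sub>0<1. \<forall>\<rho>\<in>{\<rho>\<^sub>0<..<1}. \<forall>f\<in>zygmund_unit_ball \<alpha>. \<forall>z\<in>unit_disc.
        0 \<le> \<rho> \<longrightarrow> s < cmod (\<phi> z) \<longrightarrow> weight \<beta> z * cmod (\<sigma> z) *
          cmod (F f (\<phi> z) - t \<rho> * F f (of_real \<rho> * \<phi> z)) \<le> M + \<epsilon>)"

text \<open>The competitor for the essential norm is the compact operator \<open>f \<mapsto> - T f\<^sub>\<rho>\<close> with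
  \<open>f\<^sub>\<rho>(z) = f(\<rho> z)\<close> and \<open>\<rho>\<close> near 1. On \<open>|\<phi> z| \<le> s\<close> the difference \<open>f - f\<^sub>\<rho>\<close> is uniformly small, so only
  the points with \<open>\<phi> z\<close> near the circle contribute.\<close>

lemma essential_norm_upper:
  assumes adm: "admissible \<alpha> \<beta> \<phi> g" and \<alpha>: "\<alpha> > 0" and M: "M\<^sub>1 \<ge> 0" "M\<^sub>2 \<ge> 0"
    and u: "dilation_defect_le \<alpha> \<beta> \<phi> (first_symbol \<phi> g) deriv of_real M\<^sub>1"
    and v: "dilation_defect_le \<alpha> \<beta> \<phi> (second_symbol \<phi> g) (\<lambda>f. f) (\<lambda>_. 1) M\<^sub>2"
  shows "essential_norm \<alpha> \<beta> (comp_volterra \<phi> g) \<le> ereal (M\<^sub>1 + M\<^sub>2)"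
proof (rule ereal_le_epsilon2)
  fix e :: real assume e: "0 < e"
  define \<epsilon> where "\<epsilon> = e / 4"
  have \<epsilon>: "\<epsilon> > 0" using e by (simp add: \<epsilon>_def)
  let ?T = "comp_volterra \<phi> g"
  have hol: "\<phi> holomorphic_on unit_disc" "\<phi> ` unit_disc \<subseteq> unit_disc" "g holomorphic_on unit_disc"
    and bdd: "bounded_operator \<alpha> \<beta> ?T" using adm by (auto simp: admissible_def)
  have lin: "linear_operator \<alpha> \<beta> ?T" using bdd by (simp add: bounded_operator_def)
  have \<phi>D: "\<phi> z \<in> unit_disc" if "z \<in> unit_disc" for z using hol(2) that by blast
  obtain B where B: "B > 0"
    "\<And>z. z \<in> unit_disc \<Longrightarrow> weight \<beta> z * cmod (first_symbol \<phi> g z) \<le> B"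
    "\<And>z. z \<in> unit_disc \<Longrightarrow> weight \<beta> z * cmod (second_symbol \<phi> g z) \<le> B"
    using symbols_bounded[OF adm] by metis
  from u[unfolded dilation_defect_le_def, rule_format, OF \<epsilon>] obtain s\<^sub>1 \<rho>\<^sub>1 where s1: "s\<^sub>1 < 1" "\<rho>\<^sub>1 < 1"
    and r1: "\<forall>\<rho>\<in>{\<rho>\<^sub>1<..<1}. \<forall>f\<in>zygmund_unit_ball \<alpha>. \<forall>z\<in>unit_disc. 0 \<le> \<rho> \<longrightarrow> s\<^sub>1 < cmod (\<phi> z) \<longrightarrow>
      weight \<beta> z * cmod (first_symbol \<phi> g z) * cmod (deriv f (\<phi> z) - of_real \<rho> * deriv f (of_real \<rho> * \<phi> z)) \<le> M\<^sub>1 + \<epsilon>"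
    by blast
  from v[unfolded dilation_defect_le_def, rule_format, OF \<epsilon>, unfolded mult_1_left] obtain s\<^sub>2 \<rho>\<^sub>2 where s2: "s\<^sub>2 < 1" "\<rho>\<^sub>2 < 1"
    and r2: "\<forall>\<rho>\<in>{\<rho>\<^sub>2<..<1}. \<forall>f\<in>zygmund_unit_ball \<alpha>. \<forall>z\<in>unit_disc. 0 \<le> \<rho> \<longrightarrow> s\<^sub>2 < cmod (\<phi> z) \<longrightarrow>
      weight \<beta> z * cmod (second_symbol \<phi> g z) * cmod (f (\<phi> z) - f (of_real \<rho> * \<phi> z)) \<le> M\<^sub>2 + \<epsilon>"
    by blast
  \<comment> \<open>\<open>\<phi> 0\<close> is included because the values of the image and of its derivative at 0 enter the norm\<close>
  define s where "s = max (max s\<^sub>1 s\<^sub>2) (cmod (\<phi> 0))"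
  have s: "s < 1" "s\<^sub>1 \<le> s" "s\<^sub>2 \<le> s" "cmod (\<phi> 0) \<le> s" using s1 s2 \<phi>D[of 0] by (auto simp: s_def)
  obtain L where L: "L > 0"
    "\<And>f \<rho> z. f \<in> zygmund_unit_ball \<alpha> \<Longrightarrow> 0 \<le> \<rho> \<Longrightarrow> \<rho> \<le> 1 \<Longrightarrow> cmod z \<le> s \<Longrightarrow>
       cmod (f z - f (of_real \<rho> * z)) \<le> L * (1 - \<rho>)"
    "\<And>f \<rho> z. f \<in> zygmund_unit_ball \<alpha> \<Longrightarrow> 0 \<le> \<rho> \<Longrightarrow> \<rho> \<le> 1 \<Longrightarrow> cmod z \<le> s \<Longrightarrow>
       cmod (deriv f z - of_real \<rho> * deriv f (of_real \<rho> * z)) \<le> L * (1 - \<rho>)"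
    by (rule dilation_error_local[OF \<alpha> s(1)]) (rule that)
  have cont: "continuous_on (cball 0 s) (deriv g)"
    using s(1) by (intro holomorphic_on_imp_continuous_on holomorphic_on_subset[OF holomorphic_deriv[OF hol(3)]]) auto
  obtain A where A: "A \<ge> 0" "\<And>z. cmod z \<le> s \<Longrightarrow> cmod (deriv g z) \<le> A"
  proof -
    have "0 \<le> s" using s(4) norm_ge_zero order_trans by blast
    have "bounded (deriv g ` cball 0 s)" by (intro compact_imp_bounded compact_continuous_image cont compact_cball)
    then obtain A where A: "\<forall>w\<in>deriv g ` cball 0 s. cmod w \<le> A" unfolding bounded_iff by blast
    have "cmod (deriv g 0) \<le> A" using A \<open>0 \<le> s\<close> by simp
    then have "A \<ge> 0" using norm_ge_zero order_trans by blast
    then show ?thesis using A by (intro that[of A]) auto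
  qed
  define \<kappa> where "\<kappa> = L * (B + A * (1 + cmod (deriv \<phi> 0)) + 1)"
  have \<kappa>: "\<kappa> > 0" unfolding \<kappa>_def using L B A by (intro mult_pos_pos add_nonneg_pos add_nonneg_nonneg mult_nonneg_nonneg) auto
  define \<rho> where "\<rho> = max (max 0 (1 - \<epsilon> / \<kappa>)) (max ((\<rho>\<^sub>1 + 1) / 2) ((\<rho>\<^sub>2 + 1) / 2))"
  have \<rho>: "0 \<le> \<rho>" "\<rho> < 1" "\<rho>\<^sub>1 < \<rho>" "\<rho>\<^sub>2 < \<rho>"
    using s1 s2 \<epsilon> \<kappa> by (auto simp: \<rho>_def less_max_iff_disj)
  have "1 - \<rho> \<le> \<epsilon> / \<kappa>" by (simp add: \<rho>_def)
  then have "\<kappa> * (1 - \<rho>) \<le> \<epsilon>" using \<kappa> by (simp add: pos_le_divide_eq mult.commute)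
  moreover define q where "q = L * (1 - \<rho>)"
  moreover have "\<kappa> * (1 - \<rho>) = q * B + q * A * (1 + cmod (deriv \<phi> 0)) + q"
    by (simp add: \<kappa>_def q_def algebra_simps)
  ultimately have "q * B + q * A * (1 + cmod (deriv \<phi> 0)) + q \<le> \<epsilon>" by simp
  moreover have q: "q \<ge> 0" using L \<rho> by (simp add: q_def)
  moreover have "q * A * (1 + cmod (deriv \<phi> 0)) = q * A + q * A * cmod (deriv \<phi> 0)" by (simp add: algebra_simps)
  moreover have "0 \<le> q * B" "0 \<le> q * A" "0 \<le> q * A * cmod (deriv \<phi> 0)" using q A B by auto
  ultimately have small: "q * B \<le> \<epsilon>" "q * A + q * A * cmod (deriv \<phi> 0) \<le> \<epsilon>" by linarith+
  have "essential_norm \<alpha> \<beta> ?T \<le> ereal (M\<^sub>1 + M\<^sub>2 + e)"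
  proof (rule essential_norm_leI[OF compact_operator_dilate[OF bdd \<alpha> \<rho>(1,2)]])
    fix f assume f: "f \<in> zygmund_unit_ball \<alpha>"
    note ub = unit_ballD[OF f \<alpha>]
    define h where "h = (\<lambda>z. f z - dilate \<rho> f z)"
    have \<rho>1: "\<rho> \<le> 1" using \<rho> by simp
    have dz: "dilate \<rho> f \<in> zygmund_space \<alpha>" by (rule dilate_zygmund[OF ub(1) \<alpha> \<rho>(1) \<rho>1])
    have h: "h \<in> zygmund_space \<alpha>" unfolding h_def by (intro zygmund_space_diff ub(1) dz)
    have eq: "(\<lambda>z. ?T f z + ?T (\<lambda>z. - dilate \<rho> f z) z) = ?T h"
    proof -
      have "?T (\<lambda>z. f z + - dilate \<rho> f z) = (\<lambda>z. ?T f z + ?T (\<lambda>z. - dilate \<rho> f z) z)"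
        using lin[unfolded linear_operator_def, THEN conjunct2, THEN conjunct1, rule_format,
            OF ub(1) neg_dilate_zygmund[OF ub(1) \<alpha> \<rho>(1) \<rho>1]] .
      then show ?thesis by (simp add: h_def)
    qed
    have Th: "?T h \<in> zygmund_space \<beta>" using lin h by (auto simp: linear_operator_def)
    note dd = dilate_derivs[OF ub(2) \<rho>(1) \<rho>1]
    have hz: "h z = f z - f (of_real \<rho> * z)" "deriv h z = deriv f z - of_real \<rho> * deriv f (of_real \<rho> * z)"
      if "z \<in> unit_disc" for z
      using deriv_diff_disc(1)[OF ub(2) dd(4) that] dd(1,2)[OF that] that by (auto simp: h_def)
    have hs: "cmod (h z) \<le> q" "cmod (deriv h z) \<le> q" if "cmod z \<le> s" for z
    proof -
      have "z \<in> unit_disc" using that s by auto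
      then show "cmod (h z) \<le> q" "cmod (deriv h z) \<le> q"
        unfolding q_def hz[OF \<open>z \<in> unit_disc\<close>] using L(2,3)[OF f \<rho>(1) \<rho>1 that] by auto
    qed
    note T' = comp_volterra_derivs[OF zygmund_spaceD(1)[OF h] hol(3,1,2)]
    have main: "weight \<beta> z * cmod (deriv (deriv (?T h)) z) \<le> M\<^sub>1 + M\<^sub>2 + 2 * \<epsilon>" if z: "z \<in> unit_disc" for z
    proof -
      have w: "weight \<beta> z \<ge> 0" using weight_pos[OF z] by (simp add: less_imp_le)
      have "weight \<beta> z * cmod (first_symbol \<phi> g z) * cmod (deriv h (\<phi> z)) \<le> M\<^sub>1 + \<epsilon>"
      proof (cases "cmod (\<phi> z) \<le> s")
        case True
        have "weight \<beta> z * cmod (first_symbol \<phi> g z) * cmod (deriv h (\<phi> z)) \<le> B * q"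
          using B(2)[OF z] hs[OF True] B(1) by (intro mult_mono) auto
        then show ?thesis using small M by (simp add: mult.commute)
      next
        case False
        then show ?thesis using r1[rule_format, of \<rho> f z] \<rho> f z s(2) hz(2)[OF \<phi>D[OF z]] by simp
      qed
      moreover have "weight \<beta> z * cmod (second_symbol \<phi> g z) * cmod (h (\<phi> z)) \<le> M\<^sub>2 + \<epsilon>"
      proof (cases "cmod (\<phi> z) \<le> s")
        case True
        have "weight \<beta> z * cmod (second_symbol \<phi> g z) * cmod (h (\<phi> z)) \<le> B * q"
          using B(3)[OF z] hs[OF True] B(1) by (intro mult_mono) auto
        then show ?thesis using small M by (simp add: mult.commute)
      next
        case False
        then show ?thesis using r2[rule_format, of \<rho> f z] \<rho> f z s(3) hz(1)[OF \<phi>D[OF z]] by simp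
      qed
      moreover have "weight \<beta> z * cmod (deriv (deriv (?T h)) z) \<le>
          weight \<beta> z * (cmod (first_symbol \<phi> g z) * cmod (deriv h (\<phi> z)) + cmod (second_symbol \<phi> g z) * cmod (h (\<phi> z)))"
        unfolding T'(2)[OF z] by (intro mult_left_mono w) (metis norm_mult norm_triangle_ineq)
      ultimately show ?thesis by (simp add: algebra_simps)
    qed
    have T0: "cmod (?T h 0) \<le> q * A"
    proof -
      obtain G where G: "\<And>z. z \<in> unit_disc \<Longrightarrow> (G has_field_derivative h z * deriv g z) (at z)"
        "\<And>z. z \<in> unit_disc \<Longrightarrow> ?T h z = G (\<phi> z) - G 0"
        using comp_volterra_primitive[OF zygmund_spaceD(1)[OF h] hol(3,2)] by metis
      have sD: "z \<in> unit_disc" if "z \<in> cball 0 s" for z using that s(1) by auto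
      have "cmod (G (\<phi> 0) - G 0) \<le> q * A * cmod (\<phi> 0 - 0)"
      proof (rule field_differentiable_bound[OF convex_cball[of 0 s]])
        show "(G has_field_derivative h z * deriv g z) (at z within cball 0 s)" if "z \<in> cball 0 s" for z
          using G(1)[OF sD[OF that]] by (rule has_field_derivative_at_within)
        show "cmod (h z * deriv g z) \<le> q * A" if "z \<in> cball 0 s" for z
          using hs[of z] A(2)[of z] that q by (simp add: norm_mult mult_mono)
      qed (use s(4) order_trans[OF norm_ge_zero s(4)] in auto)
      also have "\<dots> \<le> q * A" using q A \<phi>D[of 0] by (simp add: mult_left_le)
      finally show ?thesis using G(2)[of 0] by simp
    qed
    have T1: "cmod (deriv (?T h) 0) \<le> q * A * cmod (deriv \<phi> 0)"
      using hs(1)[OF s(4)] A(2)[OF s(4)] q A(1) T'(1)[of 0] by (simp add: norm_mult mult_mono mult_right_mono)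
    have "zygmund_norm \<beta> (?T h) \<le> cmod (?T h 0) + cmod (deriv (?T h) 0) + (M\<^sub>1 + M\<^sub>2 + 2 * \<epsilon>)"
      using zygmund_spaceD[OF Th] main by (intro zygmund_spaceI(2)) auto
    also have "\<dots> \<le> M\<^sub>1 + M\<^sub>2 + e" using T0 T1 small \<epsilon> by (simp add: \<epsilon>_def)
    finally show "zygmund_norm \<beta> (\<lambda>z. ?T f z + ?T (\<lambda>z. - dilate \<rho> f z) z) \<le> M\<^sub>1 + M\<^sub>2 + e"
      unfolding eq .
  qed
  then show "essential_norm \<alpha> \<beta> ?T \<le> ereal (M\<^sub>1 + M\<^sub>2) + ereal e" by simp
qed

section \<open>Compact operators on gliding humps\<close>

text \<open>The humps are selected one at a time: near 1 the sum of those already chosen is below 1/2, so a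
  new one of size at most \<open>C\<close> is affordable there; elsewhere the new one is required to be smaller than
  \<open>(1/2) ^ (N + 1)\<close>, which is exactly the decrease of the remaining margin.\<close>

lemma gliding_hump_selection:
  fixes p :: "nat \<Rightarrow> real \<Rightarrow> real"
  assumes bdd: "\<And>k r. 0 \<le> r \<Longrightarrow> r < 1 \<Longrightarrow> p k r \<le> C" and "C \<ge> 0"
    and cpt: "\<And>s e. s < 1 \<Longrightarrow> e > 0 \<Longrightarrow> \<forall>\<^sub>F k in sequentially. \<forall>r\<in>{0..s}. p k r \<le> e"
    and bdy: "\<And>k. (p k \<longlongrightarrow> 0) (at_left 1)"
    and I: "infinite I"
  shows "\<exists>F\<subseteq>I. finite F \<and> card F = N \<and> (\<forall>r\<in>{0..<1}. (\<Sum>k\<in>F. p k r) \<le> C + 1 - (1/2) ^ N)"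
proof (induction N)
  case 0
  then show ?case using assms(2) by (intro exI[of _ "{}"]) auto
next
  case (Suc N)
  then obtain F where F: "F \<subseteq> I" "finite F" "card F = N"
    "\<And>r. r \<in> {0..<1} \<Longrightarrow> (\<Sum>k\<in>F. p k r) \<le> C + 1 - (1/2) ^ N" by blast
  have "((\<lambda>r. \<Sum>k\<in>F. p k r) \<longlongrightarrow> (\<Sum>k\<in>F. 0)) (at_left 1)"
    by (intro tendsto_sum bdy)
  then have "eventually (\<lambda>r. (\<Sum>k\<in>F. p k r) < 1/2) (at_left 1)"
    by (intro order_tendstoD(2)) auto
  then obtain s where s: "s < 1" "\<And>r. s < r \<Longrightarrow> r < 1 \<Longrightarrow> (\<Sum>k\<in>F. p k r) < 1/2"
    unfolding eventually_at_left_field by blast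
  have ev: "\<forall>\<^sub>F k in sequentially. (\<forall>r\<in>{0..s}. p k r \<le> (1/2) ^ Suc N) \<and> (\<forall>j\<in>F. j < k)"
  proof (intro eventually_conj cpt s(1))
    show "\<forall>\<^sub>F k in sequentially. \<forall>j\<in>F. j < k"
      using F(2) by (intro eventually_ball_finite ballI eventually_gt_at_top)
  qed simp
  have "\<exists>\<^sub>F k in sequentially. k \<in> I \<and> ((\<forall>r\<in>{0..s}. p k r \<le> (1/2) ^ Suc N) \<and> (\<forall>j\<in>F. j < k))"
  proof (rule frequently_eventually_frequently[OF _ ev])
    show "\<exists>\<^sub>F k in sequentially. k \<in> I"
      using I by (simp add: frequently_cofinite flip: cofinite_eq_sequentially)
  qed
  then obtain k where k: "k \<in> I" "\<And>r. r \<in> {0..s} \<Longrightarrow> p k r \<le> (1/2) ^ Suc N" "k \<notin> F"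
    using frequently_ex by blast
  have "(\<Sum>j\<in>insert k F. p j r) \<le> C + 1 - (1/2) ^ Suc N" if r: "r \<in> {0..<1}" for r
  proof (cases "r \<le> s")
    case True
    then have "p k r \<le> (1/2) ^ Suc N" using r by (intro k(2)) auto
    then show ?thesis using k(3) F(2) F(4)[OF r] by simp
  next
    case False
    have "(1/2::real) ^ Suc N \<le> 1/2" using power_le_one[of "1/2::real" N] by simp
    then show ?thesis using s(2)[of r] bdd[of r k] False r F(2) k(3) by simp
  qed
  then show ?case using k F by (intro exI[of _ "insert k F"]) auto
qed

lemma linear_operator_sum:
  assumes "linear_operator \<alpha> \<beta> K" "finite F" "\<And>k. k \<in> F \<Longrightarrow> f k \<in> zygmund_space \<alpha>"
  shows "K (\<lambda>z. \<Sum>k\<in>F. f k z) = (\<lambda>z. \<Sum>k\<in>F. K (f k) z)"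
  using assms(2,3)
proof (induction F)
  case empty
  have "K (\<lambda>z. 0) = (\<lambda>z. 0)"
    using assms(1)[unfolded linear_operator_def, THEN conjunct2, THEN conjunct2, rule_format,
        OF zygmund_space_zero(1), of 0] by simp
  then show ?case by simp
next
  case (insert k F)
  have "K (\<lambda>z. f k z + (\<Sum>k\<in>F. f k z)) = (\<lambda>z. K (f k) z + K (\<lambda>z. \<Sum>k\<in>F. f k z) z)"
    using assms(1)[unfolded linear_operator_def, THEN conjunct2, THEN conjunct1, rule_format]
      insert zygmund_space_sum(1)[of F f \<alpha>] by auto
  then show ?case using insert by simp
qed

lemma compact_operator_bounded:
  assumes "compact_operator \<alpha> \<beta> K"
  obtains B where "B > 0" "\<And>f. f \<in> zygmund_unit_ball \<alpha> \<Longrightarrow> zygmund_norm \<beta> (K f) \<le> B"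
proof -
  interpret M: Metric_space "zygmund_space \<beta>" "zygmund_dist \<beta>" by (rule Metric_space_zygmund)
  let ?S = "K ` zygmund_unit_ball \<alpha>"
  have K: "linear_operator \<alpha> \<beta> K" "compactin M.mtopology (M.mtopology closure_of ?S)"
    using assms by (auto simp: compact_operator_def zygmund_topology_def)
  have S: "?S \<subseteq> zygmund_space \<beta>"
    using K(1) by (auto simp: linear_operator_def zygmund_unit_ball_def)
  have "M.mbounded ?S"
    using M.compactin_imp_mbounded[OF K(2)] closure_of_subset[of ?S M.mtopology] S M.mbounded_subset
    by auto
  then obtain x B where xB: "?S \<subseteq> M.mcball x B" by (auto simp: M.mbounded_def)
  have "zygmund_norm \<beta> (K f) \<le> max 1 (B + zygmund_norm \<beta> x)" if "f \<in> zygmund_unit_ball \<alpha>" for f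
  proof -
    have "K f \<in> M.mcball x B" using that xB by blast
    then have *: "x \<in> zygmund_space \<beta>" "K f \<in> zygmund_space \<beta>" "zygmund_dist \<beta> (K f) x \<le> B"
      by (auto simp: M.mcball_def M.commute)
    then have "zygmund_norm \<beta> (\<lambda>z. K f z - x z) \<le> B" by (simp add: zygmund_dist_def)
    then show ?thesis
      using zygmund_space_add(2)[OF zygmund_space_diff(1)[OF *(2,1)] *(1)] by simp
  qed
  then show ?thesis by (intro that[of "max 1 (B + zygmund_norm \<beta> x)"]) auto
qed

text \<open>If \<open>K f\<^sub>k\<close> stayed away from 0, compactness would make many \<open>K f\<^sub>k\<close> nearly equal to one \<open>l \<noteq> 0\<close>;
  adding \<open>N\<close> of them gives an image of norm about \<open>N \<cdot> \<parallel>l\<parallel>\<close>, whereas the gliding hump selection keeps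
  the norm of the sum of the \<open>f\<^sub>k\<close> below a fixed constant. So these sequences behave as weakly null ones.\<close>

lemma compact_operator_gliding_hump:
  fixes f :: "nat \<Rightarrow> complex \<Rightarrow> complex" and p :: "nat \<Rightarrow> real \<Rightarrow> real"
  assumes K: "compact_operator \<alpha> \<beta> K"
    and f: "\<And>k. f k \<in> zygmund_space \<alpha>" "\<And>k. f k 0 = 0" "\<And>k. deriv (f k) 0 = 0"
    and fp: "\<And>k z. z \<in> unit_disc \<Longrightarrow> weight \<alpha> z * cmod (deriv (deriv (f k)) z) \<le> p k (cmod z)"
    and bdd: "\<And>k r. 0 \<le> r \<Longrightarrow> r < 1 \<Longrightarrow> p k r \<le> 1"
    and cpt: "\<And>s e. s < 1 \<Longrightarrow> e > 0 \<Longrightarrow> \<forall>\<^sub>F k in sequentially. \<forall>r\<in>{0..s}. p k r \<le> e"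
    and bdy: "\<And>k. (p k \<longlongrightarrow> 0) (at_left 1)"
    and \<epsilon>: "\<epsilon> > 0"
  shows "\<forall>\<^sub>F k in sequentially. zygmund_norm \<beta> (K (f k)) < \<epsilon>"
proof (rule ccontr)
  assume "\<not> ?thesis"
  then have "infinite {k. zygmund_norm \<beta> (K (f k)) \<ge> \<epsilon>}" (is "infinite ?I")
    by (simp add: not_less eventually_cofinite flip: cofinite_eq_sequentially)
  interpret M: Metric_space "zygmund_space \<beta>" "zygmund_dist \<beta>" by (rule Metric_space_zygmund)
  let ?S = "K ` zygmund_unit_ball \<alpha>"
  have lin: "linear_operator \<alpha> \<beta> K" and cK: "compactin M.mtopology (M.mtopology closure_of ?S)"
    using K by (auto simp: compact_operator_def zygmund_topology_def)
  obtain B where B: "B > 0" "\<And>f. f \<in> zygmund_unit_ball \<alpha> \<Longrightarrow> zygmund_norm \<beta> (K f) \<le> B"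
    using compact_operator_bounded[OF K] by metis
  have Kin: "K h \<in> zygmund_space \<beta>" if "h \<in> zygmund_space \<alpha>" for h
    using lin that by (auto simp: linear_operator_def)
  have S: "?S \<subseteq> zygmund_space \<beta>" using Kin by (auto simp: zygmund_unit_ball_def)
  have sum_norm: "zygmund_norm \<alpha> (\<lambda>z. \<Sum>k\<in>F. f k z) \<le> c"
    if F: "finite F" "\<And>r. 0 \<le> r \<Longrightarrow> r < 1 \<Longrightarrow> (\<Sum>k\<in>F. p k r) \<le> c" for F c
  proof -
    have der: "(f k has_field_derivative deriv (f k) z) (at z)"
      "(deriv (f k) has_field_derivative deriv (deriv (f k)) z) (at z)" if "z \<in> unit_disc" for k z
      using zygmund_spaceD(1)[OF f(1)] that by (auto intro!: holomorphic_derivI holomorphic_deriv)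
    note D = deriv2_eqI[where f = "\<lambda>z. \<Sum>k\<in>F. f k z" and ?f1.0 = "\<lambda>z. \<Sum>k\<in>F. deriv (f k) z"
        and ?f2.0 = "\<lambda>z. \<Sum>k\<in>F. deriv (deriv (f k)) z", OF DERIV_sum DERIV_sum, OF der]
    have "zygmund_norm \<alpha> (\<lambda>z. \<Sum>k\<in>F. f k z) \<le>
        cmod (\<Sum>k\<in>F. f k 0) + cmod (deriv (\<lambda>z. \<Sum>k\<in>F. f k z) 0) + c"
    proof (rule zygmund_spaceI(2))
      fix z :: complex assume z: "z \<in> unit_disc"
      have "weight \<alpha> z * cmod (\<Sum>k\<in>F. deriv (deriv (f k)) z) \<le>
          weight \<alpha> z * (\<Sum>k\<in>F. cmod (deriv (deriv (f k)) z))"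
        using weight_pos[OF z, of \<alpha>] by (intro mult_left_mono norm_sum) auto
      also have "\<dots> \<le> (\<Sum>k\<in>F. p k (cmod z))"
        unfolding sum_distrib_left by (intro sum_mono fp z)
      also have "\<dots> \<le> c" using z by (intro F(2)) auto
      finally show "weight \<alpha> z * cmod (deriv (deriv (\<lambda>z. \<Sum>k\<in>F. f k z)) z) \<le> c"
        by (simp only: D(2)[OF _ _ z])
    qed (use zygmund_spaceD(1,2)[OF f(1)] in \<open>auto intro!: holomorphic_on_sum\<close>)
    also have "\<dots> = c" using D(1)[of 0] by (simp add: f)
    finally show ?thesis .
  qed
  have ball: "f k \<in> zygmund_unit_ball \<alpha>" for k
    using sum_norm[of "{k}" 1] bdd f(1) by (simp add: zygmund_unit_ball_def)
  define e where "e = enumerate ?I"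
  have e: "strict_mono e" "\<And>n. e n \<in> ?I"
    using strict_mono_enumerate[OF \<open>infinite ?I\<close>] enumerate_in_set[OF \<open>infinite ?I\<close>] by (auto simp: e_def)
  have "range (\<lambda>n. K (f (e n))) \<subseteq> M.mtopology closure_of ?S"
    using closure_of_subset[of ?S M.mtopology] S ball by auto
  then obtain l r where l: "strict_mono (r :: nat \<Rightarrow> nat)"
    "limitin M.mtopology ((\<lambda>n. K (f (e n))) \<circ> r) l sequentially"
    using cK unfolding M.compactin_sequentially by blast
  have lin\<beta>: "l \<in> zygmund_space \<beta>" using l(2) unfolding M.limitin_metric by simp
  have "\<forall>\<^sub>F n in sequentially. zygmund_dist \<beta> (K (f (e (r n)))) l < \<epsilon> / 4"
    using l(2) \<epsilon> unfolding M.limitin_metric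
    by (auto dest!: spec[of _ "\<epsilon> / 4"] elim: eventually_mono)
  then obtain n0 where n0: "\<And>n. n \<ge> n0 \<Longrightarrow> zygmund_norm \<beta> (\<lambda>z. K (f (e (r n))) z - l z) < \<epsilon> / 4"
    unfolding eventually_sequentially by (auto simp: zygmund_dist_def lin\<beta> Kin f)
  define J where "J = (e \<circ> r) ` {n0..}"
  have "inj (e \<circ> r)" using e(1) l(1) by (intro strict_mono_imp_inj_on strict_mono_o)
  then have J: "infinite J" unfolding J_def
    by (subst finite_image_iff) (auto intro: inj_on_subset simp: infinite_Ici)
  have near: "zygmund_norm \<beta> (\<lambda>z. K (f k) z - l z) < \<epsilon> / 4" "k \<in> ?I" if "k \<in> J" for k
    using that n0 e(2) by (auto simp: J_def)
  have nl: "zygmund_norm \<beta> l \<ge> \<epsilon> * (3 / 4)"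
  proof -
    obtain k where k: "k \<in> J" using J by (metis finite.emptyI ex_in_conv)
    have "zygmund_norm \<beta> (\<lambda>z. (K (f k) z - l z) + l z) \<le> zygmund_norm \<beta> (\<lambda>z. K (f k) z - l z) + zygmund_norm \<beta> l"
      using Kin[OF f(1)] lin\<beta> by (intro zygmund_space_add zygmund_space_diff)
    then show ?thesis using near[OF k] by simp
  qed
  obtain N :: nat where N: "N > 4 * B / \<epsilon>" using reals_Archimedean2 by blast
  then have N0: "N > 0" using B \<epsilon> by (auto intro!: Nat.gr0I simp: zero_less_mult_iff divide_less_0_iff)
  obtain F where F: "F \<subseteq> J" "finite F" "card F = N" "\<And>r. r \<in> {0..<1} \<Longrightarrow> (\<Sum>k\<in>F. p k r) \<le> 1 + 1 - (1/2) ^ N"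
    using gliding_hump_selection[of p 1 J N, OF bdd _ cpt bdy J] by force
  define h where "h = (\<lambda>z. \<Sum>k\<in>F. f k z)"
  have h: "h \<in> zygmund_space \<alpha>" unfolding h_def by (intro zygmund_space_sum F f)
  have "(\<Sum>k\<in>F. p k r) \<le> 2" if "0 \<le> r" "r < 1" for r
  proof -
    have "(0::real) \<le> (1/2) ^ N" by simp
    moreover have "(\<Sum>k\<in>F. p k r) \<le> 1 + 1 - (1/2) ^ N" by (rule F(4)) (use that in auto)
    ultimately show ?thesis by linarith
  qed
  then have "zygmund_norm \<alpha> h \<le> 2"
    unfolding h_def by (intro sum_norm F(2)) auto
  then have hb: "(\<lambda>z. (1/2) * h z) \<in> zygmund_unit_ball \<alpha>"
    using zygmund_space_cmult[OF h, of "1/2"] by (auto simp: zygmund_unit_ball_def)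
  have "K (\<lambda>z. 2 * ((1/2) * h z)) = (\<lambda>z. 2 * K (\<lambda>z. (1/2) * h z) z)"
    using lin[unfolded linear_operator_def, THEN conjunct2, THEN conjunct2, rule_format,
        OF zygmund_space_cmult(1)[OF h, of "1/2"], of 2] .
  then have "zygmund_norm \<beta> (K h) \<le> 2 * zygmund_norm \<beta> (K (\<lambda>z. (1/2) * h z))"
    using zygmund_space_cmult(2)[OF Kin[OF zygmund_space_cmult(1)[OF h, of "1/2"]], of 2] by simp
  also have "\<dots> \<le> 2 * B" using B(2)[OF hb] by simp
  finally have KhB: "zygmund_norm \<beta> (K h) \<le> 2 * B" .
  define d where "d = (\<lambda>z. \<Sum>k\<in>F. K (f k) z - l z)"
  have d: "d \<in> zygmund_space \<beta>" "zygmund_norm \<beta> d \<le> (\<Sum>k\<in>F. zygmund_norm \<beta> (\<lambda>z. K (f k) z - l z))"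
    unfolding d_def by (intro zygmund_space_sum F zygmund_space_diff Kin f lin\<beta>)+
  have "zygmund_norm \<beta> d \<le> (\<Sum>k\<in>F. \<epsilon> / 4)"
    using d(2) by (rule order_trans) (intro sum_mono less_imp_le near(1) subsetD[OF F(1)])
  then have dN: "zygmund_norm \<beta> d \<le> N * (\<epsilon> / 4)" using F(3) by simp
  have Nl: "(\<lambda>z. K h z - d z) = (\<lambda>z. of_nat N * l z)"
    using linear_operator_sum[OF lin F(2), of f] f F(3) by (simp add: h_def d_def sum_subtractf fun_eq_iff)
  have Nl': "(\<lambda>z. of_nat N * l z) \<in> zygmund_space \<beta>" by (rule zygmund_space_cmult(1)[OF lin\<beta>])
  have "zygmund_norm \<beta> (\<lambda>z. (1 / of_nat N) * (of_nat N * l z)) \<le> cmod (1 / of_nat N) * zygmund_norm \<beta> (\<lambda>z. of_nat N * l z)"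
    by (rule zygmund_space_cmult(2)[OF Nl'])
  then have "N * zygmund_norm \<beta> l \<le> zygmund_norm \<beta> (\<lambda>z. of_nat N * l z)"
    using N0 by (simp add: norm_divide field_simps)
  also have "\<dots> \<le> 2 * B + N * (\<epsilon> / 4)"
    using zygmund_space_diff(2)[OF Kin[OF h] d(1)] KhB dN by (simp add: Nl)
  finally have "N * zygmund_norm \<beta> l \<le> 2 * B + N * (\<epsilon> / 4)" .
  moreover have "N * (\<epsilon> * (3/4)) \<le> N * zygmund_norm \<beta> l" using nl by (intro mult_left_mono) auto
  ultimately have "N * \<epsilon> \<le> 4 * B" by simp
  then show False using N \<epsilon> by (simp add: pos_divide_less_eq)
qed

section \<open>Lower estimates of the essential norm\<close>

text \<open>A polynomial with lowest degree at least \<open>n\<close> and nonnegative coefficients is smaller at radius \<open>s\<close>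
  than at a larger radius \<open>t\<close> by the factor \<open>(s / t) ^ n\<close>, up to the shift of degree by the two
  derivatives, while the weighted bound controls its value at \<open>t\<close>.\<close>

lemma polynomial_hump_small:
  fixes b :: "nat \<Rightarrow> nat \<Rightarrow> real"
  assumes \<alpha>: "\<alpha> > 0" and b: "\<And>n k. b n k \<ge> 0" and A: "\<And>n. finite (A n)" "\<And>n k. k \<in> A n \<Longrightarrow> k \<ge> 2 \<and> k \<ge> n"
    and bnd: "\<And>n r. 0 \<le> r \<Longrightarrow> r < 1 \<Longrightarrow>
        (1 - r\<^sup>2) powr \<alpha> * (\<Sum>k\<in>A n. b n k * real k * real (k - 1) * r ^ (k - 2)) \<le> 1"
    and s: "s < 1" and e: "e > 0"
  shows "\<forall>\<^sub>F n in sequentially. \<forall>r\<in>{0..s}.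
        (1 - r\<^sup>2) powr \<alpha> * (\<Sum>k\<in>A n. b n k * real k * real (k - 1) * r ^ (k - 2)) \<le> e"
proof -
  let ?c = "\<lambda>n k. b n k * real k * real (k - 1)"
  define t where "t = (1 + max s 0) / 2"
  have t: "max s 0 < t" "0 < t" "t < 1" using s by (auto simp: t_def)
  define q where "q = max s 0 / t"
  have q: "0 \<le> q" "q < 1" using t by (auto simp: q_def)
  have t2: "1 - t\<^sup>2 > 0" using t by (simp add: power_less_one_iff)
  define C where "C = 1 / (1 - t\<^sup>2) powr \<alpha>"
  have C: "C > 0" using t2 by (simp add: C_def)
  have le: "(1 - r\<^sup>2) powr \<alpha> * (\<Sum>k\<in>A n. ?c n k * r ^ (k - 2)) \<le> q ^ (n - 2) * C" if r: "r \<in> {0..s}" for n r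
  proof -
    have r01: "0 \<le> r" "r < 1" "r\<^sup>2 \<le> 1" using r s by (auto simp: power_le_one)
    have rt: "r = (r / t) * t" using t by simp
    have rq: "0 \<le> r / t" "r / t \<le> q" using r t by (auto simp: q_def divide_right_mono)
    have "(\<Sum>k\<in>A n. ?c n k * r ^ (k - 2)) \<le> (\<Sum>k\<in>A n. q ^ (n - 2) * (?c n k * t ^ (k - 2)))"
    proof (rule sum_mono)
      fix k assume k: "k \<in> A n"
      have "r ^ (k - 2) = (r / t) ^ (k - 2) * t ^ (k - 2)" using t by (simp add: power_divide)
      also have "\<dots> \<le> q ^ (n - 2) * t ^ (k - 2)"
      proof (rule mult_right_mono)
        have "(r / t) ^ (k - 2) \<le> q ^ (k - 2)" using rq by (intro power_mono) auto
        also have "\<dots> \<le> q ^ (n - 2)" using q A(2)[OF k] by (intro power_decreasing) auto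
        finally show "(r / t) ^ (k - 2) \<le> q ^ (n - 2)" .
      qed (use t in auto)
      finally have "?c n k * r ^ (k - 2) \<le> ?c n k * (q ^ (n - 2) * t ^ (k - 2))"
        using b[of n k] by (intro mult_left_mono) auto
      then show "?c n k * r ^ (k - 2) \<le> q ^ (n - 2) * (?c n k * t ^ (k - 2))" by (simp add: mult_ac)
    qed
    also have "\<dots> = q ^ (n - 2) * (\<Sum>k\<in>A n. ?c n k * t ^ (k - 2))" by (simp add: sum_distrib_left)
    also have "\<dots> \<le> q ^ (n - 2) * C"
      using bnd[of t n] t t2 q by (intro mult_left_mono) (auto simp: C_def pos_le_divide_eq mult.commute)
    finally have *: "(\<Sum>k\<in>A n. ?c n k * r ^ (k - 2)) \<le> q ^ (n - 2) * C" .
    have "(1 - r\<^sup>2) powr \<alpha> \<le> 1" using r01 \<alpha> by (intro powr_le1) auto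
    then have "(1 - r\<^sup>2) powr \<alpha> * (\<Sum>k\<in>A n. ?c n k * r ^ (k - 2)) \<le> 1 * (\<Sum>k\<in>A n. ?c n k * r ^ (k - 2))"
      using b r01 by (intro mult_right_mono sum_nonneg) auto
    then show ?thesis using * by simp
  qed
  have "(\<lambda>n. q ^ n * C) \<longlonglongrightarrow> 0 * C" using q by (intro tendsto_intros LIMSEQ_realpow_zero) auto
  then have "(\<lambda>n. q ^ (n - 2) * C) \<longlonglongrightarrow> 0"
    by (intro LIMSEQ_offset[where k = 2 and f = "\<lambda>n. q ^ (n - 2) * C"]) simp
  then have "\<forall>\<^sub>F n in sequentially. q ^ (n - 2) * C < e" using e by (rule order_tendstoD)
  then show ?thesis 
  proof eventually_elim
    case (elim n)
    then show ?case using le[of _ n] by (intro ballI) (rule order_trans, assumption, simp)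
  qed
qed

lemma cnj_sgn_mult: "cnj (sgn w) * w = of_real (cmod w)"
proof (cases "w = 0")
  case False
  have "w * cnj w = of_real (cmod w) * of_real (cmod w)"
    using complex_norm_square[of w] by (simp add: power2_eq_square)
  then show ?thesis using False by (simp add: sgn_eq field_simps)
qed simp

text \<open>The test functions are polynomials with nonnegative coefficients and lowest degree tending to
  infinity, rotated so that their terms add up without cancellation at \<open>\<phi> z\<close>. A compact perturbation of the
  operator is asymptotically invisible on them, so the second derivatives of their images are bounded
  by a multiple of the essential norm. The factor \<open>cnj (sgn (\<phi> z))\<close> is the rotation, differentiated once; it vanishes
  at zeros of \<open>\<phi>\<close>, where all terms do because the degrees are at least 2.\<close>

lemma essential_norm_lower:
  fixes b :: "nat \<Rightarrow> nat \<Rightarrow> real"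
  assumes adm: "admissible \<alpha> \<beta> \<phi> g" and \<alpha>: "\<alpha> > 0" and M: "M > 0"
    and ess: "essential_norm \<alpha> \<beta> (comp_volterra \<phi> g) < ereal M"
    and b: "\<And>n k. b n k \<ge> 0" and A: "\<And>n. finite (A n)" "\<And>n k. k \<in> A n \<Longrightarrow> k \<ge> 2 \<and> k \<ge> n"
    and bnd: "\<And>n r. 0 \<le> r \<Longrightarrow> r < 1 \<Longrightarrow>
        (1 - r\<^sup>2) powr \<alpha> * (\<Sum>k\<in>A n. b n k * real k * real (k - 1) * r ^ (k - 2)) \<le> 1"
  shows "\<forall>\<^sub>F n in sequentially. \<forall>z\<in>unit_disc.
      weight \<beta> z * cmod (first_symbol \<phi> g z * cnj (sgn (\<phi> z)) * of_real (\<Sum>k\<in>A n. b n k * real k * cmod (\<phi> z) ^ (k - 1))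
        + second_symbol \<phi> g z * of_real (\<Sum>k\<in>A n. b n k * cmod (\<phi> z) ^ k)) \<le> 2 * M"
proof -
  let ?T = "comp_volterra \<phi> g"
  define Q where "Q n z = weight \<beta> z * cmod (first_symbol \<phi> g z * cnj (sgn (\<phi> z)) * of_real (\<Sum>k\<in>A n. b n k * real k * cmod (\<phi> z) ^ (k - 1))
        + second_symbol \<phi> g z * of_real (\<Sum>k\<in>A n. b n k * cmod (\<phi> z) ^ k))" for n z
  have hol: "\<phi> holomorphic_on unit_disc" "\<phi> ` unit_disc \<subseteq> unit_disc" "g holomorphic_on unit_disc"
    and bdd: "bounded_operator \<alpha> \<beta> ?T" using adm by (auto simp: admissible_def)
  have \<phi>D: "\<phi> z \<in> unit_disc" if "z \<in> unit_disc" for z using hol(2) that by blast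
  have lin: "linear_operator \<alpha> \<beta> ?T" using bdd by (simp add: bounded_operator_def)
  obtain K where K: "compact_operator \<alpha> \<beta> K" "operator_norm \<alpha> \<beta> (\<lambda>f z. ?T f z + K f z) < ereal M"
  proof -
    have "\<exists>K\<in>{K. compact_operator \<alpha> \<beta> K}. operator_norm \<alpha> \<beta> (\<lambda>f z. ?T f z + K f z) < ereal M"
      using ess by (simp only: essential_norm_def INF_less_iff)
    then show ?thesis by (elim bexE CollectE) (rule that)
  qed
  have linK: "linear_operator \<alpha> \<beta> K" using K(1) by (simp add: compact_operator_def)
  \<comment> \<open>points at which the claim fails, wherever there are any; the polynomials are rotated towards them
    so that one sequence of test functions serves all points of the disc\<close>
  define zz where "zz n = (SOME z. z \<in> unit_disc \<and> Q n z > 2 * M)" for n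
  have zz: "zz n \<in> unit_disc \<and> Q n (zz n) > 2 * M" if "\<exists>z\<in>unit_disc. Q n z > 2 * M" for n
    using someI_ex[OF that[unfolded Bex_def]] unfolding zz_def .
  define c where "c n = cnj (sgn (\<phi> (zz n)))" for n
  have c: "cmod (c n) \<le> 1" for n by (simp add: c_def norm_sgn)
  define P where "P n = (\<lambda>w. \<Sum>k\<in>A n. (of_real (b n k) * c n ^ k) * w ^ k)" for n
  define f where "f n = disc_part (P n)" for n
  define p where "p n r = (1 - r\<^sup>2) powr \<alpha> * (\<Sum>k\<in>A n. b n k * real k * real (k - 1) * r ^ (k - 2))" for n r
  note dP = polynomial_test_derivs[where a = "\<lambda>k. of_real (b n k) * c n ^ k" and A = "A n" for n, folded P_def]
  have holP: "P n holomorphic_on unit_disc" for n unfolding P_def by (intro holomorphic_intros)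
  have fp: "weight \<alpha> z * cmod (deriv (deriv (P n)) z) \<le> p n (cmod z)" if z: "z \<in> unit_disc" for n z
  proof -
    have "cmod (deriv (deriv (P n)) z) \<le> (\<Sum>k\<in>A n. b n k * real k * real (k - 1) * cmod z ^ (k - 2))"
      unfolding dP
    proof (rule sum_norm_le)
      fix k
      have "b n k * cmod (c n) ^ k \<le> b n k * 1"
        using c[of n] b by (intro mult_left_mono power_le_one) auto
      then have "b n k * cmod (c n) ^ k * (real k * real (k - 1) * cmod z ^ (k - 2))
          \<le> b n k * (real k * real (k - 1) * cmod z ^ (k - 2))"
        by (intro mult_right_mono) auto
      then show "cmod (of_real (b n k) * c n ^ k * of_nat k * of_nat (k - 1) * z ^ (k - 2))
          \<le> b n k * real k * real (k - 1) * cmod z ^ (k - 2)"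
        using b[of n k] by (simp add: norm_mult norm_power mult_ac)
    qed
    then show ?thesis unfolding p_def weight_def by (intro mult_left_mono) auto
  qed
  have p1: "p n r \<le> 1" if "0 \<le> r" "r < 1" for n r
    unfolding p_def using bnd[OF that] .
  have A2: "k \<noteq> 0" "k - 1 \<noteq> 0" if "k \<in> A n" for n k using A(2)[OF that] by auto
  have P0: "P n 0 = 0" "deriv (P n) 0 = 0" for n
  proof -
    show "P n 0 = 0" unfolding P_def by (intro sum.neutral ballI) (simp add: power_0_left A2)
    show "deriv (P n) 0 = 0"
      unfolding dP(1) by (intro sum.neutral ballI) (simp only: power_0_left A2 if_False mult_zero_right)
  qed
  have wP: "weight \<alpha> z * cmod (deriv (deriv (P n)) z) \<le> 1" if "z \<in> unit_disc" for n z
    using fp[OF that, of n] p1[of "cmod z" n] that by simp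
  have f: "f n \<in> zygmund_space \<alpha>" "f n \<in> zygmund_unit_ball \<alpha>" for n
    using disc_part_zygmund[OF holP[of n] wP[of _ n]] P0[of n] by (auto simp: f_def zygmund_unit_ball_def)
  have "\<forall>\<^sub>F n in sequentially. zygmund_norm \<beta> (K (f n)) < M"
  proof (rule compact_operator_gliding_hump[where f = f and p = p, OF K(1)])
    show "f n 0 = 0" "deriv (f n) 0 = 0" for n
      unfolding f_def using P0[of n] disc_part_simps(1,2)[of 0 "P n"] by simp_all
    show "weight \<alpha> z * cmod (deriv (deriv (f n)) z) \<le> p n (cmod z)" if "z \<in> unit_disc" for n z
      unfolding f_def disc_part_simps[OF that] by (rule fp[OF that])
    show "\<forall>\<^sub>F n in sequentially. \<forall>r\<in>{0..s}. p n r \<le> e" if "s < 1" "e > 0" for s e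
      unfolding p_def by (rule polynomial_hump_small[OF \<alpha> b A bnd that])
    show "(p n \<longlongrightarrow> 0) (at_left 1)" for n
    proof -
      have "((\<lambda>r::real. (1 - r\<^sup>2) powr \<alpha>) \<longlongrightarrow> (1 - 1\<^sup>2) powr \<alpha>) (at_left 1)"
      proof (rule tendsto_powr')
        have "\<forall>\<^sub>F r in at_left (1::real). -1 < r \<and> r < 1"
          using eventually_at_left_real[of "-1" "1::real"] by (auto elim: eventually_mono)
        then have "\<forall>\<^sub>F r in at_left (1::real). 0 \<le> 1 - r\<^sup>2"
          by eventually_elim (auto simp: abs_square_le_1)
        then show "1 - 1\<^sup>2 \<noteq> (0::real) \<or> 0 < \<alpha> \<and> (\<forall>\<^sub>F r in at_left (1::real). 0 \<le> 1 - r\<^sup>2)"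
          using \<alpha> by blast
      qed (intro tendsto_intros)+
      then have "((\<lambda>r::real. (1 - r\<^sup>2) powr \<alpha>) \<longlongrightarrow> 0) (at_left 1)" using \<alpha> by simp
      moreover have "((\<lambda>r. \<Sum>k\<in>A n. b n k * real k * real (k - 1) * r ^ (k - 2)) \<longlongrightarrow>
          (\<Sum>k\<in>A n. b n k * real k * real (k - 1) * 1 ^ (k - 2))) (at_left 1)"
        by (intro tendsto_intros)
      ultimately show ?thesis unfolding p_def using tendsto_mult by fastforce
    qed
  qed (use f p1 M in auto)
  then have "\<forall>\<^sub>F n in sequentially. \<forall>z\<in>unit_disc. Q n z \<le> 2 * M"
  proof eventually_elim
    case (elim n)
    show ?case
    proof (rule ccontr)
      assume "\<not> ?thesis"
      then have z: "zz n \<in> unit_disc" "Q n (zz n) > 2 * M" using zz[of n] by (auto simp: not_le)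
      define z where "z = zz n"
      note z = z[folded z_def]
      have "ereal (zygmund_norm \<beta> (\<lambda>z. ?T (f n) z + K (f n) z)) < ereal M"
        using K(2) SUP_upper[OF f(2), of "\<lambda>f. ereal (zygmund_norm \<beta> (\<lambda>z. ?T f z + K f z))" n]
        unfolding operator_norm_def by (rule le_less_trans[rotated])
      moreover have TK: "?T (f n) \<in> zygmund_space \<beta>" "K (f n) \<in> zygmund_space \<beta>"
        using lin linK f(1) by (auto simp: linear_operator_def)
      moreover have "zygmund_norm \<beta> (\<lambda>z. (?T (f n) z + K (f n) z) - K (f n) z)
          \<le> zygmund_norm \<beta> (\<lambda>z. ?T (f n) z + K (f n) z) + zygmund_norm \<beta> (K (f n))"
        by (intro zygmund_space_diff zygmund_space_add TK)
      ultimately have "zygmund_norm \<beta> (?T (f n)) < 2 * M" using elim by simp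
      moreover have "weight \<beta> z * cmod (deriv (deriv (?T (f n))) z) \<le> zygmund_norm \<beta> (?T (f n))"
        using zygmund_spaceD(5)[OF TK(1) z(1)] .
      moreover have "weight \<beta> z * cmod (deriv (deriv (?T (f n))) z) = Q n z"
      proof -
        have r: "c n * \<phi> z = of_real (cmod (\<phi> z))"
          by (simp add: c_def z_def[symmetric] cnj_sgn_mult)
        have "deriv (f n) (\<phi> z) = (\<Sum>k\<in>A n. c n * of_real (b n k * real k * cmod (\<phi> z) ^ (k - 1)))"
          unfolding f_def disc_part_simps(2)[OF \<phi>D[OF z(1)]] dP(1)
        proof (rule sum.cong[OF refl])
          fix k assume "k \<in> A n"
          then have "c n ^ k = c n * c n ^ (k - 1)" using A(2)[of k n] by (cases k) auto
          then have "c n ^ k * \<phi> z ^ (k - 1) = c n * of_real (cmod (\<phi> z) ^ (k - 1))"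
            by (simp add: power_mult_distrib[symmetric] r mult.assoc)
          then show "of_real (b n k) * c n ^ k * of_nat k * \<phi> z ^ (k - 1) = c n * of_real (b n k * real k * cmod (\<phi> z) ^ (k - 1))"
            by (simp add: mult_ac)
        qed
        moreover have "f n (\<phi> z) = (\<Sum>k\<in>A n. of_real (b n k * cmod (\<phi> z) ^ k))"
          unfolding f_def disc_part_simps(1)[OF \<phi>D[OF z(1)]] P_def
          by (intro sum.cong refl) (simp add: mult.assoc power_mult_distrib[symmetric] r)
        ultimately show ?thesis
          unfolding comp_volterra_derivs(2)[OF zygmund_spaceD(1)[OF f(1)] hol(3,1,2) z(1)] Q_def
          by (simp add: c_def z_def[symmetric] sum_distrib_left mult_ac)
      qed
      ultimately show False using z(2) by simp
    qed
  qed
  then show ?thesis unfolding Q_def .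
qed

section \<open>Powers of the self-map and the boundary behaviour of a symbol\<close>

text \<open>Pointwise real form of the statement that \<open>c n * weighted_norm \<beta> (\<sigma> \<phi> ^ n)\<close> is eventually at most \<open>B\<close>.\<close>

definition eventual_bound ::
    "(nat \<Rightarrow> real) \<Rightarrow> real \<Rightarrow> (complex \<Rightarrow> complex) \<Rightarrow> (complex \<Rightarrow> complex) \<Rightarrow> real \<Rightarrow> bool" where
  "eventual_bound c \<beta> \<phi> \<sigma> B \<longleftrightarrow> (\<forall>\<^sub>F n in sequentially. \<forall>z\<in>unit_disc.
     c n * (weight \<beta> z * cmod (\<sigma> z) * cmod (\<phi> z) ^ n) \<le> B)"

lemma eventual_bound_of_limsup:
  assumes "limsup (\<lambda>n. ereal (c n) * weighted_norm \<beta> (\<lambda>z. \<sigma> z * \<phi> z ^ n)) < ereal B" "\<And>n. c n \<ge> 0"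
  shows "eventual_bound c \<beta> \<phi> \<sigma> B"
proof -
  have "\<forall>\<^sub>F n in sequentially. ereal (c n) * weighted_norm \<beta> (\<lambda>z. \<sigma> z * \<phi> z ^ n) < ereal B"
    using Limsup_lessD[OF assms(1)] .
  then show ?thesis unfolding eventual_bound_def
  proof eventually_elim
    case (elim n)
    show ?case
    proof
      fix z assume z: "z \<in> unit_disc"
      have "ereal (weight \<beta> z * cmod (\<sigma> z * \<phi> z ^ n)) \<le> weighted_norm \<beta> (\<lambda>z. \<sigma> z * \<phi> z ^ n)"
        unfolding weighted_norm_def using z by (intro SUP_upper)
      then have "ereal (c n) * ereal (weight \<beta> z * cmod (\<sigma> z * \<phi> z ^ n))
          \<le> ereal (c n) * weighted_norm \<beta> (\<lambda>z. \<sigma> z * \<phi> z ^ n)"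
        using assms(2) by (intro ereal_mult_left_mono) auto
      also note elim
      finally show "c n * (weight \<beta> z * cmod (\<sigma> z) * cmod (\<phi> z) ^ n) \<le> B"
        by (simp add: norm_mult norm_power mult.assoc)
    qed
  qed
qed

lemma limsup_of_eventual_bound:
  assumes "eventual_bound c \<beta> \<phi> \<sigma> B" "\<forall>\<^sub>F n in sequentially. c n > 0"
  shows "limsup (\<lambda>n. ereal (c n) * weighted_norm \<beta> (\<lambda>z. \<sigma> z * \<phi> z ^ n)) \<le> ereal B"
proof (rule Limsup_bounded)
  show "\<forall>\<^sub>F n in sequentially. ereal (c n) * weighted_norm \<beta> (\<lambda>z. \<sigma> z * \<phi> z ^ n) \<le> ereal B"
    using assms unfolding eventual_bound_def
  proof eventually_elim
    case (elim n)
    have "weighted_norm \<beta> (\<lambda>z. \<sigma> z * \<phi> z ^ n) \<le> ereal (B / c n)"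
    proof (rule weighted_norm_least(1))
      fix z assume z: "z \<in> unit_disc"
      have "c n * (weight \<beta> z * cmod (\<sigma> z) * cmod (\<phi> z) ^ n) \<le> B" using elim(1) z by blast
      then show "weight \<beta> z * cmod (\<sigma> z * \<phi> z ^ n) \<le> B / c n"
        using elim(2) by (simp add: norm_mult norm_power pos_le_divide_eq mult_ac)
    qed
    then have "ereal (c n) * weighted_norm \<beta> (\<lambda>z. \<sigma> z * \<phi> z ^ n) \<le> ereal (c n) * ereal (B / c n)"
      using elim(2) by (intro ereal_mult_left_mono) auto
    then show ?case using elim(2) by simp
  qed
qed

text \<open>With \<open>r = |\<phi> z|\<close> the exponent \<open>m = \<lfloor>1 / (1 - r)\<rfloor>\<close> is the critical one: \<open>r ^ m\<close> is bounded below by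
  \<open>(1 - 1 / m) ^ m \<ge> 1 / 6\<close>, so the bound for the power \<open>m\<close> bounds the symbol itself at \<open>z\<close>.\<close>

lemma sixth_le_power:
  assumes "m \<ge> 2"
  shows "1 / 6 \<le> (1 - 1 / real m) ^ m"
proof -
  define k where "k = m div 2"
  have k: "2 * k \<le> m" "m \<le> 3 * k" "k \<le> m" using assms by (auto simp: k_def)
  have B: "1 - real j / real m \<le> (1 - 1 / real m) ^ j" for j
    using Bernoulli_inequality[of "- (1 / real m)" j] assms by simp
  have "2 * real k \<le> real m" "real m \<le> 3 * real k" "real (m - k) = real m - real k" "real m > 0"
    using k assms by linarith+
  then have "1 / 2 \<le> 1 - real k / real m" "1 / 3 \<le> 1 - real (m - k) / real m"
    by (simp_all add: field_simps)
  then have "1 / 2 * (1 / 3) \<le> (1 - 1 / real m) ^ k * (1 - 1 / real m) ^ (m - k)"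
    using B[of k] B[of "m - k"] by (intro mult_mono) auto
  also have "\<dots> = (1 - 1 / real m) ^ m" using k by (simp flip: power_add)
  finally show ?thesis by simp
qed

lemma eventual_bound_critical_exponent:
  assumes "eventual_bound c \<beta> \<phi> \<sigma> B" "\<And>n. c n \<ge> 0"
  shows "\<exists>s<1. \<forall>z\<in>unit_disc. s < cmod (\<phi> z) \<longrightarrow> cmod (\<phi> z) < 1 \<longrightarrow>
    (\<exists>m\<ge>2. 1 / (1 - cmod (\<phi> z)) < real (m + 1) \<and> weight \<beta> z * cmod (\<sigma> z) * c m \<le> 6 * B)"
proof -
  obtain N where N: "\<And>n z. n \<ge> N \<Longrightarrow> z \<in> unit_disc \<Longrightarrow>
      c n * (weight \<beta> z * cmod (\<sigma> z) * cmod (\<phi> z) ^ n) \<le> B"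
    using assms(1) unfolding eventual_bound_def eventually_sequentially by blast
  define N' where "N' = max N 2"
  show ?thesis
  proof (intro exI[of _ "1 - 1 / real N'"] conjI ballI impI)
    show "1 - 1 / real N' < 1" by (simp add: N'_def)
    fix z assume z: "z \<in> unit_disc" and r: "1 - 1 / real N' < cmod (\<phi> z)" "cmod (\<phi> z) < 1"
    define r where "r = cmod (\<phi> z)"
    define m where "m = nat \<lfloor>1 / (1 - r)\<rfloor>"
    have r1: "1 - r > 0" "r \<ge> 0" using r by (auto simp: r_def)
    have "real N' \<le> 1 / (1 - r)"
      using r r1 by (simp add: r_def field_simps N'_def)
    then have m: "N' \<le> m" unfolding m_def by (simp add: le_nat_floor)
    have m2: "m \<ge> 2" "m \<ge> N" using m by (auto simp: N'_def)
    have mr: "real m \<le> 1 / (1 - r)" "1 / (1 - r) < real (m + 1)"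
      using r1 unfolding m_def by (auto simp: of_nat_floor) linarith
    have "1 - 1 / real m \<le> r" using mr(1) m2 r1 by (simp add: field_simps)
    moreover have "0 \<le> 1 - 1 / real m" using m2 by (simp add: field_simps)
    ultimately have "(1 - 1 / real m) ^ m \<le> r ^ m" by (intro power_mono) auto
    then have "1 / 6 \<le> r ^ m" using sixth_le_power[OF m2(1)] by linarith
    moreover have "weight \<beta> z * cmod (\<sigma> z) * c m \<ge> 0"
      using weight_pos[OF z, of \<beta>] assms(2) by simp
    ultimately have "weight \<beta> z * cmod (\<sigma> z) * c m * (1 / 6) \<le> weight \<beta> z * cmod (\<sigma> z) * c m * r ^ m"
      by (intro mult_left_mono)
    also have "\<dots> \<le> B" using N[OF m2(2) z] by (simp add: r_def mult_ac)
    finally have "weight \<beta> z * cmod (\<sigma> z) * c m \<le> 6 * B" by simp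
    then show "\<exists>m\<ge>2. 1 / (1 - cmod (\<phi> z)) < real (m + 1) \<and> weight \<beta> z * cmod (\<sigma> z) * c m \<le> 6 * B"
      using m2 mr by (auto simp: r_def)
  qed
qed

lemma symbol_bound_power:
  assumes "eventual_bound (\<lambda>n. real (n + 1) powr p) \<beta> \<phi> \<sigma> B" "p \<ge> 0" "\<phi> ` unit_disc \<subseteq> unit_disc"
  shows "\<exists>s<1. \<forall>z\<in>unit_disc. s < cmod (\<phi> z) \<longrightarrow>
    weight \<beta> z * cmod (\<sigma> z) * (1 - cmod (\<phi> z)) powr - p \<le> 6 * B"
proof -
  have "\<exists>s<1. \<forall>z\<in>unit_disc. s < cmod (\<phi> z) \<longrightarrow> cmod (\<phi> z) < 1 \<longrightarrow>
    (\<exists>m\<ge>2. 1 / (1 - cmod (\<phi> z)) < real (m + 1) \<and> weight \<beta> z * cmod (\<sigma> z) * real (m + 1) powr p \<le> 6 * B)"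
    by (rule eventual_bound_critical_exponent[OF assms(1) powr_ge_zero])
  then obtain s where s: "s < 1"
    "\<forall>z\<in>unit_disc. s < cmod (\<phi> z) \<longrightarrow> cmod (\<phi> z) < 1 \<longrightarrow>
      (\<exists>m\<ge>2. 1 / (1 - cmod (\<phi> z)) < real (m + 1) \<and> weight \<beta> z * cmod (\<sigma> z) * real (m + 1) powr p \<le> 6 * B)"
    by blast
  show ?thesis
  proof (intro exI[of _ s] conjI ballI impI s(1))
    fix z assume z: "z \<in> unit_disc" "s < cmod (\<phi> z)"
    have r: "cmod (\<phi> z) < 1" using assms(3) z(1) by force
    obtain m where m: "1 / (1 - cmod (\<phi> z)) < real (m + 1)" "weight \<beta> z * cmod (\<sigma> z) * real (m + 1) powr p \<le> 6 * B"
      using s(2) z r by blast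
    have "(1 - cmod (\<phi> z)) powr - p = (1 / (1 - cmod (\<phi> z))) powr p"
      using r by (simp add: powr_minus powr_divide field_simps)
    also have "\<dots> \<le> real (m + 1) powr p" using m(1) r assms(2) by (intro powr_mono2) auto
    finally have "weight \<beta> z * cmod (\<sigma> z) * (1 - cmod (\<phi> z)) powr - p \<le> weight \<beta> z * cmod (\<sigma> z) * real (m + 1) powr p"
      using weight_pos[OF z(1), of \<beta>] by (intro mult_left_mono) auto
    then show "weight \<beta> z * cmod (\<sigma> z) * (1 - cmod (\<phi> z)) powr - p \<le> 6 * B" using m(2) by simp
  qed
qed

text \<open>The restriction \<open>|\<phi> z| > 2/3\<close> makes the logarithm at least 1, so that it absorbs additive
  constants.\<close>

lemma ln_of_nat_nonneg: "0 \<le> ln (real n)"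
proof (cases "n = 0")
  case False
  then show ?thesis by (intro ln_ge_zero) simp
qed simp

lemma symbol_bound_log:
  assumes "eventual_bound (\<lambda>n. ln (real n)) \<beta> \<phi> \<sigma> B" "\<phi> ` unit_disc \<subseteq> unit_disc"
  shows "\<exists>s<1. \<forall>z\<in>unit_disc. s < cmod (\<phi> z) \<longrightarrow>
       1 \<le> ln (1 / (1 - cmod (\<phi> z))) \<and> weight \<beta> z * cmod (\<sigma> z) * ln (1 / (1 - cmod (\<phi> z))) \<le> 12 * B"
proof -
  have ln0: "ln (real n) \<ge> 0" for n :: nat
    by (rule ln_of_nat_nonneg)
  have "\<exists>s<1. \<forall>z\<in>unit_disc. s < cmod (\<phi> z) \<longrightarrow> cmod (\<phi> z) < 1 \<longrightarrow>
    (\<exists>m\<ge>2. 1 / (1 - cmod (\<phi> z)) < real (m + 1) \<and> weight \<beta> z * cmod (\<sigma> z) * ln (real m) \<le> 6 * B)"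
    by (rule eventual_bound_critical_exponent[OF assms(1) ln0])
  then obtain s where s: "s < 1"
    "\<forall>z\<in>unit_disc. s < cmod (\<phi> z) \<longrightarrow> cmod (\<phi> z) < 1 \<longrightarrow>
      (\<exists>m\<ge>2. 1 / (1 - cmod (\<phi> z)) < real (m + 1) \<and> weight \<beta> z * cmod (\<sigma> z) * ln (real m) \<le> 6 * B)"
    by blast
  show ?thesis
  proof (intro exI[of _ "max s (2/3)"] conjI[where P = "_ < _"] ballI impI)
    show "max s (2/3) < 1" using s(1) by simp
    fix z assume z: "z \<in> unit_disc" "max s (2/3) < cmod (\<phi> z)"
    have r: "cmod (\<phi> z) < 1" using assms(2) z(1) by force
    have z2: "s < cmod (\<phi> z)" "2 / 3 < cmod (\<phi> z)" using z(2) by simp_all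
    obtain m where m: "m \<ge> 2" "1 / (1 - cmod (\<phi> z)) < real (m + 1)" "weight \<beta> z * cmod (\<sigma> z) * ln (real m) \<le> 6 * B"
      using s(2) z(1) z2(1) r by blast
    have "3 \<le> 1 / (1 - cmod (\<phi> z))" using r z2(2) by (simp add: pos_le_divide_eq)
    then have "exp 1 \<le> 1 / (1 - cmod (\<phi> z))" using exp_le by linarith
    then have "1 \<le> ln (1 / (1 - cmod (\<phi> z)))" using r by (subst ln_ge_iff) auto
    moreover have "weight \<beta> z * cmod (\<sigma> z) * ln (1 / (1 - cmod (\<phi> z))) \<le> 12 * B"
    proof -
      have "real (m + 1) \<le> 2 * real m" using m(1) by simp
      moreover have "2 * real m \<le> real m ^ 2"
        using m(1) by (auto simp: power2_eq_square intro: mult_right_mono)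
      ultimately have "real (m + 1) \<le> real m ^ 2" by linarith
      then have "ln (1 / (1 - cmod (\<phi> z))) \<le> ln (real m ^ 2)"
        using m(2) r by (intro ln_mono) auto
      also have "\<dots> = 2 * ln (real m)" using m(1) by (simp add: ln_realpow)
      finally have "weight \<beta> z * cmod (\<sigma> z) * ln (1 / (1 - cmod (\<phi> z))) \<le> weight \<beta> z * cmod (\<sigma> z) * (2 * ln (real m))"
        using weight_pos[OF z(1), of \<beta>] by (intro mult_left_mono) auto
      then show ?thesis using m(3) by simp
    qed
    ultimately show "1 \<le> ln (1 / (1 - cmod (\<phi> z))) \<and> weight \<beta> z * cmod (\<sigma> z) * ln (1 / (1 - cmod (\<phi> z))) \<le> 12 * B" ..
  qed
qed

section \<open>Contribution of the symbols near the circle\<close>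

lemma small_power_tail:
  fixes K q \<epsilon> :: real
  assumes "K \<ge> 0" "q > 0" "\<epsilon> > 0"
  shows "\<exists>\<rho>\<^sub>0<1. \<forall>\<rho>\<in>{\<rho>\<^sub>0<..<1}. K * (1 - \<rho>) powr q \<le> \<epsilon>"
proof -
  define d where "d = (\<epsilon> / (K + 1)) powr (1 / q)"
  have d: "d > 0" "K * d powr q \<le> \<epsilon>" using assms by (auto simp: d_def powr_powr field_simps)
  have "K * (1 - \<rho>) powr q \<le> \<epsilon>" if "\<rho> \<in> {1 - d<..<1}" for \<rho>
  proof -
    have "(1 - \<rho>) powr q \<le> d powr q" using that assms by (intro powr_mono2) auto
    then have "K * (1 - \<rho>) powr q \<le> K * d powr q" using assms by (intro mult_left_mono)
    then show ?thesis using d by simp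
  qed
  then show ?thesis using d by (intro exI[of _ "1 - d"]) auto
qed

text \<open>For \<open>\<alpha> < 2\<close> the unit ball is uniformly Hoelder continuous on the closed disc, so \<open>f - f\<^sub>\<rho>\<close> is uniformly
  small and the second symbol contributes nothing; for \<open>\<alpha> < 1\<close> the same holds for the derivatives and the
  first symbol. Replacing \<open>\<alpha>\<close> by \<open>max \<alpha> (3/2)\<close> keeps all powers in the range \<open>1 < \<gamma> < 2\<close>.\<close>

lemma negligible_values:
  assumes adm: "admissible \<alpha> \<beta> \<phi> g" and \<alpha>: "0 < \<alpha>" "\<alpha> < 2"
  shows "dilation_defect_le \<alpha> \<beta> \<phi> (second_symbol \<phi> g) (\<lambda>f. f) (\<lambda>_. 1) 0"
  unfolding dilation_defect_le_def
proof (intro allI impI)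
  fix \<epsilon> :: real assume \<epsilon>: "\<epsilon> > 0"
  define \<gamma> where "\<gamma> = max \<alpha> (3/2)"
  have \<gamma>: "\<alpha> \<le> \<gamma>" "1 < \<gamma>" "\<gamma> < 2" using \<alpha> by (auto simp: \<gamma>_def)
  obtain B where B: "B > 0" "\<And>z. z \<in> unit_disc \<Longrightarrow> weight \<beta> z * cmod (second_symbol \<phi> g z) \<le> B"
    using symbols_bounded[OF adm] by metis
  define C where "C = (1 + 1 / (\<gamma> - 1)) / (1 - (\<gamma> - 1))"
  have C: "C > 0" using \<gamma> by (auto simp: C_def intro!: divide_pos_pos add_pos_pos)
  have "\<exists>\<rho>\<^sub>0<1. \<forall>\<rho>\<in>{\<rho>\<^sub>0<..<1}. B * C * (1 - \<rho>) powr (1 - (\<gamma> - 1)) \<le> \<epsilon>"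
    using B C \<gamma> \<epsilon> by (intro small_power_tail) auto
  then obtain \<rho>\<^sub>0 where \<rho>0: "\<rho>\<^sub>0 < 1" "\<forall>\<rho>\<in>{\<rho>\<^sub>0<..<1}. B * C * (1 - \<rho>) powr (1 - (\<gamma> - 1)) \<le> \<epsilon>" by blast
  have "weight \<beta> z * cmod (second_symbol \<phi> g z) * cmod (f (\<phi> z) - f (of_real \<rho> * \<phi> z)) \<le> 0 + \<epsilon>"
    if \<rho>: "\<rho> \<in> {\<rho>\<^sub>0<..<1}" "0 \<le> \<rho>" and f: "f \<in> zygmund_unit_ball \<alpha>" and z: "z \<in> unit_disc" for \<rho> f z
  proof -
    have \<phi>z: "\<phi> z \<in> unit_disc" using adm z unfolding admissible_def by blast
    have "cmod (f (\<phi> z) - f (of_real \<rho> * \<phi> z)) \<le> C * (1 - \<rho>) powr (1 - (\<gamma> - 1))"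
      unfolding C_def
      by (rule increment_bound_subcritical[OF unit_ballD(6)[OF f \<alpha>(1)] unit_ball_crude(2)[OF f \<alpha>(1) \<gamma>(1,2)]])
        (use \<gamma> \<phi>z \<rho> in auto)
    then have "weight \<beta> z * cmod (second_symbol \<phi> g z) * cmod (f (\<phi> z) - f (of_real \<rho> * \<phi> z)) \<le> B * (C * (1 - \<rho>) powr (1 - (\<gamma> - 1)))"
      using B z by (intro mult_mono) auto
    also have "\<dots> \<le> \<epsilon>" using \<rho>0(2) \<rho>(1) by (simp add: mult.assoc)
    finally show ?thesis by simp
  qed
  then show "\<exists>s<1. \<exists>\<rho>\<^sub>0<1. \<forall>\<rho>\<in>{\<rho>\<^sub>0<..<1}. \<forall>f\<in>zygmund_unit_ball \<alpha>. \<forall>z\<in>unit_disc.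
        0 \<le> \<rho> \<longrightarrow> s < cmod (\<phi> z) \<longrightarrow> weight \<beta> z * cmod (second_symbol \<phi> g z) *
          cmod (f (\<phi> z) - 1 * f (of_real \<rho> * \<phi> z)) \<le> 0 + \<epsilon>"
    using \<rho>0(1) by (intro exI[of _ 0] conjI exI[of _ \<rho>\<^sub>0]) auto
qed

lemma negligible_derivatives:
  assumes adm: "admissible \<alpha> \<beta> \<phi> g" and \<alpha>: "0 < \<alpha>" "\<alpha> < 1"
  shows "dilation_defect_le \<alpha> \<beta> \<phi> (first_symbol \<phi> g) deriv of_real 0"
  unfolding dilation_defect_le_def
proof (intro allI impI)
  fix \<epsilon> :: real assume \<epsilon>: "\<epsilon> > 0"
  obtain B where B: "B > 0" "\<And>z. z \<in> unit_disc \<Longrightarrow> weight \<beta> z * cmod (first_symbol \<phi> g z) \<le> B"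
    using symbols_bounded[OF adm] by metis
  define C where "C = 1 / (1 - \<alpha>)"
  have C: "C > 0" using \<alpha> by (auto simp: C_def)
  have "\<exists>\<rho>\<^sub>0<1. \<forall>\<rho>\<in>{\<rho>\<^sub>0<..<1}. B * (2 * C + 1) * (1 - \<rho>) powr (1 - \<alpha>) \<le> \<epsilon>"
    using B C \<alpha> \<epsilon> by (intro small_power_tail) auto
  then obtain \<rho>\<^sub>0 where \<rho>0: "\<rho>\<^sub>0 < 1" "\<forall>\<rho>\<in>{\<rho>\<^sub>0<..<1}. B * (2 * C + 1) * (1 - \<rho>) powr (1 - \<alpha>) \<le> \<epsilon>" by blast
  have "weight \<beta> z * cmod (first_symbol \<phi> g z) * cmod (deriv f (\<phi> z) - of_real \<rho> * deriv f (of_real \<rho> * \<phi> z)) \<le> 0 + \<epsilon>"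
    if \<rho>: "\<rho> \<in> {\<rho>\<^sub>0<..<1}" "0 \<le> \<rho>" and f: "f \<in> zygmund_unit_ball \<alpha>" and z: "z \<in> unit_disc" for \<rho> f z
  proof -
    have \<phi>z: "\<phi> z \<in> unit_disc" using adm z unfolding admissible_def by blast
    note ub = unit_ballD[OF f \<alpha>(1)]
    have 1: "cmod (deriv f (\<phi> z) - deriv f (of_real \<rho> * \<phi> z)) \<le> C * (1 - \<rho>) powr (1 - \<alpha>)"
      unfolding C_def
      by (rule increment_bound_subcritical[OF ub(7,5)]) (use \<alpha> \<phi>z \<rho> in auto)
    have "cmod (deriv f (of_real \<rho> * \<phi> z)) \<le> 1 + 1 / (1 - \<alpha>)"
      by (rule growth_subcritical[OF ub(7,5,4)]) (use \<alpha> scaled_in_disc(1)[OF \<phi>z] \<rho> in auto)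
    moreover have "1 - \<rho> \<le> (1 - \<rho>) powr (1 - \<alpha>)"
      using powr_mono'[of "1 - \<alpha>" 1 "1 - \<rho>"] \<rho> \<alpha> by simp
    ultimately have 2: "cmod (of_real (1 - \<rho>) * deriv f (of_real \<rho> * \<phi> z)) \<le> (1 - \<rho>) powr (1 - \<alpha>) * (1 + C)"
      unfolding norm_mult norm_of_real C_def using \<rho> by (intro mult_mono) auto
    have "deriv f (\<phi> z) - of_real \<rho> * deriv f (of_real \<rho> * \<phi> z)
        = (deriv f (\<phi> z) - deriv f (of_real \<rho> * \<phi> z)) + of_real (1 - \<rho>) * deriv f (of_real \<rho> * \<phi> z)"
      by (simp add: algebra_simps)
    then have "cmod (deriv f (\<phi> z) - of_real \<rho> * deriv f (of_real \<rho> * \<phi> z)) \<le> (2 * C + 1) * (1 - \<rho>) powr (1 - \<alpha>)"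
      using 1 2 norm_triangle_ineq[of "deriv f (\<phi> z) - deriv f (of_real \<rho> * \<phi> z)" "of_real (1 - \<rho>) * deriv f (of_real \<rho> * \<phi> z)"]
      by (simp add: algebra_simps)
    then have "weight \<beta> z * cmod (first_symbol \<phi> g z) * cmod (deriv f (\<phi> z) - of_real \<rho> * deriv f (of_real \<rho> * \<phi> z))
        \<le> B * ((2 * C + 1) * (1 - \<rho>) powr (1 - \<alpha>))"
      using B z by (intro mult_mono) auto
    also have "\<dots> \<le> \<epsilon>" using \<rho>0(2) \<rho>(1) by (simp add: mult.assoc)
    finally show ?thesis by simp
  qed
  then show "\<exists>s<1. \<exists>\<rho>\<^sub>0<1. \<forall>\<rho>\<in>{\<rho>\<^sub>0<..<1}. \<forall>f\<in>zygmund_unit_ball \<alpha>. \<forall>z\<in>unit_disc.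
        0 \<le> \<rho> \<longrightarrow> s < cmod (\<phi> z) \<longrightarrow> weight \<beta> z * cmod (first_symbol \<phi> g z) *
          cmod (deriv f (\<phi> z) - of_real \<rho> * deriv f (of_real \<rho> * \<phi> z)) \<le> 0 + \<epsilon>"
    using \<rho>0(1) by (intro exI[of _ 0] conjI exI[of _ \<rho>\<^sub>0]) auto
qed

text \<open>If instead only a growth bound \<open>\<Lambda>\<close> is available, no smallness can be expected: \<open>f\<close> and its dilation are
  estimated separately by the increasing function \<open>\<Lambda>\<close>, which explains the factor 2, and the symbol times
  \<open>\<Lambda>(|\<phi> z|)\<close> is controlled near the circle. The constant \<open>C'\<close> is there for the logarithmic bounds, which
  vanish at the origin.\<close>

lemma tail_estimate:
  fixes F :: "(complex \<Rightarrow> complex) \<Rightarrow> complex \<Rightarrow> complex" and \<sigma> :: "complex \<Rightarrow> complex" and \<Lambda> :: "real \<Rightarrow> real"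
  assumes \<phi>: "\<phi> ` unit_disc \<subseteq> unit_disc"
    and s: "s < 1" "\<And>z. z \<in> unit_disc \<Longrightarrow> s < cmod (\<phi> z) \<Longrightarrow> weight \<beta> z * cmod (\<sigma> z) * \<Lambda> (cmod (\<phi> z)) \<le> B"
    and growth: "\<And>f z. f \<in> zygmund_unit_ball \<alpha> \<Longrightarrow> z \<in> unit_disc \<Longrightarrow> cmod (F f z) \<le> C * \<Lambda> (cmod z) + C'"
    and dom: "\<And>z. z \<in> unit_disc \<Longrightarrow> s < cmod (\<phi> z) \<Longrightarrow> C' \<le> C' * \<Lambda> (cmod (\<phi> z))"
    and mono: "\<And>r r'. 0 \<le> r \<Longrightarrow> r \<le> r' \<Longrightarrow> r' < 1 \<Longrightarrow> \<Lambda> r \<le> \<Lambda> r'"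
    and C: "C \<ge> 0" "C' \<ge> 0" and t: "\<And>\<rho>. 0 \<le> \<rho> \<Longrightarrow> \<rho> \<le> 1 \<Longrightarrow> cmod (t \<rho>) \<le> 1"
  shows "dilation_defect_le \<alpha> \<beta> \<phi> \<sigma> F t (2 * (C + C') * B)"
  unfolding dilation_defect_le_def
proof (intro allI impI)
  fix \<epsilon> :: real assume \<epsilon>: "\<epsilon> > 0"
  have "weight \<beta> z * cmod (\<sigma> z) * cmod (F f (\<phi> z) - t \<rho> * F f (of_real \<rho> * \<phi> z)) \<le> 2 * (C + C') * B + \<epsilon>"
    if \<rho>: "\<rho> \<in> {0<..<1}" and f: "f \<in> zygmund_unit_ball \<alpha>" and z: "z \<in> unit_disc" "s < cmod (\<phi> z)"
    for \<rho> f z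
  proof -
    have \<phi>z: "\<phi> z \<in> unit_disc" using \<phi> z(1) by blast
    have \<rho>1: "0 \<le> \<rho>" "\<rho> \<le> 1" using \<rho> by auto
    note \<rho>z = scaled_in_disc[OF \<phi>z \<rho>1]
    let ?l = "\<Lambda> (cmod (\<phi> z))"
    have "\<Lambda> (cmod (of_real \<rho> * \<phi> z)) \<le> ?l" using \<rho>z \<phi>z by (intro mono) auto
    then have "C * \<Lambda> (cmod (of_real \<rho> * \<phi> z)) + C' \<le> C * ?l + C' * ?l"
      using C dom[OF z] by (intro add_mono mult_left_mono) auto
    then have "cmod (F f (of_real \<rho> * \<phi> z)) \<le> (C + C') * ?l"
      using growth[OF f \<rho>z(1)] by (simp add: algebra_simps)
    moreover have "cmod (t \<rho> * F f (of_real \<rho> * \<phi> z)) \<le> cmod (F f (of_real \<rho> * \<phi> z))"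
      using t[OF \<rho>1] by (simp add: norm_mult mult_left_le_one_le)
    moreover have "cmod (F f (\<phi> z)) \<le> (C + C') * ?l"
      using growth[OF f \<phi>z] dom[OF z] by (simp add: algebra_simps)
    ultimately have "cmod (F f (\<phi> z) - t \<rho> * F f (of_real \<rho> * \<phi> z)) \<le> 2 * (C + C') * ?l"
      using norm_triangle_ineq4[of "F f (\<phi> z)" "t \<rho> * F f (of_real \<rho> * \<phi> z)"] by linarith
    then have "weight \<beta> z * cmod (\<sigma> z) * cmod (F f (\<phi> z) - t \<rho> * F f (of_real \<rho> * \<phi> z))
        \<le> weight \<beta> z * cmod (\<sigma> z) * (2 * (C + C') * ?l)"
      using weight_pos[OF z(1), of \<beta>] by (intro mult_left_mono) auto
    also have "\<dots> = 2 * (C + C') * (weight \<beta> z * cmod (\<sigma> z) * ?l)" by simp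
    also have "\<dots> \<le> 2 * (C + C') * B" using C by (intro mult_left_mono s(2) z) auto
    finally show ?thesis using \<epsilon> by simp
  qed
  then show "\<exists>s<1. \<exists>\<rho>\<^sub>0<1. \<forall>\<rho>\<in>{\<rho>\<^sub>0<..<1}. \<forall>f\<in>zygmund_unit_ball \<alpha>. \<forall>z\<in>unit_disc.
        0 \<le> \<rho> \<longrightarrow> s < cmod (\<phi> z) \<longrightarrow> weight \<beta> z * cmod (\<sigma> z) *
          cmod (F f (\<phi> z) - t \<rho> * F f (of_real \<rho> * \<phi> z)) \<le> 2 * (C + C') * B + \<epsilon>"
    using s(1) by (intro exI[of _ s] conjI exI[of _ 0]) auto
qed

lemma derivative_defect_power:
  assumes \<phi>: "\<phi> ` unit_disc \<subseteq> unit_disc" and \<alpha>: "1 < \<alpha>"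
    and b: "eventual_bound (\<lambda>n. real (n + 1) powr (\<alpha> - 1)) \<beta> \<phi> \<sigma> B"
  shows "dilation_defect_le \<alpha> \<beta> \<phi> \<sigma> deriv of_real (2 * (1 + 1 / (\<alpha> - 1) + 0) * (6 * B))"
proof -
  have \<alpha>1: "\<alpha> - 1 \<ge> 0" and \<alpha>0: "\<alpha> > 0" using \<alpha> by auto
  obtain s where s: "s < 1" "\<forall>z\<in>unit_disc. s < cmod (\<phi> z) \<longrightarrow>
      weight \<beta> z * cmod (\<sigma> z) * (1 - cmod (\<phi> z)) powr - (\<alpha> - 1) \<le> 6 * B"
    using symbol_bound_power[OF b \<alpha>1 \<phi>] by blast
  show ?thesis
  proof (rule tail_estimate[where \<Lambda> = "\<lambda>r. (1 - r) powr - (\<alpha> - 1)", OF \<phi> s(1)])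
    show "cmod (deriv f z) \<le> (1 + 1 / (\<alpha> - 1)) * (1 - cmod z) powr - (\<alpha> - 1) + 0"
      if "f \<in> zygmund_unit_ball \<alpha>" "z \<in> unit_disc" for f z
      using unit_ball_crude(2)[OF that(1) \<alpha>0 order_refl \<alpha> that(2)] by simp
    show "(1 - r) powr - (\<alpha> - 1) \<le> (1 - r') powr - (\<alpha> - 1)" if "0 \<le> r" "r \<le> r'" "r' < 1" for r r'
      using that \<alpha> by (intro powr_mono2') auto
  qed (use s(2) \<alpha> in auto)
qed

lemma value_defect_power:
  assumes \<phi>: "\<phi> ` unit_disc \<subseteq> unit_disc" and \<alpha>: "2 < \<alpha>"
    and b: "eventual_bound (\<lambda>n. real (n + 1) powr (\<alpha> - 2)) \<beta> \<phi> \<sigma> B"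
  shows "dilation_defect_le \<alpha> \<beta> \<phi> \<sigma> (\<lambda>f. f) (\<lambda>_. 1)
     (2 * (1 + (1 + 1 / (\<alpha> - 1)) / (\<alpha> - 2) + 0) * (6 * B))"
proof -
  have \<alpha>2: "\<alpha> - 2 \<ge> 0" and \<alpha>0: "\<alpha> > 0" and \<alpha>1: "\<alpha> > 1" using \<alpha> by auto
  obtain s where s: "s < 1" "\<forall>z\<in>unit_disc. s < cmod (\<phi> z) \<longrightarrow>
      weight \<beta> z * cmod (\<sigma> z) * (1 - cmod (\<phi> z)) powr - (\<alpha> - 2) \<le> 6 * B"
    using symbol_bound_power[OF b \<alpha>2 \<phi>] by blast
  show ?thesis
  proof (rule tail_estimate[where \<Lambda> = "\<lambda>r. (1 - r) powr - (\<alpha> - 2)", OF \<phi> s(1)])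
    show "cmod (f z) \<le> (1 + (1 + 1 / (\<alpha> - 1)) / (\<alpha> - 2)) * (1 - cmod z) powr - (\<alpha> - 2) + 0"
      if f: "f \<in> zygmund_unit_ball \<alpha>" and z: "z \<in> unit_disc" for f z
      using growth_supercritical[OF unit_ballD(6)[OF f \<alpha>0] unit_ball_crude(2)[OF f \<alpha>0 order_refl \<alpha>1]
          unit_ballD(3)[OF f \<alpha>0] _ _ z] \<alpha> by simp
    show "(1 - r) powr - (\<alpha> - 2) \<le> (1 - r') powr - (\<alpha> - 2)" if "0 \<le> r" "r \<le> r'" "r' < 1" for r r'
      using that \<alpha> by (intro powr_mono2') auto
  qed (use s(2) \<alpha> in auto)
qed

lemma ln_inverse_gap_mono:
  fixes r r' :: real
  assumes "r \<le> r'" "r' < 1"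
  shows "ln (1 / (1 - r)) \<le> ln (1 / (1 - r'))"
  using assms by (intro ln_mono divide_left_mono mult_pos_pos) auto

lemma derivative_defect_log:
  assumes \<phi>: "\<phi> ` unit_disc \<subseteq> unit_disc"
    and b: "eventual_bound (\<lambda>n. ln (real n)) \<beta> \<phi> \<sigma> B"
  shows "dilation_defect_le 1 \<beta> \<phi> \<sigma> deriv of_real (2 * (1 + 1) * (12 * B))"
proof -
  obtain s where s: "s < 1" "\<forall>z\<in>unit_disc. s < cmod (\<phi> z) \<longrightarrow> 1 \<le> ln (1 / (1 - cmod (\<phi> z))) \<and>
      weight \<beta> z * cmod (\<sigma> z) * ln (1 / (1 - cmod (\<phi> z))) \<le> 12 * B"
    using symbol_bound_log[OF b \<phi>] by blast
  show ?thesis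
  proof (rule tail_estimate[where \<Lambda> = "\<lambda>r. ln (1 / (1 - r))", OF \<phi> s(1)])
    show "cmod (deriv f z) \<le> 1 * ln (1 / (1 - cmod z)) + 1"
      if f: "f \<in> zygmund_unit_ball 1" and z: "z \<in> unit_disc" for f z
      using growth_critical[OF unit_ballD(7)[OF f] unit_ballD(5)[OF f] unit_ballD(4)[OF f] _ z] by simp
  qed (use s(2) ln_inverse_gap_mono in auto)
qed

lemma value_defect_log:
  assumes \<phi>: "\<phi> ` unit_disc \<subseteq> unit_disc"
    and b: "eventual_bound (\<lambda>n. ln (real n)) \<beta> \<phi> \<sigma> B"
  shows "dilation_defect_le 2 \<beta> \<phi> \<sigma> (\<lambda>f. f) (\<lambda>_. 1) (2 * (2 + 1) * (12 * B))"
proof -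
  obtain s where s: "s < 1" "\<forall>z\<in>unit_disc. s < cmod (\<phi> z) \<longrightarrow> 1 \<le> ln (1 / (1 - cmod (\<phi> z))) \<and>
      weight \<beta> z * cmod (\<sigma> z) * ln (1 / (1 - cmod (\<phi> z))) \<le> 12 * B"
    using symbol_bound_log[OF b \<phi>] by blast
  show ?thesis
  proof (rule tail_estimate[where \<Lambda> = "\<lambda>r. ln (1 / (1 - r))", OF \<phi> s(1)])
    show "cmod (f z) \<le> 2 * ln (1 / (1 - cmod z)) + 1"
      if f: "f \<in> zygmund_unit_ball 2" and z: "z \<in> unit_disc" for f z
    proof -
      have "cmod (deriv f w) \<le> 2 * (1 - cmod w) powr - 1" if "w \<in> unit_disc" for w
        using unit_ball_crude(2)[OF f _ _ _ that, of 2] by simp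
      from growth_critical[OF unit_ballD(6)[OF f] this unit_ballD(3)[OF f] _ z] show ?thesis by simp
    qed
  qed (use s(2) ln_inverse_gap_mono in auto)
qed

section \<open>Monomials as test functions\<close>

lemma powr_le_exp:
  fixes x \<alpha> :: real
  assumes "0 \<le> x" "0 < \<alpha>"
  shows "x powr \<alpha> \<le> \<alpha> powr \<alpha> * exp x"
proof -
  have "x / \<alpha> \<le> exp (x / \<alpha>)" using exp_ge_add_one_self[of "x / \<alpha>"] by linarith
  then have "x \<le> \<alpha> * exp (x / \<alpha>)" using assms by (simp add: field_simps)
  then have "x powr \<alpha> \<le> (\<alpha> * exp (x / \<alpha>)) powr \<alpha>" using assms by (intro powr_mono2) auto
  also have "\<dots> = \<alpha> powr \<alpha> * exp x" using assms by (simp add: powr_mult exp_powr_real)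
  finally show ?thesis .
qed

text \<open>With \<open>x = n (1 - r)\<close> the left-hand side is of the order of \<open>x powr \<alpha> * exp (- x)\<close>.\<close>

lemma monomial_weight_bound:
  fixes \<alpha> r :: real
  assumes "0 < \<alpha>" "0 \<le> r" "r < 1" "n \<ge> 2"
  shows "(1 - r\<^sup>2) powr \<alpha> * (real n powr (\<alpha> - 2) * real n * real (n - 1) * r ^ (n - 2))
    \<le> 2 powr \<alpha> * \<alpha> powr \<alpha> * exp 2"
proof -
  define x where "x = (1 - r) * real n"
  have x: "0 \<le> x" using assms by (simp add: x_def)
  have "(1 - r\<^sup>2) = (1 + r) * (1 - r)" by (simp add: power2_eq_square algebra_simps)
  then have "1 - r\<^sup>2 \<le> 2 * (1 - r)" "0 \<le> 1 - r\<^sup>2" using assms mult_right_mono[of "1 + r" 2 "1 - r"] by auto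
  then have "(1 - r\<^sup>2) powr \<alpha> \<le> (2 * (1 - r)) powr \<alpha>" using assms by (intro powr_mono2) auto
  then have 1: "(1 - r\<^sup>2) powr \<alpha> \<le> 2 powr \<alpha> * (1 - r) powr \<alpha>"
    unfolding powr_mult[of 2 "1 - r" \<alpha>] .
  have "real n powr (\<alpha> - 2) * real n * real (n - 1) \<le> real n powr (\<alpha> - 2) * (real n * real n)"
    using assms by (simp add: mult.assoc mult_left_mono)
  also have "\<dots> = real n powr \<alpha>" using assms by (simp add: powr_diff powr_numeral power2_eq_square)
  finally have 2: "real n powr (\<alpha> - 2) * real n * real (n - 1) \<le> real n powr \<alpha>" .
  have "r \<le> exp (- (1 - r))" using exp_ge_add_one_self[of "- (1 - r)"] by simp
  then have "r ^ (n - 2) \<le> exp (- (1 - r)) ^ (n - 2)" using assms by (intro power_mono) auto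
  also have "\<dots> = exp (real (n - 2) * - (1 - r))" by (rule exp_of_nat_mult[symmetric])
  also have "\<dots> \<le> exp (2 - x)"
    using assms by (simp add: x_def of_nat_diff algebra_simps)
  finally have 3: "r ^ (n - 2) \<le> exp (2 - x)" .
  have "(1 - r\<^sup>2) powr \<alpha> * (real n powr (\<alpha> - 2) * real n * real (n - 1) * r ^ (n - 2))
      \<le> (2 powr \<alpha> * (1 - r) powr \<alpha>) * (real n powr \<alpha> * exp (2 - x))"
    using 1 2 3 assms by (intro mult_mono) auto
  also have "\<dots> = 2 powr \<alpha> * x powr \<alpha> * exp (2 - x)"
    using assms by (simp add: x_def powr_mult)
  also have "\<dots> \<le> 2 powr \<alpha> * (\<alpha> powr \<alpha> * exp x) * exp (2 - x)"
    using powr_le_exp[OF x assms(1)] by (intro mult_right_mono mult_left_mono) auto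
  also have "\<dots> = 2 powr \<alpha> * \<alpha> powr \<alpha> * exp 2" by (simp add: exp_diff)
  finally show ?thesis .
qed

definition monomial_constant :: "real \<Rightarrow> real" where
  "monomial_constant \<alpha> = 2 * (2 powr \<alpha> * \<alpha> powr \<alpha> * exp 2)"

lemma monomial_lower:
  assumes adm: "admissible \<alpha> \<beta> \<phi> g" and \<alpha>: "\<alpha> > 0" and M: "M > 0"
    and ess: "essential_norm \<alpha> \<beta> (comp_volterra \<phi> g) < ereal M"
  shows "\<forall>\<^sub>F n in sequentially. \<forall>z\<in>unit_disc. real n powr (\<alpha> - 2) * (weight \<beta> z *
        cmod (first_symbol \<phi> g z * cnj (sgn (\<phi> z)) * of_real (real n * cmod (\<phi> z) ^ (n - 1))
          + second_symbol \<phi> g z * of_real (cmod (\<phi> z) ^ n))) \<le> monomial_constant \<alpha> * M"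
proof -
  define C where "C = 2 powr \<alpha> * \<alpha> powr \<alpha> * exp 2"
  have mc: "monomial_constant \<alpha> = 2 * C" by (simp add: monomial_constant_def C_def)
  have C: "C > 0" using \<alpha> by (simp add: C_def)
  define b where "b n k = real n powr (\<alpha> - 2) / C" for n k :: nat
  define A where "A n = (if n < 2 then {} else {n})" for n :: nat
  have "(1 - r\<^sup>2) powr \<alpha> * (\<Sum>k\<in>A n. b n k * real k * real (k - 1) * r ^ (k - 2)) \<le> 1"
    if "0 \<le> r" "r < 1" for n r
  proof (cases "n < 2")
    case False
    have "(1 - r\<^sup>2) powr \<alpha> * (\<Sum>k\<in>A n. b n k * real k * real (k - 1) * r ^ (k - 2))
        = (1 - r\<^sup>2) powr \<alpha> * (real n powr (\<alpha> - 2) * real n * real (n - 1) * r ^ (n - 2)) / C"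
      using False by (simp add: A_def b_def)
    then show ?thesis
      using monomial_weight_bound[OF \<alpha> that, of n] False C
      by (simp add: divide_le_eq_1 flip: C_def)
  qed (simp add: A_def)
  note bnd = this
  have b: "b n k \<ge> 0" and A: "finite (A n)" "k \<in> A n \<Longrightarrow> k \<ge> 2 \<and> k \<ge> n" for n k
    using C by (auto simp: b_def A_def split: if_splits)
  have "\<forall>\<^sub>F n in sequentially. \<forall>z\<in>unit_disc.
      weight \<beta> z * cmod (first_symbol \<phi> g z * cnj (sgn (\<phi> z)) * of_real (\<Sum>k\<in>A n. b n k * real k * cmod (\<phi> z) ^ (k - 1))
        + second_symbol \<phi> g z * of_real (\<Sum>k\<in>A n. b n k * cmod (\<phi> z) ^ k)) \<le> 2 * M"
    by (rule essential_norm_lower[OF adm \<alpha> M ess b A bnd])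
  then show ?thesis
    using eventually_ge_at_top[of 2]
  proof eventually_elim
    case (elim n)
    show ?case
    proof
      fix z assume z: "z \<in> unit_disc"
      let ?a = "real n powr (\<alpha> - 2) / C"
      let ?X = "first_symbol \<phi> g z * cnj (sgn (\<phi> z)) * of_real (real n * cmod (\<phi> z) ^ (n - 1))
          + second_symbol \<phi> g z * of_real (cmod (\<phi> z) ^ n)"
      have eq1: "first_symbol \<phi> g z * cnj (sgn (\<phi> z)) * of_real (\<Sum>k\<in>A n. b n k * real k * cmod (\<phi> z) ^ (k - 1))
        + second_symbol \<phi> g z * of_real (\<Sum>k\<in>A n. b n k * cmod (\<phi> z) ^ k) = of_real ?a * ?X"
        using elim(2) by (simp add: A_def b_def algebra_simps)
      have eq2: "cmod (of_real ?a * ?X) = ?a * cmod ?X"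
        unfolding norm_mult[of "of_real ?a"] norm_of_real using C by simp
      have "weight \<beta> z * (?a * cmod ?X) \<le> 2 * M"
        using elim(1)[rule_format, OF z] unfolding eq1 eq2 .
      then show "real n powr (\<alpha> - 2) * (weight \<beta> z * cmod ?X) \<le> monomial_constant \<alpha> * M"
        using C unfolding mc by (simp add: field_simps)
    qed
  qed
qed

lemma norm_cnj_sgn_times_power:
  assumes "n \<ge> 1"
  shows "cmod (cnj (sgn w)) * cmod w ^ n = cmod w ^ n"
  using assms by (cases "w = 0") (auto simp: norm_sgn)

text \<open>Below the exponent 2 the second symbol is multiplied by \<open>n powr (\<alpha> - 2) \<longlonglongrightarrow> 0\<close>.\<close>

lemma first_symbol_lower_intermediate:
  assumes adm: "admissible \<alpha> \<beta> \<phi> g" and \<alpha>: "1 < \<alpha>" "\<alpha> < 2" and M: "M > 0"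
    and ess: "essential_norm \<alpha> \<beta> (comp_volterra \<phi> g) < ereal M"
  shows "eventual_bound (\<lambda>n. real (n + 1) powr (\<alpha> - 1)) \<beta> \<phi> (first_symbol \<phi> g)
    ((monomial_constant \<alpha> + 1) * M)"
proof -
  have \<alpha>0: "\<alpha> > 0" using \<alpha> by simp
  define C where "C = monomial_constant \<alpha>"
  obtain B where B: "B > 0" "\<And>z. z \<in> unit_disc \<Longrightarrow> weight \<beta> z * cmod (second_symbol \<phi> g z) \<le> B"
    using symbols_bounded[OF adm] by metis
  have "((\<lambda>n. real n powr (\<alpha> - 2) * B) \<longlongrightarrow> 0 * B) sequentially"
    using \<alpha> by (intro tendsto_intros tendsto_neg_powr filterlim_real_sequentially) auto
  then have "\<forall>\<^sub>F n in sequentially. real n powr (\<alpha> - 2) * B < M"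
    using M by (intro order_tendstoD(2)) auto
  from eventually_sequentially_Suc[THEN iffD2, OF eventually_conj[OF monomial_lower[OF adm \<alpha>0 M ess, folded C_def] this]]
    eventually_ge_at_top[of 1]
  show ?thesis
    unfolding eventual_bound_def C_def[symmetric]
  proof eventually_elim
    case (elim n)
    show ?case
    proof
      fix z assume z: "z \<in> unit_disc"
      define u where "u = first_symbol \<phi> g z * cnj (sgn (\<phi> z)) * of_real (real (Suc n) * cmod (\<phi> z) ^ n)"
      define v where "v = second_symbol \<phi> g z * of_real (cmod (\<phi> z) ^ Suc n)"
      define a where "a = real (Suc n) powr (\<alpha> - 2)"
      have a: "a \<ge> 0" by (simp add: a_def)
      have w: "weight \<beta> z \<ge> 0" using weight_pos[OF z] by (simp add: less_imp_le)
      have r: "cmod (\<phi> z) \<le> 1" using adm z by (force simp: admissible_def less_imp_le)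
      have uv: "a * (weight \<beta> z * cmod (u + v)) \<le> C * M"
        using elim(1) z by (simp add: u_def v_def a_def)
      have "cmod v \<le> cmod (second_symbol \<phi> g z)"
        using mult_left_le[of "cmod (\<phi> z) ^ Suc n" "cmod (second_symbol \<phi> g z)"]
          power_le_one[OF norm_ge_zero r, of "Suc n"]
        unfolding v_def norm_mult norm_of_real by simp
      then have "weight \<beta> z * cmod v \<le> B"
        using B(2)[OF z] w by (meson mult_left_mono order_trans)
      then have "a * (weight \<beta> z * cmod v) \<le> a * B" using a by (intro mult_left_mono)
      also have "\<dots> \<le> M" using elim(1) by (simp add: a_def)
      finally have v: "a * (weight \<beta> z * cmod v) \<le> M" .
      have "cmod u \<le> cmod (u + v) + cmod v" using norm_triangle_ineq4[of "u + v" v] by simp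
      then have "a * (weight \<beta> z * cmod u) \<le> a * (weight \<beta> z * (cmod (u + v) + cmod v))"
        using a w by (intro mult_left_mono)
      then have main: "a * (weight \<beta> z * cmod u) \<le> (C + 1) * M" using uv v by (simp add: algebra_simps)
      have cu: "cmod u = cmod (first_symbol \<phi> g z) * (real (Suc n) * cmod (\<phi> z) ^ n)"
        using norm_cnj_sgn_times_power[OF elim(2), of "\<phi> z"] unfolding u_def norm_mult norm_of_real
        by (auto simp: norm_power mult_ac)
      have an: "a * real (Suc n) = real (n + 1) powr (\<alpha> - 1)"
        using powr_add[of "real (Suc n)" "\<alpha> - 2" 1] by (simp add: a_def add.commute)
      have E: "a * (weight \<beta> z * cmod u) = (a * real (Suc n)) * (weight \<beta> z * cmod (first_symbol \<phi> g z) * cmod (\<phi> z) ^ n)"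
        unfolding cu by (simp only: mult_ac)
      show "real (n + 1) powr (\<alpha> - 1) * (weight \<beta> z * cmod (first_symbol \<phi> g z) * cmod (\<phi> z) ^ n) \<le> (C + 1) * M"
        using main unfolding E an .
    qed
  qed
qed

definition first_constant :: "real \<Rightarrow> real" where
  "first_constant \<alpha> = 3 powr (\<alpha> - 1) * (2 * monomial_constant \<alpha>)"

definition second_constant :: "real \<Rightarrow> real" where
  "second_constant \<alpha> = 2 powr (\<alpha> - 2) * (monomial_constant \<alpha> + first_constant \<alpha>)"

lemma lower_constants_pos:
  assumes "\<alpha> > 0"
  shows "monomial_constant \<alpha> > 0" "first_constant \<alpha> > 0" "second_constant \<alpha> > 0"
proof -
  show 1: "monomial_constant \<alpha> > 0" using assms by (simp add: monomial_constant_def)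
  then show 2: "first_constant \<alpha> > 0" by (simp add: first_constant_def)
  with 1 show "second_constant \<alpha> > 0" by (simp add: second_constant_def add_pos_pos)
qed

text \<open>From the exponent 2 on the two symbols are separated by comparing the exponents \<open>n\<close> and \<open>2 n\<close>: after
  multiplying the first estimate by \<open>|\<phi> z| ^ n\<close> the second symbol has the same factor in both, and the
  difference contains only the first.\<close>

lemma first_symbol_lower_large:
  assumes adm: "admissible \<alpha> \<beta> \<phi> g" and \<alpha>: "2 \<le> \<alpha>" and M: "M > 0"
    and ess: "essential_norm \<alpha> \<beta> (comp_volterra \<phi> g) < ereal M"
  shows "eventual_bound (\<lambda>n. real (n + 1) powr (\<alpha> - 1)) \<beta> \<phi> (first_symbol \<phi> g) (first_constant \<alpha> * M)"
proof -
  have \<alpha>0: "\<alpha> > 0" using \<alpha> by simp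
  define C where "C = monomial_constant \<alpha>"
  define C\<^sub>1 where "C\<^sub>1 = first_constant \<alpha>"
  have C\<^sub>1: "C\<^sub>1 = 3 powr (\<alpha> - 1) * (2 * C)" by (simp add: C_def C\<^sub>1_def first_constant_def)
  obtain N where N: "\<And>n z. n \<ge> N \<Longrightarrow> z \<in> unit_disc \<Longrightarrow> real n powr (\<alpha> - 2) * (weight \<beta> z *
      cmod (first_symbol \<phi> g z * cnj (sgn (\<phi> z)) * of_real (real n * cmod (\<phi> z) ^ (n - 1))
        + second_symbol \<phi> g z * of_real (cmod (\<phi> z) ^ n))) \<le> C * M"
    unfolding C_def using monomial_lower[OF adm \<alpha>0 M ess] unfolding eventually_sequentially by blast
  have "real (m + 1) powr (\<alpha> - 1) * (weight \<beta> z * cmod (first_symbol \<phi> g z) * cmod (\<phi> z) ^ m) \<le> C\<^sub>1 * M"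
    if m: "m \<ge> 2 * N + 3" and z: "z \<in> unit_disc" for m z
  proof -
    \<comment> \<open>the estimate is obtained for the exponent \<open>2 n - 1 \<le> m\<close>, and \<open>m + 1 \<le> 3 n\<close>\<close>
    define n where "n = (m + 1) div 2"
    have n: "n \<ge> N" "n \<ge> 2" "2 * n - 1 \<le> m" "m + 1 \<le> 3 * n" using m by (auto simp: n_def)
    define r where "r = cmod (\<phi> z)"
    have r: "0 \<le> r" "r \<le> 1" using adm z by (force simp: admissible_def less_imp_le r_def)+
    have w: "weight \<beta> z \<ge> 0" using weight_pos[OF z] by (simp add: less_imp_le)
    define a where "a = real n powr (\<alpha> - 2)"
    have a: "a \<ge> 0" by (simp add: a_def)
    define u where "u = first_symbol \<phi> g z * cnj (sgn (\<phi> z)) * of_real (real n * r ^ (2 * n - 1))"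
    define v where "v = second_symbol \<phi> g z * of_real (r ^ (2 * n))"
    let ?X = "first_symbol \<phi> g z * cnj (sgn (\<phi> z)) * of_real (real n * r ^ (n - 1))
        + second_symbol \<phi> g z * of_real (r ^ n)"
    have 1: "a * (weight \<beta> z * cmod (u + v)) \<le> C * M"
    proof -
      have "r ^ (2 * n - 1) = r ^ (n - 1) * r ^ n" "r ^ (2 * n) = r ^ n * r ^ n"
        using n(2) by (simp_all add: mult_2 flip: power_add)
      then have "u + v = ?X * of_real (r ^ n)" by (simp add: u_def v_def algebra_simps)
      moreover have "cmod (?X * of_real (r ^ n)) \<le> cmod ?X"
        unfolding norm_mult norm_of_real using r by (intro mult_left_le) (auto simp: power_le_one)
      ultimately have "cmod (u + v) \<le> cmod ?X" by simp
      then have "a * (weight \<beta> z * cmod (u + v)) \<le> a * (weight \<beta> z * cmod ?X)"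
        using a w by (intro mult_left_mono)
      then show ?thesis using N[OF n(1) z] by (simp add: a_def r_def)
    qed
    have 2: "a * (weight \<beta> z * cmod (2 * u + v)) \<le> C * M"
    proof -
      have "a \<le> real (2 * n) powr (\<alpha> - 2)" unfolding a_def using \<alpha> by (intro powr_mono2) auto
      then have "a * (weight \<beta> z * cmod (2 * u + v)) \<le> real (2 * n) powr (\<alpha> - 2) * (weight \<beta> z * cmod (2 * u + v))"
        using w by (intro mult_right_mono) auto
      moreover have "2 * u + v = first_symbol \<phi> g z * cnj (sgn (\<phi> z)) * of_real (real (2 * n) * r ^ (2 * n - 1))
        + second_symbol \<phi> g z * of_real (r ^ (2 * n))" by (simp add: u_def v_def)
      ultimately show ?thesis using N[of "2 * n" z] n(1) z by (simp add: r_def)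
    qed
    have "cmod u \<le> cmod (2 * u + v) + cmod (u + v)"
      using norm_triangle_ineq4[of "2 * u + v" "u + v"] by simp
    then have "a * (weight \<beta> z * cmod u) \<le> a * (weight \<beta> z * (cmod (2 * u + v) + cmod (u + v)))"
      using a w by (intro mult_left_mono)
    then have 3: "a * (weight \<beta> z * cmod u) \<le> 2 * C * M" using 1 2 by (simp add: algebra_simps)
    have cu: "cmod u = cmod (first_symbol \<phi> g z) * (real n * r ^ (2 * n - 1))"
      using norm_cnj_sgn_times_power[of "2 * n - 1" "\<phi> z"] n(2) r unfolding u_def norm_mult norm_of_real
      by (auto simp: r_def mult_ac)
    have an: "a * real n = real n powr (\<alpha> - 1)"
      using powr_add[of "real n" "\<alpha> - 2" 1] n(2) by (simp add: a_def)
    have E: "a * (weight \<beta> z * cmod u) = (a * real n) * (weight \<beta> z * cmod (first_symbol \<phi> g z) * r ^ (2 * n - 1))"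
      unfolding cu by (simp only: mult_ac)
    have 4: "real n powr (\<alpha> - 1) * (weight \<beta> z * cmod (first_symbol \<phi> g z) * r ^ (2 * n - 1)) \<le> 2 * C * M"
      using 3 unfolding E an .
    have "real (m + 1) \<le> 3 * real n" using n(4) by linarith
    then have "real (m + 1) powr (\<alpha> - 1) \<le> (3 * real n) powr (\<alpha> - 1)" using \<alpha> by (intro powr_mono2) auto
    then have "real (m + 1) powr (\<alpha> - 1) \<le> 3 powr (\<alpha> - 1) * real n powr (\<alpha> - 1)" by (simp add: powr_mult)
    then have "real (m + 1) powr (\<alpha> - 1) * (weight \<beta> z * cmod (first_symbol \<phi> g z) * r ^ m)
        \<le> (3 powr (\<alpha> - 1) * real n powr (\<alpha> - 1)) * (weight \<beta> z * cmod (first_symbol \<phi> g z) * r ^ (2 * n - 1))"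
      using w r n(3) by (intro mult_mono power_decreasing) auto
    also have "\<dots> \<le> 3 powr (\<alpha> - 1) * (2 * C * M)"
      unfolding mult.assoc[of "3 powr (\<alpha> - 1)"] using 4 by (intro mult_left_mono) auto
    finally show ?thesis by (simp add: r_def C\<^sub>1 mult_ac)
  qed
  then show ?thesis unfolding eventual_bound_def eventually_sequentially C\<^sub>1_def[symmetric] by blast
qed

text \<open>Once the first symbol is controlled it can be subtracted from the estimate for the monomial.\<close>

lemma second_symbol_lower_large:
  assumes adm: "admissible \<alpha> \<beta> \<phi> g" and \<alpha>: "2 \<le> \<alpha>" and M: "M > 0"
    and ess: "essential_norm \<alpha> \<beta> (comp_volterra \<phi> g) < ereal M"
  shows "eventual_bound (\<lambda>n. real (n + 1) powr (\<alpha> - 2)) \<beta> \<phi> (second_symbol \<phi> g) (second_constant \<alpha> * M)"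
proof -
  have \<alpha>0: "\<alpha> > 0" using \<alpha> by simp
  define C where "C = monomial_constant \<alpha>"
  define C\<^sub>1 where "C\<^sub>1 = first_constant \<alpha>"
  have C\<^sub>2: "second_constant \<alpha> = 2 powr (\<alpha> - 2) * (C + C\<^sub>1)"
    by (simp add: C_def C\<^sub>1_def second_constant_def)
  obtain N where N: "\<And>n z. n \<ge> N \<Longrightarrow> z \<in> unit_disc \<Longrightarrow> real n powr (\<alpha> - 2) * (weight \<beta> z *
      cmod (first_symbol \<phi> g z * cnj (sgn (\<phi> z)) * of_real (real n * cmod (\<phi> z) ^ (n - 1))
        + second_symbol \<phi> g z * of_real (cmod (\<phi> z) ^ n))) \<le> C * M"
    unfolding C_def using monomial_lower[OF adm \<alpha>0 M ess] unfolding eventually_sequentially by blast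
  obtain N' where N': "\<And>n z. n \<ge> N' \<Longrightarrow> z \<in> unit_disc \<Longrightarrow>
      real (n + 1) powr (\<alpha> - 1) * (weight \<beta> z * cmod (first_symbol \<phi> g z) * cmod (\<phi> z) ^ n) \<le> C\<^sub>1 * M"
    using first_symbol_lower_large[OF adm \<alpha> M ess, folded C\<^sub>1_def] unfolding eventual_bound_def eventually_sequentially by blast
  have "real (n + 1) powr (\<alpha> - 2) * (weight \<beta> z * cmod (second_symbol \<phi> g z) * cmod (\<phi> z) ^ n) \<le> second_constant \<alpha> * M"
    if n: "n \<ge> N + N' + 1" and z: "z \<in> unit_disc" for n z
  proof -
    have w: "weight \<beta> z \<ge> 0" using weight_pos[OF z] by (simp add: less_imp_le)
    define a where "a = real n powr (\<alpha> - 2)"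
    have a: "a \<ge> 0" by (simp add: a_def)
    define u where "u = first_symbol \<phi> g z * cnj (sgn (\<phi> z)) * of_real (real n * cmod (\<phi> z) ^ (n - 1))"
    define v where "v = second_symbol \<phi> g z * of_real (cmod (\<phi> z) ^ n)"
    have 1: "a * (weight \<beta> z * cmod (u + v)) \<le> C * M" using N[of n z] n z by (simp add: a_def u_def v_def)
    have "cmod (cnj (sgn (\<phi> z))) \<le> 1" by (simp add: norm_sgn)
    then have "cmod (first_symbol \<phi> g z) * cmod (cnj (sgn (\<phi> z))) * (real n * cmod (\<phi> z) ^ (n - 1))
        \<le> cmod (first_symbol \<phi> g z) * 1 * (real n * cmod (\<phi> z) ^ (n - 1))"
      by (intro mult_right_mono mult_left_mono) auto
    then have "cmod u \<le> cmod (first_symbol \<phi> g z) * (real n * cmod (\<phi> z) ^ (n - 1))"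
      unfolding u_def norm_mult norm_of_real by (simp add: abs_mult)
    then have "a * (weight \<beta> z * cmod u) \<le> a * (weight \<beta> z * (cmod (first_symbol \<phi> g z) * (real n * cmod (\<phi> z) ^ (n - 1))))"
      using a w by (intro mult_left_mono)
    also have "\<dots> = (a * real n) * (weight \<beta> z * cmod (first_symbol \<phi> g z) * cmod (\<phi> z) ^ (n - 1))"
      by (simp add: mult_ac)
    also have "a * real n = real n powr (\<alpha> - 1)"
      using powr_add[of "real n" "\<alpha> - 2" 1] n by (simp add: a_def)
    also have "real n powr (\<alpha> - 1) * (weight \<beta> z * cmod (first_symbol \<phi> g z) * cmod (\<phi> z) ^ (n - 1)) \<le> C\<^sub>1 * M"
      using N'[of "n - 1" z] n z by simp
    finally have 2: "a * (weight \<beta> z * cmod u) \<le> C\<^sub>1 * M" .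
    have "cmod v \<le> cmod (u + v) + cmod u" using norm_triangle_ineq4[of "u + v" u] by simp
    then have "a * (weight \<beta> z * cmod v) \<le> a * (weight \<beta> z * (cmod (u + v) + cmod u))"
      using a w by (intro mult_left_mono)
    then have 3: "a * (weight \<beta> z * cmod v) \<le> (C + C\<^sub>1) * M" using 1 2 by (simp add: algebra_simps)
    have "real (n + 1) powr (\<alpha> - 2) \<le> (2 * real n) powr (\<alpha> - 2)" using \<alpha> n by (intro powr_mono2) auto
    then have "real (n + 1) powr (\<alpha> - 2) \<le> 2 powr (\<alpha> - 2) * a" by (simp add: powr_mult a_def)
    then have "real (n + 1) powr (\<alpha> - 2) * (weight \<beta> z * cmod v) \<le> 2 powr (\<alpha> - 2) * a * (weight \<beta> z * cmod v)"
      using w by (intro mult_right_mono) auto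
    also have "\<dots> \<le> 2 powr (\<alpha> - 2) * ((C + C\<^sub>1) * M)"
      unfolding mult.assoc[of "2 powr (\<alpha> - 2)"] using 3 by (intro mult_left_mono) auto
    finally show ?thesis by (simp add: v_def norm_mult norm_power C\<^sub>2 mult_ac)
  qed
  then show ?thesis unfolding eventual_bound_def eventually_sequentially by blast
qed

section \<open>Harmonic blocks as test functions\<close>

lemma ln_le_harmonic_block:
  assumes "m \<ge> 1"
  shows "ln (real m) \<le> (\<Sum>k\<in>{m..m\<^sup>2}. 1 / real k)"
proof -
  have gap: "ln (real (Suc k)) - ln (real k) \<le> 1 / real k" if "k \<ge> 1" for k
    using ln_diff_le[of "real (Suc k)" "real k"] that by simp
  have block: "ln (real (Suc n)) - ln (real m) \<le> (\<Sum>k\<in>{m..n}. 1 / real k)" if "m \<le> n" for n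
    using that
  proof (induction n rule: dec_induct)
    case base
    show ?case using gap[OF assms] by simp
  next
    case (step n)
    then show ?case using gap[of "Suc n"] by simp
  qed
  have "m \<le> m\<^sup>2" using assms by (simp add: power2_eq_square)
  from block[OF this] have "ln (real (Suc (m\<^sup>2))) - ln (real m) \<le> (\<Sum>k\<in>{m..m\<^sup>2}. 1 / real k)" .
  moreover have "ln (real m ^ 2) \<le> ln (real (Suc (m\<^sup>2)))"
    using assms by (intro ln_mono) auto
  moreover have "ln (real m ^ 2) = 2 * ln (real m)" using assms by (simp add: ln_realpow)
  ultimately show ?thesis by linarith
qed

text \<open>Bounds along the sparse exponents \<open>2 m\<^sup>2\<close> suffice, since the logarithm changes only by a constant
  factor between consecutive ones.\<close>

lemma eventual_bound_ln_from_squares: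
  assumes "\<forall>\<^sub>F m in sequentially. \<forall>z\<in>unit_disc.
      ln (real m) * (weight \<beta> z * cmod (\<sigma> z) * cmod (\<phi> z) ^ (2 * m\<^sup>2)) \<le> B"
    and \<phi>: "\<phi> ` unit_disc \<subseteq> unit_disc"
  shows "eventual_bound (\<lambda>n. ln (real n)) \<beta> \<phi> \<sigma> (5 * B)"
proof -
  obtain N where N: "\<And>m z. m \<ge> N \<Longrightarrow> z \<in> unit_disc \<Longrightarrow>
      ln (real m) * (weight \<beta> z * cmod (\<sigma> z) * cmod (\<phi> z) ^ (2 * m\<^sup>2)) \<le> B"
    using assms(1) unfolding eventually_sequentially by blast
  define N' where "N' = max N 3"
  have "ln (real j) * (weight \<beta> z * cmod (\<sigma> z) * cmod (\<phi> z) ^ j) \<le> 5 * B"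
    if j: "j \<ge> 2 * N'\<^sup>2" and z: "z \<in> unit_disc" for j z
  proof -
    define m where "m = nat \<lfloor>sqrt (real j / 2)\<rfloor>"
    have "real N' \<le> sqrt (real j / 2)"
    proof (rule real_le_rsqrt)
      have "real (2 * N'\<^sup>2) \<le> real j" using j by (simp only: of_nat_le_iff)
      then show "(real N')\<^sup>2 \<le> real j / 2" by simp
    qed
    then have "N' \<le> m" unfolding m_def by (simp add: le_nat_floor)
    then have m: "m \<ge> N" "m \<ge> 3" by (auto simp: N'_def)
    have fl: "real m \<le> sqrt (real j / 2)" "sqrt (real j / 2) < real m + 1"
      unfolding m_def by (auto simp: of_nat_floor)
    have "(real m)\<^sup>2 \<le> (sqrt (real j / 2))\<^sup>2" using fl by (intro power_mono) auto
    then have "real (2 * m\<^sup>2) \<le> real j" by simp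
    then have mj: "2 * m\<^sup>2 \<le> j" by (simp only: of_nat_le_iff)
    have "(sqrt (real j / 2))\<^sup>2 \<le> (real m + 1)\<^sup>2" using fl by (intro power_mono) auto
    then have "real j \<le> 2 * (real m + 1)\<^sup>2" by simp
    also have "\<dots> \<le> 2 * (2 * real m)\<^sup>2" using m by (intro mult_left_mono power_mono) auto
    also have "\<dots> = 8 * (real m)\<^sup>2" by (simp add: power2_eq_square)
    also have "\<dots> \<le> real m ^ 3 * (real m)\<^sup>2"
    proof (rule mult_right_mono)
      have "(3::real) ^ 3 \<le> real m ^ 3" using m by (intro power_mono) auto
      then show "8 \<le> real m ^ 3" by simp
    qed simp
    also have "\<dots> = real m ^ 5" by (simp flip: power_add)
    finally have "real j \<le> real m ^ 5" .
    moreover have "j > 0" using mj m by (intro Nat.gr0I) auto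
    ultimately have "ln (real j) \<le> ln (real m ^ 5)" by (intro ln_mono) auto
    also have "\<dots> = 5 * ln (real m)" using m by (simp add: ln_realpow)
    finally have lnj: "ln (real j) \<le> 5 * ln (real m)" .
    have w: "weight \<beta> z \<ge> 0" using weight_pos[OF z] by (simp add: less_imp_le)
    have r: "cmod (\<phi> z) \<le> 1" using \<phi> z by (force simp: less_imp_le)
    have "ln (real j) * (weight \<beta> z * cmod (\<sigma> z) * cmod (\<phi> z) ^ j)
        \<le> 5 * ln (real m) * (weight \<beta> z * cmod (\<sigma> z) * cmod (\<phi> z) ^ (2 * m\<^sup>2))"
      using lnj w r mj ln_of_nat_nonneg[of m] by (intro mult_mono power_decreasing) auto
    also have "\<dots> \<le> 5 * B" using N[OF m(1) z] by simp
    finally show ?thesis .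
  qed
  then show ?thesis unfolding eventual_bound_def eventually_sequentially by blast
qed

lemma sum_shifted_le_sums:
  fixes h :: "nat \<Rightarrow> real"
  assumes "h sums S" "\<And>j. h j \<ge> 0" "finite A" "\<And>k. k \<in> A \<Longrightarrow> k \<ge> 2"
  shows "(\<Sum>k\<in>A. h (k - 2)) \<le> S"
proof -
  have "inj_on (\<lambda>k. k - 2) A" using assms(4) by (intro inj_onI) (metis le_add_diff_inverse2)
  then have "(\<Sum>k\<in>A. h (k - 2)) = (\<Sum>j\<in>(\<lambda>k. k - 2) ` A. h j)" by (simp add: sum.reindex)
  also have "\<dots> \<le> suminf h" using assms by (intro sum_le_suminf) (auto simp: sums_iff)
  finally show ?thesis using assms(1) by (simp add: sums_iff)
qed

text \<open>The range of degrees of the logarithmic test functions. The upper end is the square of the lower one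
  so that the harmonic sum is comparable to the logarithm; blocks meeting the degrees 0 and 1 are
  replaced by the empty one.\<close>

definition square_block :: "nat \<Rightarrow> nat set" where
  "square_block n = (if n < 2 then {} else {n..n\<^sup>2})"

lemma square_block: "finite (square_block n)" "k \<in> square_block n \<Longrightarrow> k \<ge> 2 \<and> k \<ge> n"
  by (auto simp: square_block_def split: if_splits)

lemma sum_inverse_products_le:
  assumes "n \<ge> 2" "n \<le> N"
  shows "(\<Sum>k\<in>{n..N}. 1 / (2 * real k * real (k - 1))) \<le> 1 / real n"
proof -
  have "(\<Sum>k\<in>{n..m}. 1 / (real k * real (k - 1))) = 1 / real (n - 1) - 1 / real m" if "n \<le> m" for m
    using that
  proof (induction m rule: dec_induct)
    case base
    show ?case using assms(1) by (simp add: of_nat_diff field_simps)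
  next
    case (step m)
    have "m > 0" using assms(1) step by simp
    then have "1 / (real (Suc m) * real m) = 1 / real m - 1 / real (Suc m)" by (simp add: field_simps)
    then show ?case using step by simp
  qed
  from this[OF assms(2)]
  have "(\<Sum>k\<in>{n..N}. 1 / (real k * real (k - 1))) = 1 / real (n - 1) - 1 / real N" .
  also have "\<dots> \<le> 1 / real (n - 1)" by simp
  also have "\<dots> \<le> 2 / real n" using assms(1) by (simp add: field_simps of_nat_diff)
  finally have "(\<Sum>k\<in>{n..N}. 1 / (real k * real (k - 1))) / 2 \<le> 1 / real n" by simp
  then show ?thesis by (simp add: sum_divide_distrib mult_ac)
qed

lemma one_minus_square_le:
  fixes r :: real
  assumes "0 \<le> r" "r < 1"
  shows "1 - r\<^sup>2 \<le> 2 * (1 - r)" "0 \<le> 1 - r\<^sup>2"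
proof -
  have "1 - r\<^sup>2 = (1 + r) * (1 - r)" by (simp add: power2_eq_square algebra_simps)
  then show "1 - r\<^sup>2 \<le> 2 * (1 - r)" "0 \<le> 1 - r\<^sup>2" using assms mult_right_mono[of "1 + r" 2 "1 - r"] by auto
qed

text \<open>The test functions have second derivative \<open>(1/2) \<Sum> z ^ (k - 2)\<close> over a block \<open>n \<le> k \<le> n\<^sup>2\<close>, which is at
  most \<open>1 / (2 (1 - |z|))\<close>. The harmonic sum makes their derivatives as large as a multiple of \<open>ln n\<close>, up
  to a power of \<open>|\<phi> z|\<close>, while the functions themselves are of size \<open>1 / n\<close>, so the second symbol drops
  out.\<close>

lemma first_symbol_lower_log:
  assumes adm: "admissible 1 \<beta> \<phi> g" and M: "M > 0" and ess: "essential_norm 1 \<beta> (comp_volterra \<phi> g) < ereal M"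
  shows "eventual_bound (\<lambda>n. ln (real n)) \<beta> \<phi> (first_symbol \<phi> g) (5 * (6 * M))"
proof (rule eventual_bound_ln_from_squares)
  show \<phi>: "\<phi> ` unit_disc \<subseteq> unit_disc" using adm by (simp add: admissible_def)
  define b where "b k = 1 / (2 * real k * real (k - 1))" for k :: nat
  have b: "b k \<ge> 0" for k by (simp add: b_def)
  have bnd: "(1 - r\<^sup>2) powr 1 * (\<Sum>k\<in>square_block n. b k * real k * real (k - 1) * r ^ (k - 2)) \<le> 1"
    if r: "0 \<le> r" "r < 1" for n r
  proof -
    have "(\<Sum>k\<in>square_block n. b k * real k * real (k - 1) * r ^ (k - 2)) = (\<Sum>k\<in>square_block n. r ^ (k - 2)) / 2"
      unfolding sum_divide_distrib
    proof (rule sum.cong[OF refl])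
      fix k assume "k \<in> square_block n"
      then have "real k \<noteq> 0" "real (k - 1) \<noteq> 0" using square_block(2)[of k n] by auto
      moreover have "1 / (2 * p * q) * p * q * x = x / 2" if "p \<noteq> 0" "q \<noteq> 0" for p q x :: real
        using that by simp
      ultimately show "b k * real k * real (k - 1) * r ^ (k - 2) = r ^ (k - 2) / 2"
        unfolding b_def by blast
    qed
    also have "\<dots> \<le> 1 / (1 - r) / 2"
      using r square_block by (intro divide_right_mono sum_shifted_le_sums[OF geometric_sums]) auto
    finally have "(1 - r\<^sup>2) powr 1 * (\<Sum>k\<in>square_block n. b k * real k * real (k - 1) * r ^ (k - 2))
        \<le> (2 * (1 - r)) * (1 / (1 - r) / 2)"
      using one_minus_square_le[OF r] r by (intro mult_mono) (auto intro!: sum_nonneg simp: b)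
    also have "2 * (1 - r) * (1 / (1 - r) / 2) = 1"
    proof -
      have "2 * c * (1 / c / 2) = 1" if "c \<noteq> 0" for c :: real using that by simp
      from this[of "1 - r"] show ?thesis using r by simp
    qed
    finally show ?thesis .
  qed
  obtain B where B: "B > 0" "\<And>z. z \<in> unit_disc \<Longrightarrow> weight \<beta> z * cmod (second_symbol \<phi> g z) \<le> B"
    using symbols_bounded[OF adm] by metis
  have ev: "\<forall>\<^sub>F n in sequentially. \<forall>z\<in>unit_disc.
      weight \<beta> z * cmod (first_symbol \<phi> g z * cnj (sgn (\<phi> z)) * of_real (\<Sum>k\<in>square_block n. b k * real k * cmod (\<phi> z) ^ (k - 1))
        + second_symbol \<phi> g z * of_real (\<Sum>k\<in>square_block n. b k * cmod (\<phi> z) ^ k)) \<le> 2 * M"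
    by (rule essential_norm_lower[where b = "\<lambda>n k. b k" and A = square_block, OF adm zero_less_one M ess b square_block bnd])
  have "((\<lambda>n. B * (1 / real n)) \<longlongrightarrow> B * 0) sequentially" by (intro tendsto_intros lim_1_over_n)
  then have "\<forall>\<^sub>F n in sequentially. B * (1 / real n) < M"
    using M by (intro order_tendstoD(2)) auto
  with ev show "\<forall>\<^sub>F m in sequentially. \<forall>z\<in>unit_disc.
      ln (real m) * (weight \<beta> z * cmod (first_symbol \<phi> g z) * cmod (\<phi> z) ^ (2 * m\<^sup>2)) \<le> 6 * M"
    using eventually_ge_at_top[of 2]
  proof eventually_elim
    case (elim n)
    show ?case
    proof
      fix z assume z: "z \<in> unit_disc"
      define r where "r = cmod (\<phi> z)"
      have r: "0 \<le> r" "r \<le> 1" using \<phi> z by (force simp: less_imp_le r_def)+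
      have w: "weight \<beta> z \<ge> 0" using weight_pos[OF z] by (simp add: less_imp_le)
      have S: "square_block n = {n..n\<^sup>2}" using elim(3) by (simp add: square_block_def)
      define X where "X = (\<Sum>k\<in>square_block n. b k * real k * r ^ (k - 1))"
      define Y where "Y = (\<Sum>k\<in>square_block n. b k * r ^ k)"
      define u where "u = first_symbol \<phi> g z * cnj (sgn (\<phi> z)) * of_real X"
      define v where "v = second_symbol \<phi> g z * of_real Y"
      have XY: "X \<ge> 0" "Y \<ge> 0" using b r by (auto simp: X_def Y_def intro!: sum_nonneg)
      have uv: "weight \<beta> z * cmod (u + v) \<le> 2 * M" using elim(1) z by (simp add: u_def v_def X_def Y_def r_def)
      show "ln (real n) * (weight \<beta> z * cmod (first_symbol \<phi> g z) * cmod (\<phi> z) ^ (2 * n\<^sup>2)) \<le> 6 * M"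
      proof (cases "\<phi> z = 0")
        case True
        then show ?thesis using M elim(3) by (simp add: power_0_left)
      next
        case False
        have "Y \<le> (\<Sum>k\<in>square_block n. b k)"
          unfolding Y_def using r b by (intro sum_mono mult_left_le) (auto simp: power_le_one)
        also have "\<dots> \<le> 1 / real n"
          unfolding S b_def using elim(3) by (intro sum_inverse_products_le) (auto simp: power2_eq_square)
        finally have "Y \<le> 1 / real n" .
        then have "weight \<beta> z * cmod (second_symbol \<phi> g z) * Y \<le> B * (1 / real n)"
          using B z XY by (intro mult_mono) auto
        then have v: "weight \<beta> z * cmod v \<le> M" using elim(2) XY by (simp add: v_def norm_mult)
        have "cmod u \<le> cmod (u + v) + cmod v" using norm_triangle_ineq4[of "u + v" v] by simp
        then have "weight \<beta> z * cmod u \<le> weight \<beta> z * (cmod (u + v) + cmod v)" using w by (intro mult_left_mono)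
        then have u: "weight \<beta> z * cmod u \<le> 3 * M" using uv v by (simp add: distrib_left)
        have cu: "cmod u = cmod (first_symbol \<phi> g z) * X"
          using False XY by (simp add: u_def norm_mult norm_sgn)
        have "r ^ (2 * n\<^sup>2) * (ln (real n) / 2) \<le> r ^ (2 * n\<^sup>2) * ((\<Sum>k\<in>square_block n. 1 / real k) / 2)"
          using ln_le_harmonic_block[of n] elim(3) r unfolding S by (intro mult_left_mono divide_right_mono) auto
        also have "\<dots> \<le> X"
          unfolding X_def sum_distrib_left sum_divide_distrib
        proof (rule sum_mono)
          fix k assume k: "k \<in> square_block n"
          then have k': "k \<ge> 2" "k - 1 \<le> 2 * n\<^sup>2" using elim(3) by (auto simp: S)
          have "1 / real k / 2 \<le> b k * real k" using k' by (simp add: b_def field_simps)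
          then have "r ^ (2 * n\<^sup>2) * (1 / real k / 2) \<le> r ^ (k - 1) * (b k * real k)"
            using r k' by (intro mult_mono power_decreasing) auto
          then show "r ^ (2 * n\<^sup>2) * (1 / real k / 2) \<le> b k * real k * r ^ (k - 1)" by (simp add: mult_ac)
        qed
        finally have "r ^ (2 * n\<^sup>2) * (ln (real n) / 2) \<le> X" .
        then have "weight \<beta> z * cmod (first_symbol \<phi> g z) * (r ^ (2 * n\<^sup>2) * (ln (real n) / 2))
            \<le> weight \<beta> z * cmod (first_symbol \<phi> g z) * X"
          using w by (intro mult_left_mono) auto
        then have "weight \<beta> z * cmod (first_symbol \<phi> g z) * (r ^ (2 * n\<^sup>2) * (ln (real n) / 2)) \<le> 3 * M"
          using u by (simp add: cu mult.assoc)
        then show ?thesis by (simp add: r_def mult_ac)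
      qed
    qed
  qed
qed

text \<open>Here \<open>(1/4) \<Sum> z ^ k / k\<close> over the block is itself the test function. Its derivative at \<open>\<phi> z\<close> is at most the
  number of terms, hence of order \<open>n\<^sup>2\<close>; multiplying the estimate by \<open>|\<phi> z|\<close> to the power \<open>n\<^sup>2\<close> makes this
  harmless, because \<open>n\<^sup>2\<close> times that power times the first symbol is already bounded.\<close>

lemma second_symbol_lower_log:
  assumes adm: "admissible 2 \<beta> \<phi> g" and M: "M > 0" and ess: "essential_norm 2 \<beta> (comp_volterra \<phi> g) < ereal M"
    and first: "eventual_bound (\<lambda>n. real (n + 1)) \<beta> \<phi> (first_symbol \<phi> g) (C * M)"
  shows "eventual_bound (\<lambda>n. ln (real n)) \<beta> \<phi> (second_symbol \<phi> g) (5 * ((8 + C) * M))"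
proof (rule eventual_bound_ln_from_squares)
  show \<phi>: "\<phi> ` unit_disc \<subseteq> unit_disc" using adm by (simp add: admissible_def)
  define b where "b k = 1 / (4 * real k)" for k :: nat
  have b: "b k \<ge> 0" for k by (simp add: b_def)
  have bnd: "(1 - r\<^sup>2) powr 2 * (\<Sum>k\<in>square_block n. b k * real k * real (k - 1) * r ^ (k - 2)) \<le> 1"
    if r: "0 \<le> r" "r < 1" for n r
  proof -
    have "(\<Sum>k\<in>square_block n. b k * real k * real (k - 1) * r ^ (k - 2))
        = (\<Sum>k\<in>square_block n. real (Suc (k - 2)) * r ^ (k - 2)) / 4"
      unfolding sum_divide_distrib
    proof (rule sum.cong[OF refl])
      fix k assume "k \<in> square_block n"
      then have "real k \<noteq> 0" "k - 1 = Suc (k - 2)" using square_block(2)[of k n] by auto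
      then show "b k * real k * real (k - 1) * r ^ (k - 2) = real (Suc (k - 2)) * r ^ (k - 2) / 4"
        by (simp add: b_def)
    qed
    also have "\<dots> \<le> 1 / (1 - r)\<^sup>2 / 4"
      using r square_block
      by (intro divide_right_mono sum_shifted_le_sums[where h = "\<lambda>j. real (Suc j) * r ^ j"] geometric_deriv_sums) auto
    finally have "(1 - r\<^sup>2)\<^sup>2 * (\<Sum>k\<in>square_block n. b k * real k * real (k - 1) * r ^ (k - 2))
        \<le> (2 * (1 - r))\<^sup>2 * (1 / (1 - r)\<^sup>2 / 4)"
      using one_minus_square_le[OF r] r by (intro mult_mono power_mono) (auto intro!: sum_nonneg simp: b)
    also have "(2 * (1 - r))\<^sup>2 = 4 * (1 - r)\<^sup>2" by (simp add: power2_eq_square algebra_simps)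
    also have "4 * (1 - r)\<^sup>2 * (1 / (1 - r)\<^sup>2 / 4) = 1" using r by simp
    finally show ?thesis using one_minus_square_le(2)[OF r] by (cases "r\<^sup>2 = 1") (auto simp: powr_numeral)
  qed
  have ev: "\<forall>\<^sub>F n in sequentially. \<forall>z\<in>unit_disc.
      weight \<beta> z * cmod (first_symbol \<phi> g z * cnj (sgn (\<phi> z)) * of_real (\<Sum>k\<in>square_block n. b k * real k * cmod (\<phi> z) ^ (k - 1))
        + second_symbol \<phi> g z * of_real (\<Sum>k\<in>square_block n. b k * cmod (\<phi> z) ^ k)) \<le> 2 * M"
    by (rule essential_norm_lower[where b = "\<lambda>n k. b k" and A = square_block, OF adm zero_less_numeral M ess b square_block bnd])
  obtain N where N: "\<And>n z. n \<ge> N \<Longrightarrow> z \<in> unit_disc \<Longrightarrow>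
      real (n + 1) * (weight \<beta> z * cmod (first_symbol \<phi> g z) * cmod (\<phi> z) ^ n) \<le> C * M"
    using first unfolding eventual_bound_def eventually_sequentially by blast
  from ev show "\<forall>\<^sub>F m in sequentially. \<forall>z\<in>unit_disc.
      ln (real m) * (weight \<beta> z * cmod (second_symbol \<phi> g z) * cmod (\<phi> z) ^ (2 * m\<^sup>2)) \<le> (8 + C) * M"
    using eventually_ge_at_top[of "max 2 N"]
  proof eventually_elim
    case (elim n)
    have n: "n \<ge> 2" "n \<ge> N" "n\<^sup>2 \<ge> N"
      using elim(2) le_trans[of N n "n\<^sup>2"] by (auto simp: power2_eq_square)
    show ?case
    proof
      fix z assume z: "z \<in> unit_disc"
      define r where "r = cmod (\<phi> z)"
      have r: "0 \<le> r" "r \<le> 1" using \<phi> z by (force simp: less_imp_le r_def)+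
      have w: "weight \<beta> z \<ge> 0" using weight_pos[OF z] by (simp add: less_imp_le)
      have S: "square_block n = {n..n\<^sup>2}" using n by (simp add: square_block_def)
      define X where "X = (\<Sum>k\<in>square_block n. b k * real k * r ^ (k - 1))"
      define Y where "Y = (\<Sum>k\<in>square_block n. b k * r ^ k)"
      define u where "u = first_symbol \<phi> g z * cnj (sgn (\<phi> z)) * of_real X"
      define v where "v = second_symbol \<phi> g z * of_real Y"
      have XY: "X \<ge> 0" "Y \<ge> 0" using b r by (auto simp: X_def Y_def intro!: sum_nonneg)
      have uv: "weight \<beta> z * cmod (u + v) \<le> 2 * M" using elim(1) z by (simp add: u_def v_def X_def Y_def r_def)
      have "X \<le> (\<Sum>k\<in>square_block n. 1 / 4)"
        unfolding X_def
      proof (rule sum_mono)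
        fix k assume "k \<in> square_block n"
        then have e: "b k * real k = 1 / 4" using square_block(2)[of k n] by (auto simp: b_def)
        show "b k * real k * r ^ (k - 1) \<le> 1 / 4"
          using power_le_one[OF r, of "k - 1"] unfolding e by simp
      qed
      also have "\<dots> = real (card {n..n\<^sup>2}) / 4" by (simp only: S sum_constant)
      also have "\<dots> \<le> real (n\<^sup>2 + 1) / 4"
      proof (rule divide_right_mono)
        have "card {n..n\<^sup>2} \<le> n\<^sup>2 + 1" by simp
        then show "real (card {n..n\<^sup>2}) \<le> real (n\<^sup>2 + 1)" by (simp only: of_nat_le_iff)
      qed simp
      finally have X: "X \<le> real (n\<^sup>2 + 1) / 4" .
      have "cmod (first_symbol \<phi> g z) * cmod (cnj (sgn (\<phi> z))) * X \<le> cmod (first_symbol \<phi> g z) * 1 * X"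
        using XY by (intro mult_right_mono mult_left_mono) (auto simp: norm_sgn)
      then have "cmod u \<le> cmod (first_symbol \<phi> g z) * X" using XY by (simp add: u_def norm_mult)
      also have "\<dots> \<le> cmod (first_symbol \<phi> g z) * (real (n\<^sup>2 + 1) / 4)" using X by (intro mult_left_mono) auto
      finally have "r ^ n\<^sup>2 * (weight \<beta> z * cmod u) \<le> r ^ n\<^sup>2 * (weight \<beta> z * (cmod (first_symbol \<phi> g z) * (real (n\<^sup>2 + 1) / 4)))"
        using w r by (intro mult_left_mono) auto
      also have "\<dots> = real (n\<^sup>2 + 1) * (weight \<beta> z * cmod (first_symbol \<phi> g z) * r ^ n\<^sup>2) / 4"
        by (simp add: mult_ac)
      also have "\<dots> \<le> C * M / 4" using N[OF n(3) z] by (simp add: r_def)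
      finally have u: "r ^ n\<^sup>2 * (weight \<beta> z * cmod u) \<le> C * M / 4" .
      have uv': "r ^ n\<^sup>2 * (weight \<beta> z * cmod (u + v)) \<le> 2 * M"
        using mult_left_le_one_le[of "weight \<beta> z * cmod (u + v)" "r ^ n\<^sup>2"] uv r w
        by (simp add: power_le_one)
      have "cmod v \<le> cmod (u + v) + cmod u" using norm_triangle_ineq4[of "u + v" u] by simp
      then have "r ^ n\<^sup>2 * (weight \<beta> z * cmod v) \<le> r ^ n\<^sup>2 * (weight \<beta> z * (cmod (u + v) + cmod u))"
        using w r by (intro mult_left_mono) auto
      then have v: "r ^ n\<^sup>2 * (weight \<beta> z * cmod v) \<le> 2 * M + C * M / 4"
        using u uv' by (simp add: distrib_left)
      have "r ^ n\<^sup>2 * (ln (real n) / 4) \<le> r ^ n\<^sup>2 * ((\<Sum>k\<in>square_block n. 1 / real k) / 4)"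
        using ln_le_harmonic_block[of n] n r unfolding S by (intro mult_left_mono divide_right_mono) auto
      also have "\<dots> \<le> Y"
        unfolding Y_def sum_distrib_left sum_divide_distrib
      proof (rule sum_mono)
        fix k assume k: "k \<in> square_block n"
        have "r ^ n\<^sup>2 * b k \<le> r ^ k * b k"
          using r k b by (intro mult_right_mono power_decreasing) (auto simp: S)
        then show "r ^ n\<^sup>2 * (1 / real k / 4) \<le> b k * r ^ k" by (simp add: b_def mult_ac)
      qed
      finally have Y: "r ^ n\<^sup>2 * (ln (real n) / 4) \<le> Y" .
      have "r ^ (2 * n\<^sup>2) = r ^ n\<^sup>2 * r ^ n\<^sup>2" by (simp add: mult_2 power_add)
      then have "ln (real n) * (weight \<beta> z * cmod (second_symbol \<phi> g z) * r ^ (2 * n\<^sup>2))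
          = 4 * (r ^ n\<^sup>2 * (weight \<beta> z * (cmod (second_symbol \<phi> g z) * (r ^ n\<^sup>2 * (ln (real n) / 4)))))"
        by (simp add: mult_ac)
      also have "\<dots> \<le> 4 * (r ^ n\<^sup>2 * (weight \<beta> z * (cmod (second_symbol \<phi> g z) * Y)))"
        using w r Y by (intro mult_left_mono) auto
      also have "\<dots> = 4 * (r ^ n\<^sup>2 * (weight \<beta> z * cmod v))" using XY by (simp add: v_def norm_mult)
      also have "\<dots> \<le> 4 * (2 * M + C * M / 4)" using v by simp
      finally show "ln (real n) * (weight \<beta> z * cmod (second_symbol \<phi> g z) * cmod (\<phi> z) ^ (2 * n\<^sup>2)) \<le> (8 + C) * M"
        by (simp add: r_def algebra_simps)
    qed
  qed
qed

section \<open>Comparison of the essential norm with the asymptotic quantities\<close>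

text \<open>Strict bounds by positive reals suffice to compare two extended reals; the hypothesis says nothing
  about infinite \<open>x\<close>, where the conclusion is trivial.\<close>

lemma ereal_le_of_real_bounds:
  fixes x y :: ereal
  assumes "0 \<le> x" "C > 0" "\<And>M. M > 0 \<Longrightarrow> x < ereal M \<Longrightarrow> y \<le> ereal (C * M)"
  shows "y \<le> ereal C * x"
proof (cases x)
  case (real r)
  show ?thesis
  proof (rule ereal_le_epsilon2)
    fix e :: real assume e: "e > 0"
    have "y \<le> ereal (C * (r + e / C))"
      using assms e real by (intro assms(3)) (auto intro!: add_nonneg_pos)
    then show "y \<le> ereal C * x + ereal e" using assms(2) real by (simp add: distrib_left)
  qed
qed (use assms in auto)

lemma comparableI:
  fixes A B :: "'a \<Rightarrow> 'b \<Rightarrow> ereal"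
  assumes "C > 0" "C' > 0" "\<And>x y. P x y \<Longrightarrow> 0 \<le> A x y" "\<And>x y. P x y \<Longrightarrow> 0 \<le> B x y"
    and "\<And>x y M. P x y \<Longrightarrow> M > 0 \<Longrightarrow> A x y < ereal M \<Longrightarrow> B x y \<le> ereal (C * M)"
    and "\<And>x y M. P x y \<Longrightarrow> M > 0 \<Longrightarrow> B x y < ereal M \<Longrightarrow> A x y \<le> ereal (C' * M)"
  shows "comparable P A B"
  unfolding comparable_def
proof (rule exI[of _ "1 / C'"], rule exI[of _ C], intro conjI allI impI)
  fix x y assume P: "P x y"
  show "B x y \<le> ereal C * A x y" using assms P by (intro ereal_le_of_real_bounds) auto
  have "A x y \<le> ereal C' * B x y" using assms P by (intro ereal_le_of_real_bounds) auto
  then have "ereal (1 / C') * A x y \<le> ereal (1 / C') * (ereal C' * B x y)"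
    using assms(2) by (intro ereal_mult_left_mono) auto
  also have "\<dots> = B x y" using assms(2) by (simp flip: mult.assoc one_ereal_def)
  finally show "ereal (1 / C') * A x y \<le> B x y" .
qed (use assms in auto)

lemma limsup_weighted_norm_nonneg:
  assumes "\<And>n. c n \<ge> 0"
  shows "0 \<le> limsup (\<lambda>n. ereal (c n) * weighted_norm \<beta> (h n))"
proof -
  have "0 \<le> limsup (\<lambda>n::nat. 0 :: ereal)" by (simp add: Limsup_const)
  also have "\<dots> \<le> limsup (\<lambda>n. ereal (c n) * weighted_norm \<beta> (h n))"
    using assms by (intro Limsup_mono always_eventually) (auto simp: weighted_norm_nonneg)
  finally show ?thesis .
qed

theorem theorem3p2:
  fixes \<alpha> \<beta> :: real
  assumes "0 < \<alpha>" and "0 < \<beta>"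
  shows
    "(\<alpha> < 1 \<longrightarrow>
       (\<forall>\<phi> g. admissible \<alpha> \<beta> \<phi> g \<longrightarrow> essential_norm \<alpha> \<beta> (comp_volterra \<phi> g) = 0)) \<and>
     (\<alpha> = 1 \<longrightarrow>
       comparable (admissible \<alpha> \<beta>)
         (\<lambda>\<phi> g. essential_norm \<alpha> \<beta> (comp_volterra \<phi> g))
         (\<lambda>\<phi> g. limsup (\<lambda>n. ereal (ln (real n)) *
            weighted_norm \<beta> (\<lambda>z. first_symbol \<phi> g z * \<phi> z ^ n)))) \<and>
     (1 < \<alpha> \<and> \<alpha> < 2 \<longrightarrow>
       comparable (admissible \<alpha> \<beta>)
         (\<lambda>\<phi> g. essential_norm \<alpha> \<beta> (comp_volterra \<phi> g))
         (\<lambda>\<phi> g. limsup (\<lambda>n. ereal (real (n + 1) powr (\<alpha> - 1)) *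
            weighted_norm \<beta> (\<lambda>z. first_symbol \<phi> g z * \<phi> z ^ n)))) \<and>
     (\<alpha> = 2 \<longrightarrow>
       comparable (admissible \<alpha> \<beta>)
         (\<lambda>\<phi> g. essential_norm \<alpha> \<beta> (comp_volterra \<phi> g))
         (\<lambda>\<phi> g. max
            (limsup (\<lambda>n. ereal (real (n + 1)) *
               weighted_norm \<beta> (\<lambda>z. first_symbol \<phi> g z * \<phi> z ^ n)))
            (limsup (\<lambda>n. ereal (ln (real n)) *
               weighted_norm \<beta> (\<lambda>z. second_symbol \<phi> g z * \<phi> z ^ n))))) \<and>
     (2 < \<alpha> \<longrightarrow>
       comparable (admissible \<alpha> \<beta>)
         (\<lambda>\<phi> g. essential_norm \<alpha> \<beta> (comp_volterra \<phi> g))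
         (\<lambda>\<phi> g. max
            (limsup (\<lambda>n. ereal (real (n + 1) powr (\<alpha> - 1)) *
               weighted_norm \<beta> (\<lambda>z. first_symbol \<phi> g z * \<phi> z ^ n)))
            (limsup (\<lambda>n. ereal (real (n + 1) powr (\<alpha> - 2)) *
               weighted_norm \<beta> (\<lambda>z. second_symbol \<phi> g z * \<phi> z ^ n)))))"
proof (intro conjI impI)
  note \<alpha> = \<open>0 < \<alpha>\<close>
  let ?E = "\<lambda>\<phi> g. essential_norm \<alpha> \<beta> (comp_volterra \<phi> g)"
  let ?L\<^sub>1 = "\<lambda>c \<phi> g. limsup (\<lambda>n. ereal (c n) * weighted_norm \<beta> (\<lambda>z. first_symbol \<phi> g z * \<phi> z ^ n))"
  let ?L\<^sub>2 = "\<lambda>c \<phi> g. limsup (\<lambda>n. ereal (c n) * weighted_norm \<beta> (\<lambda>z. second_symbol \<phi> g z * \<phi> z ^ n))"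
  let ?log = "\<lambda>n. ln (real n)"
  let ?pow = "\<lambda>p n. real (n + 1) powr p"
  have inv: "\<phi> ` unit_disc \<subseteq> unit_disc" if "admissible \<alpha> \<beta> \<phi> g" for \<phi> g
    using that by (simp add: admissible_def)
  have ln_pos: "\<forall>\<^sub>F n in sequentially. 0 < ln (real n)"
    using eventually_gt_at_top[of 1] by eventually_elim simp
  \<comment> \<open>upper constant for the first symbol: growth constant of \<open>f'\<close>, once for \<open>f\<close> and once for its dilation,
    times the loss 6 at the critical exponent\<close>
  define k where "k = 2 * (1 + 1 / (\<alpha> - 1) + 0) * 6"
  {
    assume \<alpha>1: "\<alpha> < 1"
    show "\<forall>\<phi> g. admissible \<alpha> \<beta> \<phi> g \<longrightarrow> ?E \<phi> g = 0"
    proof (intro allI impI antisym essential_norm_nonneg)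
      fix \<phi> g assume adm: "admissible \<alpha> \<beta> \<phi> g"
      have "\<alpha> < 2" using \<alpha>1 by simp
      then show "?E \<phi> g \<le> 0"
        using essential_norm_upper[OF adm \<alpha> order_refl order_refl
            negligible_derivatives[OF adm \<alpha> \<alpha>1] negligible_values[OF adm \<alpha>]]
        by (simp add: zero_ereal_def)
    qed
  next
    assume \<alpha>1: "\<alpha> = 1"
    show "comparable (admissible \<alpha> \<beta>) ?E (?L\<^sub>1 ?log)"
    proof (rule comparableI[where C = "5 * 6" and C' = "2 * (1 + 1) * 12"])
      fix \<phi> g M assume adm: "admissible \<alpha> \<beta> \<phi> g" and M: "(0::real) < M"
      show "?L\<^sub>1 ?log \<phi> g \<le> ereal (5 * 6 * M)" if "?E \<phi> g < ereal M"
        using limsup_of_eventual_bound[OF first_symbol_lower_log[OF adm[unfolded \<alpha>1] M that[unfolded \<alpha>1]] ln_pos]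
        by simp
      show "?E \<phi> g \<le> ereal (2 * (1 + 1) * 12 * M)" if "?L\<^sub>1 ?log \<phi> g < ereal M"
      proof -
        have "dilation_defect_le \<alpha> \<beta> \<phi> (first_symbol \<phi> g) deriv of_real (2 * (1 + 1) * (12 * M))"
          unfolding \<alpha>1
          by (rule derivative_defect_log[OF inv[OF adm] eventual_bound_of_limsup[OF that ln_of_nat_nonneg]])
        from essential_norm_upper[OF adm \<alpha> _ order_refl this negligible_values[OF adm \<alpha>]] show ?thesis
          using M \<alpha>1 by simp
      qed
    qed (auto simp: essential_norm_nonneg intro!: limsup_weighted_norm_nonneg ln_of_nat_nonneg)
  next
    assume \<alpha>12: "1 < \<alpha> \<and> \<alpha> < 2"
    then have \<alpha>1: "1 < \<alpha>" and \<alpha>2: "\<alpha> < 2" by auto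
    have pos: "monomial_constant \<alpha> + 1 > 0" "k > 0"
      using lower_constants_pos(1)[OF \<alpha>] \<alpha>1 by (auto simp: k_def intro!: add_pos_pos)
    show "comparable (admissible \<alpha> \<beta>) ?E (?L\<^sub>1 (?pow (\<alpha> - 1)))"
    proof (rule comparableI[OF pos])
      fix \<phi> g M assume adm: "admissible \<alpha> \<beta> \<phi> g" and M: "(0::real) < M"
      show "?L\<^sub>1 (?pow (\<alpha> - 1)) \<phi> g \<le> ereal ((monomial_constant \<alpha> + 1) * M)" if "?E \<phi> g < ereal M"
        by (rule limsup_of_eventual_bound[OF first_symbol_lower_intermediate[OF adm \<alpha>1 \<alpha>2 M that]]) simp
      show "?E \<phi> g \<le> ereal (k * M)" if "?L\<^sub>1 (?pow (\<alpha> - 1)) \<phi> g < ereal M"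
      proof -
        have "dilation_defect_le \<alpha> \<beta> \<phi> (first_symbol \<phi> g) deriv of_real (k * M)"
          using derivative_defect_power[OF inv[OF adm] \<alpha>1 eventual_bound_of_limsup[OF that powr_ge_zero]]
          by (simp only: k_def mult.assoc)
        from essential_norm_upper[OF adm \<alpha> _ order_refl this negligible_values[OF adm \<alpha> \<alpha>2]] show ?thesis
          using M pos by simp
      qed
    qed (auto simp: essential_norm_nonneg intro!: limsup_weighted_norm_nonneg)
  next
    assume \<alpha>2: "\<alpha> = 2"
    then have \<alpha>1: "1 < \<alpha>" and \<alpha>2': "2 \<le> \<alpha>" by auto
    have powr1: "?pow (\<alpha> - 1) = (\<lambda>n. real (n + 1))" by (auto simp: \<alpha>2)
    define D where "D = 5 * (8 + first_constant \<alpha>)"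
    define D' where "D' = k + 2 * (2 + 1) * (12::real)"
    have D: "D > 0" "D' > 0" "first_constant \<alpha> \<le> D"
      using lower_constants_pos(2)[OF \<alpha>] by (auto simp: D_def D'_def k_def \<alpha>2)
    show "comparable (admissible \<alpha> \<beta>) ?E (\<lambda>\<phi> g. max (?L\<^sub>1 (\<lambda>n. real (n + 1)) \<phi> g) (?L\<^sub>2 ?log \<phi> g))"
    proof (rule comparableI[OF D(1,2)])
      fix \<phi> g M assume adm: "admissible \<alpha> \<beta> \<phi> g" and M: "(0::real) < M"
      show "max (?L\<^sub>1 (\<lambda>n. real (n + 1)) \<phi> g) (?L\<^sub>2 ?log \<phi> g) \<le> ereal (D * M)" if ess: "?E \<phi> g < ereal M"
      proof (rule max.boundedI)
        note first = first_symbol_lower_large[OF adm \<alpha>2' M ess, unfolded powr1]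
        have le: "ereal (first_constant \<alpha> * M) \<le> ereal (D * M)" using D M by simp
        show "?L\<^sub>1 (\<lambda>n. real (n + 1)) \<phi> g \<le> ereal (D * M)"
          by (rule order_trans[OF limsup_of_eventual_bound[OF first] le]) simp
        show "?L\<^sub>2 ?log \<phi> g \<le> ereal (D * M)"
          using limsup_of_eventual_bound[OF second_symbol_lower_log[OF adm[unfolded \<alpha>2] M ess[unfolded \<alpha>2] first] ln_pos]
          by (simp only: D_def mult.assoc)
      qed
      show "?E \<phi> g \<le> ereal (D' * M)"
        if lim: "max (?L\<^sub>1 (\<lambda>n. real (n + 1)) \<phi> g) (?L\<^sub>2 ?log \<phi> g) < ereal M"
      proof -
        have first: "eventual_bound (?pow (\<alpha> - 1)) \<beta> \<phi> (first_symbol \<phi> g) M"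
          unfolding powr1 by (rule eventual_bound_of_limsup) (use lim in auto)
        have second: "eventual_bound ?log \<beta> \<phi> (second_symbol \<phi> g) M"
          by (rule eventual_bound_of_limsup) (use lim ln_of_nat_nonneg in auto)
        have "dilation_defect_le \<alpha> \<beta> \<phi> (first_symbol \<phi> g) deriv of_real (k * M)"
          using derivative_defect_power[OF inv[OF adm] \<alpha>1 first] by (simp only: k_def mult.assoc)
        moreover have "dilation_defect_le \<alpha> \<beta> \<phi> (second_symbol \<phi> g) (\<lambda>f. f) (\<lambda>_. 1) (2 * (2 + 1) * (12 * M))"
          unfolding \<alpha>2 by (rule value_defect_log[OF inv[OF adm] second])
        ultimately have "?E \<phi> g \<le> ereal (k * M + 2 * (2 + 1) * (12 * M))"
          using M by (intro essential_norm_upper[OF adm \<alpha>]) (auto simp: k_def \<alpha>2)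
        then show ?thesis by (simp add: D'_def algebra_simps)
      qed
    qed (auto simp: essential_norm_nonneg le_max_iff_disj intro!: limsup_weighted_norm_nonneg)
  next
    assume \<alpha>2: "2 < \<alpha>"
    then have \<alpha>1: "1 < \<alpha>" and \<alpha>2': "2 \<le> \<alpha>" by auto
    define D where "D = first_constant \<alpha> + second_constant \<alpha>"
    define k\<^sub>2 where "k\<^sub>2 = 2 * (1 + (1 + 1 / (\<alpha> - 1)) / (\<alpha> - 2) + 0) * 6"
    have k: "k > 0" "k\<^sub>2 > 0" using \<alpha>2 by (auto simp: k_def k\<^sub>2_def intro!: add_pos_pos divide_pos_pos)
    have D: "D > 0" "k + k\<^sub>2 > 0" "first_constant \<alpha> \<le> D" "second_constant \<alpha> \<le> D"
      using lower_constants_pos[OF \<alpha>] k by (auto simp: D_def)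
    let ?B = "\<lambda>\<phi> g. max (?L\<^sub>1 (?pow (\<alpha> - 1)) \<phi> g) (?L\<^sub>2 (?pow (\<alpha> - 2)) \<phi> g)"
    show "comparable (admissible \<alpha> \<beta>) ?E ?B"
    proof (rule comparableI[OF D(1,2)])
      fix \<phi> g M assume adm: "admissible \<alpha> \<beta> \<phi> g" and M: "(0::real) < M"
      show "?B \<phi> g \<le> ereal (D * M)" if ess: "?E \<phi> g < ereal M"
      proof (rule max.boundedI)
        have le: "ereal (first_constant \<alpha> * M) \<le> ereal (D * M)" "ereal (second_constant \<alpha> * M) \<le> ereal (D * M)"
          using D M by simp_all
        show "?L\<^sub>1 (?pow (\<alpha> - 1)) \<phi> g \<le> ereal (D * M)"
          by (rule order_trans[OF limsup_of_eventual_bound[OF first_symbol_lower_large[OF adm \<alpha>2' M ess]] le(1)]) simp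
        show "?L\<^sub>2 (?pow (\<alpha> - 2)) \<phi> g \<le> ereal (D * M)"
          by (rule order_trans[OF limsup_of_eventual_bound[OF second_symbol_lower_large[OF adm \<alpha>2' M ess]] le(2)]) simp
      qed
      show "?E \<phi> g \<le> ereal ((k + k\<^sub>2) * M)" if lim: "?B \<phi> g < ereal M"
      proof -
        have first: "eventual_bound (?pow (\<alpha> - 1)) \<beta> \<phi> (first_symbol \<phi> g) M"
          by (rule eventual_bound_of_limsup) (use lim in auto)
        have second: "eventual_bound (?pow (\<alpha> - 2)) \<beta> \<phi> (second_symbol \<phi> g) M"
          by (rule eventual_bound_of_limsup) (use lim in auto)
        have "dilation_defect_le \<alpha> \<beta> \<phi> (first_symbol \<phi> g) deriv of_real (k * M)"
          using derivative_defect_power[OF inv[OF adm] \<alpha>1 first] by (simp only: k_def mult.assoc)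
        moreover have "dilation_defect_le \<alpha> \<beta> \<phi> (second_symbol \<phi> g) (\<lambda>f. f) (\<lambda>_. 1) (k\<^sub>2 * M)"
          using value_defect_power[OF inv[OF adm] \<alpha>2 second] by (simp only: k\<^sub>2_def mult.assoc)
        ultimately have "?E \<phi> g \<le> ereal (k * M + k\<^sub>2 * M)"
          using M k by (intro essential_norm_upper[OF adm \<alpha>]) auto
        then show ?thesis by (simp add: distrib_right)
      qed
    qed (auto simp: essential_norm_nonneg le_max_iff_disj intro!: limsup_weighted_norm_nonneg)
  }
qed

end
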